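(* Let $n\ge 1$ and $m\ge 0$ be integers. Then $$\sum_{A} \operatorname{sgn}(A) \;=\; 3^{\binom{n+1}{2}} \prod_{i=1}^n \frac{(2n+m+2-3i)_i}{(i)_i},$$ where the sum is over all arrowed Gelfand–Tsetlin patterns $A$ with $n$ rows in which no entry is decorated with the double arrow $\nwarrow\nearrow$, whose entries are all integers in $\{0,1,\ldots,m\}$, and whose bottom row is strictly increasing.
   Context: A Gelfand–Tsetlin pattern with $n$ rows is a triangular array of integers $(a_{i,j})_{1\le j\le i\le n}$, row $i$ being $a_{i,1},\ldots,a_{i,i}$, drawn so that $a_{i-1,j}$ sits between $a_{i,j}$ and $a_{i,j+1}$, satisfying $a_{i+1,j}\le a_{i,j}\le a_{i+1,j+1}$ for all $1\le j\le i<n$. Row $n$ is the bottom row. For an entry $a_{i,j}$: its $\nwarrow$-neighbor is $a_{i-1,j-1}$ and its $\nearrow$-neighbor is $a_{i-1,j}$ (when they exist), its $\swarrow$-neighbor is $a_{i+1,j}$ and its $\searrow$-neighbor is $a_{i+1,j+1}$, and its left/right neighbors are $a_{i,j-1}$, $a_{i,j+1}$. An arrowed Gelfand–Tsetlin pattern is a Gelfand–Tsetlin pattern in which each entry either carries no decoration or carries exactly one decoration from $\{\nwarrow,\nearrow,\nwarrow\nearrow\}$ (the last one is called the double arrow), subject to: if an entry $a$ equals its $\nearrow$-neighbor and is decorated with $\nearrow$ or $\nwarrow\nearrow$, then the entry to the right of $a$ in the same row also equals $a$ and is decorated with $\nwarrow$ or $\nwarrow\nearrow$; and if $a$ equals its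 $\nwarrow$-neighbor and is decorated with $\nwarrow$ or $\nwarrow\nearrow$, then the entry to the left of $a$ in the same row also equals $a$ and is decorated with $\nearrow$ or $\nwarrow\nearrow$. A special little triangle is an entry $a$ that equals both its $\swarrow$-neighbor $b$ and its $\searrow$-neighbor $c$, where $b$ is decorated with $\nearrow$ or $\nwarrow\nearrow$ and $c$ is decorated with $\nwarrow$ or $\nwarrow\nearrow$. The sign is $\operatorname{sgn}(A)=(-1)^{\#\text{special little triangles in }A}$. Pochhammer symbol: $(a)_k=a(a+1)\cdots(a+k-1)$, $(a)_0=1$. *)

theory Defs
  imports Complex_Main
begin

datatype deco = NoArr | NW | NE | Both

definition has_NE :: "deco \<Rightarrow> bool" where
  "has_NE x \<longleftrightarrow> x = NE \<or> x = Both"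

definition has_NW :: "deco \<Rightarrow> bool" where
  "has_NW x \<longleftrightarrow> x = NW \<or> x = Both"

text \<open>A pattern with n rows: entry a i j (row i, position j) for 1 <= j <= i <= n,
  decoration d i j.  Outside the triangle the functions take default values
  (0, resp. NoArr), so that patterns are determined by their entries.\<close>

definition in_tri :: "nat \<Rightarrow> nat \<Rightarrow> nat \<Rightarrow> bool" where
  "in_tri n i j \<longleftrightarrow> 1 \<le> j \<and> j \<le> i \<and> i \<le> n"

definition is_GT :: "nat \<Rightarrow> (nat \<Rightarrow> nat \<Rightarrow> int) \<Rightarrow> bool" where
  "is_GT n a \<longleftrightarrow>
     (\<forall>i j. \<not> in_tri n i j \<longrightarrow> a i j = 0) \<and>
     (\<forall>i j. 1 \<le> j \<and> j \<le> i \<and> i < n \<longrightarrow> a (i+1) j \<le> a i j \<and> a i j \<le> a (i+1) (j+1))"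

definition is_arrowed_GT :: "nat \<Rightarrow> (nat \<Rightarrow> nat \<Rightarrow> int) \<Rightarrow> (nat \<Rightarrow> nat \<Rightarrow> deco) \<Rightarrow> bool" where
  "is_arrowed_GT n a d \<longleftrightarrow>
     is_GT n a \<and>
     (\<forall>i j. \<not> in_tri n i j \<longrightarrow> d i j = NoArr) \<and>
     \<comment> \<open>NE-neighbour of (i,j) is (i-1,j), existing when i >= 2 and j <= i-1\<close>
     (\<forall>i j. in_tri n i j \<and> 2 \<le> i \<and> j \<le> i - 1 \<and> a i j = a (i-1) j \<and> has_NE (d i j) \<longrightarrow>
        j + 1 \<le> i \<and> a i (j+1) = a i j \<and> has_NW (d i (j+1))) \<and>
     \<comment> \<open>NW-neighbour of (i,j) is (i-1,j-1), existing when i >= 2 and j >= 2\<close>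
     (\<forall>i j. in_tri n i j \<and> 2 \<le> i \<and> 2 \<le> j \<and> a i j = a (i-1) (j-1) \<and> has_NW (d i j) \<longrightarrow>
        a i (j-1) = a i j \<and> has_NE (d i (j-1)))"

definition special_triangles :: "nat \<Rightarrow> (nat \<Rightarrow> nat \<Rightarrow> int) \<Rightarrow> (nat \<Rightarrow> nat \<Rightarrow> deco) \<Rightarrow> (nat \<times> nat) set" where
  "special_triangles n a d =
     {(i, j). 1 \<le> j \<and> j \<le> i \<and> i < n \<and>
        a i j = a (i+1) j \<and> a i j = a (i+1) (j+1) \<and>
        has_NE (d (i+1) j) \<and> has_NW (d (i+1) (j+1))}"

definition sgn_AGT :: "nat \<Rightarrow> (nat \<Rightarrow> nat \<Rightarrow> int) \<Rightarrow> (nat \<Rightarrow> nat \<Rightarrow> deco) \<Rightarrow> int" where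
  "sgn_AGT n a d = (-1) ^ card (special_triangles n a d)"

definition AGT_set :: "nat \<Rightarrow> nat \<Rightarrow> ((nat \<Rightarrow> nat \<Rightarrow> int) \<times> (nat \<Rightarrow> nat \<Rightarrow> deco)) set" where
  "AGT_set n m =
     {(a, d). is_arrowed_GT n a d \<and>
        (\<forall>i j. in_tri n i j \<longrightarrow> d i j \<noteq> Both) \<and>
        (\<forall>i j. in_tri n i j \<longrightarrow> 0 \<le> a i j \<and> a i j \<le> int m) \<and>
        (\<forall>j. 1 \<le> j \<and> j < n \<longrightarrow> a n j < a n (j+1))}"

end

(*
  Attach a variable x_i to row i and weight a pattern by
  x_i^(sum of row i - sum of row i-1 + #NE - #NW).  Removing the bottom row turns the signed,
  weighted sum over patterns with bottom row k into
    (PROD i. 1 + x_i + 1/x_i) * G k {x_1, ..., x_n},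
  where G symmetrizes PROD x_i^(k_i) PROD_{i<j} (1 + x_j + x_i x_j)/(x_j - x_i): in the geometric
  sums over the next row, every term in which some entry k_j is used by both of its neighbours
  cancels by antisymmetry.  Summing G over strictly increasing k in [0, N) gives a bounded
  Littlewood identity; with f(x) = x + x^2 and M = N + 2n - 2 its right-hand side is, up to
  elementary factors, the determinant of f(x_i)^l - x_i^M f(1/x_i)^l.  It follows by induction
  on N from a Lagrange interpolation identity.

  Putting x_i = r^(2i) and letting r tend to 1 leaves the determinant of
  SUM_c [x^c] f(x)^l * (2c - M)^(2i+1), a polynomial in M.  At an integer M = v all columns l with
  2l <= v <= 3l vanish after a unitriangular column operation, because f^a (f+1)^(l-a) is palindromic
  around v/2 for a = v - 2l; this gives all the linear factors.  The behaviour as M tends to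
  infinity, read off in the basis (f-2)^l, shows that the cofactor is constant and computes it.
*)
theory Submission
  imports Defs "Jordan_Normal_Form.Determinant"
begin

section \<open>Transfer of one row\<close>

text \<open>Interior rows are only weakly increasing, and the decoration rules couple neighbouring
  entries. Both obstacles vanish once the choice of a next-row entry between k and k' is written as
  a sum from k + [NE] to k' - [NW] that may run backwards: an entry violating a rule lies outside
  the range, and a special little triangle is a backward sum with a single term. Such sums obey the
  geometric formula for every choice of decorations. The three admissible decorations contribute 1,
  x and 1/x. This gives the factor 1 + x + 1/x, which tends to 3, and also the numerator of the
  kernel. The closed form of the sum of G has denominators x_j - x_i, 1 - x_i and 1 - x_i x_j, so
  the unweighted count, with all variables equal to 1, is reachable only as a limit. The exponents
  2i are even so that x_i^c - x_i^(M-c) = r^(M i) (w^i - w^(-i)) holds with w = r^(2c-M), without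
  square roots. The constant in f - 2 is f(1).\<close>

definition kern :: "real \<Rightarrow> real \<Rightarrow> real" where
  "kern x y = (1 + y + x * y) / (y - x)"

definition omega :: "real \<Rightarrow> real set \<Rightarrow> real" where
  "omega x X = (\<Prod>y\<in>X - {x}. kern x y)"

text \<open>Unrolled, this runs over all orderings of \<open>X\<close>: the variable chosen first
  receives the first exponent, and \<open>omega\<close> collects its kernels with all later
  variables. As \<open>X\<close> is a set, symmetry in the variables is built in. The intended lists
  have length \<open>card X\<close>.\<close>

fun G :: "int list \<Rightarrow> real set \<Rightarrow> real" where
  "G [] X = 1"
| "G (k # ks) X = (\<Sum>x\<in>X. x powi k * omega x X * G ks (X - {x}))"

text \<open>The continuation of the sum over \<open>{lo..hi}\<close> for which \<open>esum_geometric\<close> holds for all bounds.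
  For \<open>lo = hi + 2\<close> it consists of one term with a minus sign, which is the special little triangle.\<close>

definition esum :: "int \<Rightarrow> int \<Rightarrow> (int \<Rightarrow> real) \<Rightarrow> real" where
  "esum lo hi f = (if lo \<le> hi + 1 then (\<Sum>l=lo..hi. f l) else - (\<Sum>l=hi+1..lo-1. f l))"

lemma esum_sum: "esum lo hi (\<lambda>l. \<Sum>y\<in>A. c y * f y l) = (\<Sum>y\<in>A. c y * esum lo hi (f y))"
proof -
  have "(\<Sum>l\<in>B. \<Sum>y\<in>A. c y * f y l) = (\<Sum>y\<in>A. c y * (\<Sum>l\<in>B. f y l))" for B :: "int set"
    by (subst sum.swap) (simp add: sum_distrib_left)
  then show ?thesis
    by (simp add: esum_def sum_negf)
qed

lemma geometric_sum_int:
  fixes q :: real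
  assumes "q \<noteq> 0" "q \<noteq> 1" "lo \<le> hi + 1"
  shows "(\<Sum>l=lo..hi. q powi l) = (q powi (hi + 1) - q powi lo) / (q - 1)"
proof -
  have "lo \<le> h + 1 \<Longrightarrow> (\<Sum>l=lo..h. q powi l) = (q powi (h + 1) - q powi lo) / (q - 1)"
    if "h \<ge> lo - 1" for h
    using that
  proof (induction h rule: int_ge_induct)
    case base
    then show ?case by simp
  next
    case (step i)
    have "{lo..i+1} = insert (i+1) {lo..i}" using step by auto
    moreover have "q powi (i + 2) = q powi (i+1) * q"
      using assms power_int_add[of q "i+1" 1] by (simp add: add.commute add.left_commute)
    ultimately show ?case
      using step assms by (simp add: field_simps)
  qed
  then show ?thesis using assms by simp
qed

lemma esum_geometric:
  assumes "q \<noteq> 0" "q \<noteq> 1"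
  shows "esum lo hi (\<lambda>l. q powi l) = (q powi (hi + 1) - q powi lo) / (q - 1)"
  using geometric_sum_int[OF assms, of lo hi] geometric_sum_int[OF assms, of "hi+1" "lo-1"]
  by (auto simp: esum_def) (metis minus_diff_eq minus_divide_left)

section \<open>Transfer operators for decorations without the double arrow\<close>

definition decos :: "deco set" where "decos = {NoArr, NE, NW}"

definition up :: "deco \<Rightarrow> int" where "up d = (if has_NE d then 1 else 0)"

definition dn :: "deco \<Rightarrow> int" where "dn d = (if has_NW d then 1 else 0)"

lemma sum_decos: "(\<Sum>d\<in>decos. f d) = (f NoArr + f NE + f NW :: real)"
  by (simp add: decos_def)

lemma up_dn_simps [simp]:
  "up NoArr = 0" "up NE = 1" "up NW = 0" "dn NoArr = 0" "dn NE = 0" "dn NW = 1"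
  by (auto simp: up_def dn_def has_NE_def has_NW_def)

text \<open>The next row is produced from left to right. \<open>lo\<close> is the lower limit for
  its next entry \<open>l\<close> and already contains the arrow of the entry to the left; the arrow
  at \<open>k\<close> affects the upper limit of \<open>l\<close> and the lower limit of the entry
  after \<open>l\<close>.\<close>

fun transfer :: "real \<Rightarrow> int \<Rightarrow> int list \<Rightarrow> (int list \<Rightarrow> real) \<Rightarrow> real" where
  "transfer X lo [] F = F []"
| "transfer X lo (k # ks) F =
     (\<Sum>d\<in>decos. X powi (k + up d - dn d) *
        esum lo (k - dn d) (\<lambda>l. X powi (-l) * transfer X (k + up d) ks (\<lambda>ls. F (l # ls))))"

text \<open>The first entry has no next-row entry to its left, so it only sets a lower
  limit.\<close>

fun row_transfer :: "real \<Rightarrow> int list \<Rightarrow> (int list \<Rightarrow> real) \<Rightarrow> real" where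
  "row_transfer X [] F = 1"
| "row_transfer X (k # ks) F =
     (\<Sum>d\<in>decos. X powi (k + up d - dn d) * transfer X (k + up d) ks F)"

lemma transfer_sum:
  "transfer X lo ks (\<lambda>ls. \<Sum>y\<in>A. c y * F y ls) = (\<Sum>y\<in>A. c y * transfer X lo ks (F y))"
proof (induction ks arbitrary: lo F)
  case Nil
  then show ?case by simp
next
  case (Cons k ks)
  have "X powi (- l) * transfer X lo' ks (\<lambda>ls. \<Sum>y\<in>A. c y * F y (l # ls)) =
      (\<Sum>y\<in>A. c y * (X powi (- l) * transfer X lo' ks (\<lambda>ls. F y (l # ls))))" for l lo'
    unfolding Cons.IH[of lo' "\<lambda>y ls. F y (l # ls)"] sum_distrib_left
    by (simp only: mult.left_commute)
  then have "transfer X lo (k # ks) (\<lambda>ls. \<Sum>y\<in>A. c y * F y ls) =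
      (\<Sum>d\<in>decos. X powi (k + up d - dn d) * (\<Sum>y\<in>A. c y *
        esum lo (k - dn d) (\<lambda>l. X powi (-l) * transfer X (k + up d) ks (\<lambda>ls. F y (l # ls)))))"
    by (simp only: transfer.simps esum_sum)
  also have "\<dots> = (\<Sum>y\<in>A. c y * transfer X lo (k # ks) (F y))"
    unfolding transfer.simps sum_distrib_left sum.swap[of _ decos]
    by (simp only: mult.left_commute)
  finally show ?case .
qed

lemma antisymmetric_sum_zero:
  fixes H :: "'a \<Rightarrow> 'a \<Rightarrow> real"
  assumes "finite Z" "\<And>y z. y \<in> Z \<Longrightarrow> z \<in> Z \<Longrightarrow> y \<noteq> z \<Longrightarrow> H y z = - H z y"
  shows "(\<Sum>y\<in>Z. \<Sum>z\<in>Z-{y}. H y z) = 0"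
proof -
  define K where "K y z = (if y = z then 0 else H y z)" for y z
  have "(\<Sum>z\<in>Z-{y}. H y z) = (\<Sum>z\<in>Z. K y z)" for y
  proof -
    have "(\<Sum>z\<in>Z-{y}. H y z) = (\<Sum>z\<in>Z-{y}. K y z)"
      by (rule sum.cong) (auto simp: K_def)
    also have "\<dots> = (\<Sum>z\<in>Z. K y z)"
      by (rule sum.mono_neutral_left) (use assms in \<open>auto simp: K_def\<close>)
    finally show ?thesis .
  qed
  moreover have "(\<Sum>y\<in>Z. \<Sum>z\<in>Z. K y z) = (\<Sum>z\<in>Z. \<Sum>y\<in>Z. K y z)"
    by (rule sum.swap)
  moreover have "(\<Sum>z\<in>Z. \<Sum>y\<in>Z. K y z) = (\<Sum>z\<in>Z. \<Sum>y\<in>Z. - K z y)"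
  proof (intro sum.cong refl)
    fix y z assume "y \<in> Z" "z \<in> Z"
    then show "K y z = - K z y"
      using assms(2)[of y z] by (cases "y = z") (simp_all add: K_def)
  qed
  ultimately show ?thesis by (simp add: sum_negf)
qed

lemma omega_remove: 
  assumes "finite Z" "z \<in> Z" "y \<noteq> z"
  shows "omega y Z = kern y z * omega y (Z - {z})"
proof -
  have "Z - {y} = insert z (Z - {z} - {y})" using assms by auto
  then show ?thesis using assms by (simp add: omega_def)
qed

text \<open>Up to a power of \<open>X\<close>, the part of the symmetrization over
  \<open>insert X Z\<close> in which \<open>X\<close> receives the exponent preceding
  \<open>ks\<close>.\<close>

definition upper :: "real \<Rightarrow> int list \<Rightarrow> real set \<Rightarrow> real" where
  "upper X ks Z = (\<Prod>y\<in>Z. kern X y) * G ks Z"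

text \<open>Each geometric sum splits into its values at the two limits. If the leftmost one uses
  \<open>lo\<close>, a variable \<open>y\<close> is consumed and a full row transfer on
  \<open>Z - {y}\<close> remains. If it uses the upper limit, the induction hypothesis splits the
  rest again; entries used from both sides cancel, and \<open>upper\<close> is left.
  \<open>lo\<close> stays arbitrary because it depends on the preceding decoration.\<close>

lemma transfer_G_expand:
  assumes "finite Z" "X \<notin> Z" "X \<noteq> 0" "0 \<notin> Z" "length ks = card Z"
  shows "transfer X lo ks (\<lambda>ls. G ls Z) = upper X ks Z -
    (\<Sum>y\<in>Z. omega y Z * ((y/X) powi lo / (y/X - 1)) * row_transfer X ks (\<lambda>ls. G ls (Z - {y})))"
  using assms
proof (induction ks arbitrary: lo Z)
  case Nil
  then have "Z = {}" by auto
  then show ?case by (simp add: upper_def)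
next
  case (Cons k ks)
  let ?Z = "\<lambda>y. Z - {y}"
  let ?L = "\<lambda>y z. row_transfer X ks (\<lambda>ls. G ls (Z - {y} - {z}))"
  let ?q = "\<lambda>y. y / X"
  have q: "?q y \<noteq> 0" "?q y \<noteq> 1" "y \<noteq> 0" if "y \<in> Z" for y
    using Cons.prems that by auto
  have IH: "transfer X lo' ks (\<lambda>ls. G ls (?Z y)) = upper X ks (?Z y) -
     (\<Sum>z\<in>?Z y. omega z (?Z y) * (?q z powi lo' / (?q z - 1)) * ?L y z)" if "y \<in> Z" for y lo'
    using Cons.IH[of "?Z y" lo'] Cons.prems that by auto
  have G: "transfer X lo' ks (\<lambda>ls. G (l # ls) Z) =
     (\<Sum>y\<in>Z. (y powi l * omega y Z) * transfer X lo' ks (\<lambda>ls. G ls (?Z y)))" for lo' l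
    by (simp add: transfer_sum)
  have E: "esum lo hi (\<lambda>l. X powi (-l) * transfer X lo' ks (\<lambda>ls. G (l # ls) Z)) =
     (\<Sum>y\<in>Z. omega y Z * transfer X lo' ks (\<lambda>ls. G ls (?Z y)) * ((?q y powi (hi + 1) - ?q y powi lo) / (?q y - 1)))" for hi lo'
  proof -
    have "X powi (-l) * transfer X lo' ks (\<lambda>ls. G (l # ls) Z) =
       (\<Sum>y\<in>Z. omega y Z * transfer X lo' ks (\<lambda>ls. G ls (?Z y)) * ?q y powi l)" for l
      unfolding G sum_distrib_left
      by (intro sum.cong refl) (simp add: power_int_divide_distrib power_int_minus field_simps)
    then have "esum lo hi (\<lambda>l. X powi (-l) * transfer X lo' ks (\<lambda>ls. G (l # ls) Z)) =
        (\<Sum>y\<in>Z. omega y Z * transfer X lo' ks (\<lambda>ls. G ls (?Z y)) * esum lo hi (\<lambda>l. ?q y powi l))"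
      by (simp add: esum_sum)
    also have "\<dots> = (\<Sum>y\<in>Z. omega y Z * transfer X lo' ks (\<lambda>ls. G ls (?Z y)) * ((?q y powi (hi + 1) - ?q y powi lo) / (?q y - 1)))"
      by (intro sum.cong refl) (simp only: esum_geometric q not_False_eq_True)
    finally show ?thesis .
  qed
  let ?T = "\<lambda>y d. transfer X (k + up d) ks (\<lambda>ls. G ls (?Z y))"
  let ?w = "\<lambda>d. X powi (k + up d - dn d)"
  have A: "transfer X lo (k # ks) (\<lambda>ls. G ls Z) =
     (\<Sum>y\<in>Z. omega y Z * (\<Sum>d\<in>decos. ?w d * ?T y d * (?q y powi (k - dn d + 1) / (?q y - 1)))) -
     (\<Sum>y\<in>Z. omega y Z * (?q y powi lo / (?q y - 1)) * (\<Sum>d\<in>decos. ?w d * ?T y d))"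
    by (simp only: transfer.simps E sum_decos sum_distrib_left sum.distrib[symmetric] sum_subtractf[symmetric])
       (intro sum.cong refl, simp add: field_simps diff_divide_distrib add_divide_distrib)
  have X: "X \<noteq> 0" using Cons by auto
  \<comment> \<open>The decorations \<open>NoArr\<close>, \<open>NE\<close>, \<open>NW\<close> give
    \<open>y\<close>, \<open>X * y\<close> and 1 over \<open>X\<close>: the numerator of
    \<open>kern X y\<close>.\<close>
  have w: "(\<Sum>d\<in>decos. ?w d * (?q y powi (k - dn d + 1))) = X powi k * ?q y powi k * ((1 + y + X * y) / X)"
    if "y \<in> Z" for y
    using q[OF that] X by (simp add: sum_decos power_int_add power_int_diff field_simps)
  \<comment> \<open>The lower limit of the following sum adds a factor \<open>z / X\<close> for
    \<open>NE\<close>, beyond the common power, so \<open>X * y\<close> becomes \<open>z * y\<close>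
    and the numerator of \<open>kern z y\<close> appears.\<close>
  have w2: "(\<Sum>d\<in>decos. ?w d * (?q y powi (k - dn d + 1)) * ?q z powi (k + up d)) =
       X powi k * ?q y powi k * ?q z powi k * ((1 + y + z * y) / X)"
    if "y \<in> Z" "z \<in> Z" for y z
    using q[OF that(1)] q[OF that(2)] X by (simp add: sum_decos power_int_add power_int_diff field_simps)
  let ?H = "\<lambda>y z. omega y Z * omega z (?Z y) * ?L y z * (X powi k * ?q y powi k * ?q z powi k * ((1 + y + z * y) / X)) / ((?q y - 1) * (?q z - 1))"
  have B: "(\<Sum>d\<in>decos. ?w d * ?T y d * (?q y powi (k - dn d + 1) / (?q y - 1))) =
      upper X ks (?Z y) * (X powi k * ?q y powi k * ((1 + y + X * y) / X)) / (?q y - 1) -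
      (\<Sum>z\<in>?Z y. omega z (?Z y) * ?L y z * (X powi k * ?q y powi k * ?q z powi k * ((1 + y + z * y) / X)) / ((?q y - 1) * (?q z - 1)))" 
    (is "?lhs = ?a - ?b") if y: "y \<in> Z" for y
  proof -
    have b: "?b = (\<Sum>z\<in>?Z y. \<Sum>d\<in>decos. omega z (?Z y) * ?L y z * (?w d * (?q y powi (k - dn d + 1)) * ?q z powi (k + up d)) / ((?q y - 1) * (?q z - 1)))"
    proof (intro sum.cong refl)
      fix z assume z: "z \<in> ?Z y"
      show "omega z (?Z y) * ?L y z * (X powi k * ?q y powi k * ?q z powi k * ((1 + y + z * y) / X)) / ((?q y - 1) * (?q z - 1)) =
       (\<Sum>d\<in>decos. omega z (?Z y) * ?L y z * (?w d * (?q y powi (k - dn d + 1)) * ?q z powi (k + up d)) / ((?q y - 1) * (?q z - 1)))"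
        unfolding sum_divide_distrib[symmetric] sum_distrib_left[symmetric]
        using w2[of y z] y z by simp
    qed
    have a: "?a = (\<Sum>d\<in>decos. upper X ks (?Z y) * (?w d * (?q y powi (k - dn d + 1))) / (?q y - 1))"
      unfolding sum_divide_distrib[symmetric] sum_distrib_left[symmetric] w[OF y] by simp
    have "?lhs = (\<Sum>d\<in>decos. ?w d * (upper X ks (?Z y) -
     (\<Sum>z\<in>?Z y. omega z (?Z y) * (?q z powi (k + up d) / (?q z - 1)) * ?L y z)) * (?q y powi (k - dn d + 1) / (?q y - 1)))"
      using IH[OF y] by simp
    also have "\<dots> = ?a - ?b"
      unfolding a b sum.swap[of _ "decos"] sum_subtractf[symmetric]
      by (intro sum.cong refl) (simp add: right_diff_distrib left_diff_distrib sum_distrib_left sum_distrib_right mult_ac)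
    finally show ?thesis .
  qed
  \<comment> \<open>Terms in which the entry \<open>k\<close> is used by the next-row entries on both sides (variables \<open>y\<close> and \<open>z\<close>).\<close>
  have dead: "(\<Sum>y\<in>Z. \<Sum>z\<in>?Z y. ?H y z) = 0"
  proof (rule antisymmetric_sum_zero)
    fix y z assume yz: "y \<in> Z" "z \<in> Z" "y \<noteq> z"
    have o1: "omega y Z * omega z (?Z y) = kern y z * (omega y (Z - {z}) * omega z (Z - {y}))"
      using omega_remove[of Z z y] yz Cons.prems by simp
    have o2: "omega z Z * omega y (?Z z) = kern z y * (omega y (Z - {z}) * omega z (Z - {y}))"
      using omega_remove[of Z y z] yz Cons.prems by simp
    have o3: "?L z y = ?L y z" by (simp add: Diff_insert2[symmetric] insert_commute)
    define K where "K = omega y (Z - {z}) * omega z (Z - {y}) * ?L y z * (X powi k * ?q y powi k * ?q z powi k) / (X * ((?q y - 1) * (?q z - 1)))"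
    \<comment> \<open>The two numerators multiply to an expression symmetric in \<open>y\<close> and
      \<open>z\<close>, so only the denominator \<open>z - y\<close> changes sign under the
      exchange.\<close>
    have "kern y z * (1 + y + z * y) = - (kern z y * (1 + z + y * z))"
      using yz by (simp add: kern_def divide_simps) (simp add: algebra_simps)
    moreover have "?H y z = kern y z * (1 + y + z * y) * K"
      unfolding o1 K_def by (simp add: mult_ac)
    moreover have "?H z y = kern z y * (1 + z + y * z) * K"
      unfolding o2 o3 K_def by (simp add: mult_ac)
    ultimately show "?H y z = - ?H z y"
      by simp
  qed (use Cons in auto)
  have up: "(\<Sum>y\<in>Z. omega y Z * (upper X ks (?Z y) * (X powi k * ?q y powi k * ((1 + y + X * y) / X)) / (?q y - 1))) = upper X (k # ks) Z"
    unfolding upper_def G.simps sum_distrib_left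
  proof (intro sum.cong refl)
    fix y assume y: "y \<in> Z"
    have p1: "(\<Prod>y\<in>Z. kern X y) = kern X y * (\<Prod>y\<in>Z-{y}. kern X y)"
      using y Cons.prems by (intro prod.remove) auto
    have p2: "X powi k * ?q y powi k = y powi k"
      using X by (simp add: power_int_divide_distrib)
    have p3: "((1 + y + X * y) / X) / (?q y - 1) = kern X y"
    proof -
      have "?q y - 1 = (y - X) / X" using X by (simp add: diff_divide_distrib)
      then show ?thesis using X by (simp add: kern_def)
    qed
    have "omega y Z * ((\<Prod>y\<in>Z - {y}. kern X y) * G ks (Z - {y}) * (X powi k * ?q y powi k * ((1 + y + X * y) / X)) / (?q y - 1)) =
       omega y Z * (\<Prod>y\<in>Z - {y}. kern X y) * G ks (Z - {y}) * (X powi k * ?q y powi k) * (((1 + y + X * y) / X) / (?q y - 1))"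
      by (simp only: times_divide_eq_right times_divide_eq_left mult.assoc)
    then show "omega y Z * ((\<Prod>y\<in>Z - {y}. kern X y) * G ks (Z - {y}) * (X powi k * ?q y powi k * ((1 + y + X * y) / X)) / (?q y - 1)) =
      (\<Prod>y\<in>Z. kern X y) * (y powi k * omega y Z * G ks (Z - {y}))"
      unfolding p1 p2 p3 by (simp only: mult_ac)
  qed
  have B': "(\<Sum>y\<in>Z. omega y Z * (\<Sum>d\<in>decos. ?w d * ?T y d * (?q y powi (k - dn d + 1) / (?q y - 1)))) = upper X (k # ks) Z - 0"
  proof -
    have "(\<Sum>y\<in>Z. omega y Z * (\<Sum>d\<in>decos. ?w d * ?T y d * (?q y powi (k - dn d + 1) / (?q y - 1)))) =
       (\<Sum>y\<in>Z. omega y Z * (upper X ks (?Z y) * (X powi k * ?q y powi k * ((1 + y + X * y) / X)) / (?q y - 1)) - (\<Sum>z\<in>?Z y. ?H y z))"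
      by (intro sum.cong refl, simp only: B, subst right_diff_distrib) (simp add: sum_distrib_left mult.assoc)
    then show ?thesis
      by (simp only: sum_subtractf up dead)
  qed
  show ?case unfolding A B' by (simp only: row_transfer.simps diff_zero)
qed

text \<open>Sorted by the variable that receives the first exponent: \<open>X\<close> comes from the
  \<open>upper\<close> term, a variable of \<open>Z\<close> from a lower limit, whose minus sign
  turns into \<open>kern y X\<close>. The factor \<open>1 + X + 1 / X\<close> arises once, from the
  decoration of the entry whose exponent goes to \<open>X\<close>.\<close>

lemma row_transfer_G:
  assumes "finite Z" "X \<notin> Z" "X \<noteq> 0" "0 \<notin> Z" "length ks = Suc (card Z)"
  shows "row_transfer X ks (\<lambda>ls. G ls Z) = (1 + X + 1 / X) * G ks (insert X Z)"
  using assms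
proof (induction ks arbitrary: Z)
  case Nil
  then show ?case by simp
next
  case (Cons k ks)
  define c where "c = 1 + X + 1 / X"
  let ?q = "\<lambda>y. y / X"
  let ?L = "\<lambda>y. row_transfer X ks (\<lambda>ls. G ls (Z - {y}))"
  let ?w = "\<lambda>d. X powi (k + up d - dn d)"
  have X: "X \<noteq> 0" using Cons by auto
  have q: "?q y \<noteq> 0" "?q y \<noteq> 1" "y \<noteq> 0" if "y \<in> Z" for y
    using Cons.prems that by auto
  have w: "(\<Sum>d\<in>decos. ?w d) = X powi k * c"
    using X by (simp add: sum_decos c_def power_int_add power_int_diff field_simps)
  have w1: "(\<Sum>d\<in>decos. ?w d * ?q y powi (k + up d)) = y powi k * ((1 + X + y * X) / X)" if "y \<in> Z" for y
    using X q[OF that] by (simp add: sum_decos power_int_add power_int_diff power_int_divide_distrib field_simps)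
  have IH: "?L y = c * G ks (insert X Z - {y})" if "y \<in> Z" for y
  proof -
    have "insert X Z - {y} = insert X (Z - {y})" using that Cons.prems by auto
    moreover have "Suc (card (Z - {y})) = card Z" using that Cons.prems card_Suc_Diff1 by metis
    ultimately show ?thesis
      using Cons.IH[of "Z - {y}"] Cons.prems that by (auto simp: c_def)
  qed
  have "row_transfer X (k # ks) (\<lambda>ls. G ls Z) =
    (\<Sum>d\<in>decos. ?w d * (upper X ks Z - (\<Sum>y\<in>Z. omega y Z * (?q y powi (k + up d) / (?q y - 1)) * ?L y)))"
    using transfer_G_expand[of Z X ks] Cons.prems by simp
  also have "\<dots> = (\<Sum>d\<in>decos. ?w d) * upper X ks Z - (\<Sum>y\<in>Z. omega y Z * ((\<Sum>d\<in>decos. ?w d * ?q y powi (k + up d)) / (?q y - 1)) * ?L y)"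
    unfolding right_diff_distrib sum_subtractf sum_distrib_right sum_distrib_left sum_divide_distrib sum.swap[of _ "decos"]
    by (simp add: mult_ac)
  also have "(\<Sum>y\<in>Z. omega y Z * ((\<Sum>d\<in>decos. ?w d * ?q y powi (k + up d)) / (?q y - 1)) * ?L y) =
     - (\<Sum>y\<in>Z. y powi k * omega y (insert X Z) * (c * G ks (insert X Z - {y})))"
    unfolding sum_negf[symmetric]
  proof (intro sum.cong refl)
    fix y assume y: "y \<in> Z"
    have "omega y (insert X Z) = kern y X * omega y Z"
      using omega_remove[of "insert X Z" X y] Cons.prems y by auto
    moreover have "((1 + X + y * X) / X) / (?q y - 1) = - kern y X"
      using X y Cons.prems by (auto simp: kern_def divide_simps algebra_simps)
    ultimately show "omega y Z * ((\<Sum>d\<in>decos. ?w d * ?q y powi (k + up d)) / (?q y - 1)) * ?L y =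
       - (y powi k * omega y (insert X Z) * (c * G ks (insert X Z - {y})))"
      unfolding w1[OF y] IH[OF y] times_divide_eq_right[symmetric] by simp
  qed
  also have "(\<Sum>d\<in>decos. ?w d) * upper X ks Z = X powi k * omega X (insert X Z) * (c * G ks (insert X Z - {X}))"
    using Cons.prems by (simp add: w upper_def omega_def)
  finally show ?case
    unfolding c_def[symmetric]
    using Cons.prems by (simp add: sum_distrib_left distrib_left mult_ac sum.insert_if)
qed

section \<open>Expansion of the transfer operators over decorations and next rows\<close>

definition lists_n :: "'a set \<Rightarrow> nat \<Rightarrow> 'a list set" where
  "lists_n A n = {xs. set xs \<subseteq> A \<and> length xs = n}"

lemma finite_lists_n: "finite A \<Longrightarrow> finite (lists_n A n)"
  by (simp add: lists_n_def finite_lists_length_eq)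

lemma lists_n_0 [simp]: "lists_n A 0 = {[]}"
  by (auto simp: lists_n_def)

lemma sum_lists_n_Suc:
  "(\<Sum>xs\<in>lists_n A (Suc n). f xs) = (\<Sum>x\<in>A. \<Sum>xs\<in>lists_n A n. f (x # xs))"
proof -
  have "(\<Sum>xs\<in>lists_n A (Suc n). f xs) = (\<Sum>(x, xs)\<in>A \<times> lists_n A n. f (x # xs))"
    by (rule sum.reindex_bij_witness[of _ "\<lambda>(x, xs). x # xs" "\<lambda>xs. (hd xs, tl xs)"])
       (auto simp: lists_n_def length_Suc_conv)
  then show ?thesis by (simp add: sum.cartesian_product)
qed

text \<open>The coefficient of \<open>f l\<close> in \<open>esum lo hi f\<close>; with it the sum
  runs over a fixed range and sums can be interchanged.\<close>

definition sg :: "int \<Rightarrow> int \<Rightarrow> int \<Rightarrow> real" where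
  "sg lo hi l = (if lo \<le> l \<and> l \<le> hi then 1 else if hi < l \<and> l < lo then -1 else 0)"

text \<open>The limits may leave \<open>{0..m}\<close> by one because an arrow shifts them by one;
  the forward range and the backward range \<open>{hi+1..lo-1}\<close> still lie inside.\<close>

lemma esum_sg:
  assumes "0 \<le> lo" "lo \<le> m + 1" "-1 \<le> hi" "hi \<le> m"
  shows "esum lo hi f = (\<Sum>l\<in>{0..m}. sg lo hi l * f l)"
proof (cases "lo \<le> hi + 1")
  case True
  have "(\<Sum>l\<in>{0..m}. sg lo hi l * f l) = (\<Sum>l\<in>{lo..hi}. sg lo hi l * f l)"
    by (rule sum.mono_neutral_right) (use assms True in \<open>auto simp: sg_def\<close>)
  also have "\<dots> = (\<Sum>l\<in>{lo..hi}. f l)"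
    by (rule sum.cong) (auto simp: sg_def)
  finally show ?thesis using True by (simp add: esum_def)
next
  case False
  have "(\<Sum>l\<in>{0..m}. sg lo hi l * f l) = (\<Sum>l\<in>{hi+1..lo-1}. sg lo hi l * f l)"
    by (rule sum.mono_neutral_right) (use assms False in \<open>auto simp: sg_def\<close>)
  also have "\<dots> = (\<Sum>l\<in>{hi+1..lo-1}. - f l)"
    by (rule sum.cong) (use False in \<open>auto simp: sg_def\<close>)
  finally show ?thesis using False by (simp add: esum_def sum_negf)
qed

lemma transfer_eq_sum:
  assumes "set ks \<subseteq> {0..m}" "0 \<le> lo" "lo \<le> m + 1"
  shows "transfer X lo ks F =
    (\<Sum>es\<in>lists_n decos (length ks). \<Sum>ls\<in>lists_n {0..m} (length ks).
      (\<Prod>j<length ks. X powi (ks!j + up (es!j) - dn (es!j))) *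
      (\<Prod>j<length ks. sg ((lo # map2 (\<lambda>k e. k + up e) ks es) ! j) (ks!j - dn (es!j)) (ls!j) * X powi (- ls!j)) * F ls)"
  using assms
proof (induction ks arbitrary: lo F)
  case Nil
  then show ?case by simp
next
  case (Cons k ks)
  have b: "0 \<le> k + up e" "k + up e \<le> m + 1" "-1 \<le> k - dn e" "k - dn e \<le> m" for e
    using Cons.prems by (auto simp: up_def dn_def)
  let ?P = "\<lambda>es. (\<Prod>j<length ks. X powi (ks!j + up (es!j) - dn (es!j)))"
  let ?Q = "\<lambda>e es ls. (\<Prod>j<length ks. sg (((k + up e) # map2 (\<lambda>k e. k + up e) ks es) ! j) (ks!j - dn (es!j)) (ls!j) * X powi (- ls!j))"
  have "transfer X lo (k # ks) F = (\<Sum>e\<in>decos. X powi (k + up e - dn e) *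
      (\<Sum>l\<in>{0..m}. sg lo (k - dn e) l * (X powi (- l) * (\<Sum>es\<in>lists_n decos (length ks). \<Sum>ls\<in>lists_n {0..m} (length ks).
        ?P es * ?Q e es ls * F (l # ls)))))"
    using Cons.prems b by (simp add: Cons.IH esum_sg[of _ m])
  also have "\<dots> = (\<Sum>e\<in>decos. \<Sum>l\<in>{0..m}. \<Sum>es\<in>lists_n decos (length ks). \<Sum>ls\<in>lists_n {0..m} (length ks).
      (X powi (k + up e - dn e) * ?P es) * ((sg lo (k - dn e) l * X powi (- l)) * ?Q e es ls) * F (l # ls))"
    unfolding sum_distrib_left by (simp only: mult_ac)
  also have "\<dots> = (\<Sum>e\<in>decos. \<Sum>es\<in>lists_n decos (length ks). \<Sum>l\<in>{0..m}. \<Sum>ls\<in>lists_n {0..m} (length ks).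
      (X powi (k + up e - dn e) * ?P es) * ((sg lo (k - dn e) l * X powi (- l)) * ?Q e es ls) * F (l # ls))"
    by (rule sum.cong[OF refl], rule sum.swap)
  also have "\<dots> = (\<Sum>es\<in>lists_n decos (Suc (length ks)). \<Sum>ls\<in>lists_n {0..m} (Suc (length ks)).
      (\<Prod>j<Suc (length ks). X powi ((k#ks)!j + up (es!j) - dn (es!j))) *
      (\<Prod>j<Suc (length ks). sg ((lo # map2 (\<lambda>k e. k + up e) (k#ks) es) ! j) ((k#ks)!j - dn (es!j)) (ls!j) * X powi (- ls!j)) * F ls)"
    unfolding sum_lists_n_Suc prod.lessThan_Suc_shift by simp
  finally show ?case by simp
qed

definition row_signs :: "int list \<Rightarrow> deco list \<Rightarrow> int list \<Rightarrow> real" where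
  "row_signs ks es ls = (\<Prod>j<length ls. sg (ks!j + up (es!j)) (ks!Suc j - dn (es!Suc j)) (ls!j))"

definition row_weight :: "real \<Rightarrow> int list \<Rightarrow> deco list \<Rightarrow> int list \<Rightarrow> real" where
  "row_weight X ks es ls =
     X powi (\<Sum>j<length ks. ks!j + up (es!j) - dn (es!j)) * X powi (- (\<Sum>j<length ls. ls!j))"

lemma prod_power_int: "x \<noteq> 0 \<Longrightarrow> (\<Prod>j\<in>A. x powi f j) = (x :: real) powi (\<Sum>j\<in>A. f j)"
  by (induction A rule: infinite_finite_induct) (auto simp: power_int_add)

lemma row_transfer_eq_sum:
  assumes "set ks \<subseteq> {0..m}" "length ks = Suc n" "X \<noteq> 0"
  shows "row_transfer X ks F =
    (\<Sum>es\<in>lists_n decos (Suc n). \<Sum>ls\<in>lists_n {0..m} n. row_weight X ks es ls * row_signs ks es ls * F ls)"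
proof -
  obtain k ks' where ks: "ks = k # ks'" using assms by (cases ks) auto
  have len: "length ks' = n" using assms ks by simp
  have b: "0 \<le> k + up e" "k + up e \<le> m + 1" for e
    using assms ks by (auto simp: up_def dn_def)
  have w: "row_weight X ks (e # es) ls * row_signs ks (e # es) ls =
     X powi (k + up e - dn e) * ((\<Prod>j<n. X powi (ks'!j + up (es!j) - dn (es!j))) *
      (\<Prod>j<n. sg (((k + up e) # map2 (\<lambda>k e. k + up e) ks' es) ! j) (ks'!j - dn (es!j)) (ls!j) * X powi (- ls!j)))"
    if "es \<in> lists_n decos n" "ls \<in> lists_n {0..m} n" for e es ls
  proof -
    have l: "length es = n" "length ls = n" using that by (auto simp: lists_n_def)
    have "((k + up e) # map2 (\<lambda>k e. k + up e) ks' es) ! j = ks!j + up ((e # es)!j)" if "j < n" for j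
      using that l len ks by (cases j) auto
    then have "(\<Prod>j<n. sg (((k + up e) # map2 (\<lambda>k e. k + up e) ks' es) ! j) (ks'!j - dn (es!j)) (ls!j) * X powi (- ls!j)) =
       row_signs ks (e # es) ls * X powi (- (\<Sum>j<n. ls!j))"
      using assms l ks by (simp add: row_signs_def prod.distrib prod_power_int sum_negf)
    moreover have "X powi (k + up e - dn e) * (\<Prod>j<n. X powi (ks'!j + up (es!j) - dn (es!j))) =
       (\<Prod>j<Suc n. X powi (ks!j + up ((e#es)!j) - dn ((e#es)!j)))"
      unfolding prod.lessThan_Suc_shift by (simp add: ks)
    moreover have "\<dots> = X powi (\<Sum>j<Suc n. ks!j + up ((e#es)!j) - dn ((e#es)!j))"
      by (rule prod_power_int) fact
    ultimately show ?thesis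
      using l assms by (simp add: row_weight_def)
  qed
  have "row_transfer X ks F = (\<Sum>e\<in>decos. \<Sum>es\<in>lists_n decos n. \<Sum>ls\<in>lists_n {0..m} n.
     X powi (k + up e - dn e) * ((\<Prod>j<n. X powi (ks'!j + up (es!j) - dn (es!j))) *
      (\<Prod>j<n. sg (((k + up e) # map2 (\<lambda>k e. k + up e) ks' es) ! j) (ks'!j - dn (es!j)) (ls!j) * X powi (- ls!j)) * F ls))"
    using assms b len unfolding ks by (simp add: transfer_eq_sum[of _ m] sum_distrib_left)
  also have "\<dots> = (\<Sum>e\<in>decos. \<Sum>es\<in>lists_n decos n. \<Sum>ls\<in>lists_n {0..m} n.
     row_weight X ks (e # es) ls * row_signs ks (e # es) ls * F ls)"
    by (intro sum.cong refl) (simp only: w mult.assoc)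
  finally show ?thesis unfolding sum_lists_n_Suc .
qed

section \<open>Patterns as conditions on single triangles\<close>

definition AGT_bottom :: "nat \<Rightarrow> int list \<Rightarrow> ((nat \<Rightarrow> nat \<Rightarrow> int) \<times> (nat \<Rightarrow> nat \<Rightarrow> deco)) set" where
  "AGT_bottom n ks = {(a, d). is_arrowed_GT n a d \<and> (\<forall>i j. in_tri n i j \<longrightarrow> d i j \<noteq> Both) \<and>
     (\<forall>j<n. a n (Suc j) = ks ! j)}"

definition AGT_weight :: "(nat \<Rightarrow> real) \<Rightarrow> nat \<Rightarrow> (nat \<Rightarrow> nat \<Rightarrow> int) \<Rightarrow> (nat \<Rightarrow> nat \<Rightarrow> deco) \<Rightarrow> real" where
  "AGT_weight x n a d = (\<Prod>i<n. x (Suc i) powi (\<Sum>j<Suc i. a (Suc i) (Suc j) + up (d (Suc i) (Suc j)) - dn (d (Suc i) (Suc j))) *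
     x (Suc i) powi (- (\<Sum>j<i. a i (Suc j))))"

text \<open>Every decoration rule concerns one triangle only: the NE-neighbour of an entry is also
  the NW-neighbour of the next entry in its row. So \<open>l\<close> and the two entries
  \<open>k\<close>, \<open>k'\<close> below it carry all conditions.\<close>

definition local_ok :: "int \<Rightarrow> deco \<Rightarrow> int \<Rightarrow> int \<Rightarrow> deco \<Rightarrow> bool" where
  "local_ok k e l k' e' \<longleftrightarrow> k \<le> l \<and> l \<le> k' \<and> (k = l \<and> has_NE e \<longrightarrow> k' = k \<and> has_NW e') \<and>
     (k' = l \<and> has_NW e' \<longrightarrow> k = k' \<and> has_NE e)"

definition special :: "int \<Rightarrow> deco \<Rightarrow> int \<Rightarrow> int \<Rightarrow> deco \<Rightarrow> bool" where
  "special k e l k' e' \<longleftrightarrow> l = k \<and> l = k' \<and> has_NE e \<and> has_NW e'"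

text \<open>For \<open>k = k'\<close> with arrows pointing at \<open>l\<close> from both sides the
  limits are \<open>k + 1\<close> and \<open>k - 1\<close>, so the backward range is
  \<open>{k}\<close> and counts with -1. In all other cases the range runs forward or is empty, and
  the rules forbid exactly the end points that the arrows remove.\<close>

lemma sg_local:
  assumes "k \<le> k'"
  shows "sg (k + up e) (k' - dn e') l = 
    (if local_ok k e l k' e' then if special k e l k' e' then -1 else 1 else 0)"
proof -
  have "k + up e \<le> l \<and> l \<le> k' - dn e' \<longleftrightarrow> local_ok k e l k' e' \<and> \<not> special k e l k' e'"
    using assms unfolding up_def dn_def local_ok_def special_def
    by (cases "has_NE e"; cases "has_NW e'") (simp_all only: simp_thms if_True if_False, presburger+)
  moreover have "k' - dn e' < l \<and> l < k + up e \<longleftrightarrow> local_ok k e l k' e' \<and> special k e l k' e'"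
    using assms unfolding up_def dn_def local_ok_def special_def
    by (cases "has_NE e"; cases "has_NW e'") (simp_all only: simp_thms if_True if_False, presburger+)
  ultimately show ?thesis
    by (cases "local_ok k e l k' e'"; cases "special k e l k' e'") (simp_all only: sg_def simp_thms if_True if_False)
qed

lemma is_arrowed_GT_iff:
  "is_arrowed_GT n a d \<longleftrightarrow> (\<forall>i j. \<not> in_tri n i j \<longrightarrow> a i j = 0 \<and> d i j = NoArr) \<and>
    (\<forall>i j. 1 \<le> j \<and> j \<le> i \<and> i < n \<longrightarrow> local_ok (a (Suc i) j) (d (Suc i) j) (a i j) (a (Suc i) (Suc j)) (d (Suc i) (Suc j)))"
  (is "?L \<longleftrightarrow> ?R")
proof
  assume L: ?L
  show ?R
  proof (intro conjI allI impI)
    fix i j assume ij: "1 \<le> j \<and> j \<le> i \<and> i < n"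
    have tri: "in_tri n (Suc i) j" "in_tri n (Suc i) (Suc j)" using ij by (auto simp: in_tri_def)
    note gt = L[unfolded is_arrowed_GT_def is_GT_def, THEN conjunct1, THEN conjunct2, rule_format]
    note ne = L[unfolded is_arrowed_GT_def, THEN conjunct2, THEN conjunct2, THEN conjunct1, rule_format]
    note nw = L[unfolded is_arrowed_GT_def, THEN conjunct2, THEN conjunct2, THEN conjunct2, rule_format]
    show "local_ok (a (Suc i) j) (d (Suc i) j) (a i j) (a (Suc i) (Suc j)) (d (Suc i) (Suc j))"
      unfolding local_ok_def
    proof (intro conjI impI)
      show "a (Suc i) j \<le> a i j" "a i j \<le> a (Suc i) (Suc j)" using gt[of j i] ij by simp_all
    next
      assume "a (Suc i) j = a i j \<and> has_NE (d (Suc i) j)"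
      then show "a (Suc i) (Suc j) = a (Suc i) j" "has_NW (d (Suc i) (Suc j))"
        using ne[of "Suc i" j] tri ij by simp_all
    next
      assume "a (Suc i) (Suc j) = a i j \<and> has_NW (d (Suc i) (Suc j))"
      then show "a (Suc i) j = a (Suc i) (Suc j)" "has_NE (d (Suc i) j)"
        using nw[of "Suc i" "Suc j"] tri ij by simp_all
    qed
  next
    fix i j assume "\<not> in_tri n i j"
    with L[unfolded is_arrowed_GT_def is_GT_def, THEN conjunct1, THEN conjunct1]
      L[unfolded is_arrowed_GT_def, THEN conjunct2, THEN conjunct1]
    show "a i j = 0" "d i j = NoArr" by simp_all
  qed
next
  assume R: ?R
  note loc = R[THEN conjunct2, rule_format, unfolded local_ok_def]
  show ?L
    unfolding is_arrowed_GT_def is_GT_def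
  proof (intro conjI allI impI)
    fix i j assume ij: "1 \<le> j \<and> j \<le> i \<and> i < n"
    show "a (i + 1) j \<le> a i j" "a i j \<le> a (i + 1) (j + 1)"
      using loc[OF ij, THEN conjunct1] loc[OF ij, THEN conjunct2, THEN conjunct1] by simp_all
  next
    fix i j assume ij: "in_tri n i j \<and> 2 \<le> i \<and> j \<le> i - 1 \<and> a i j = a (i - 1) j \<and> has_NE (d i j)"
    then obtain i' where i: "i = Suc i'" by (cases i) auto
    then have "1 \<le> j \<and> j \<le> i' \<and> i' < n" using ij by (auto simp: in_tri_def)
    note l = loc[OF this, THEN conjunct2, THEN conjunct2, THEN conjunct1]
    show "j + 1 \<le> i" using ij by auto
    have "a (Suc i') (Suc j) = a (Suc i') j \<and> has_NW (d (Suc i') (Suc j))"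
      using ij by (intro l[rule_format]) (simp add: i)
    then show "a i (j + 1) = a i j" "has_NW (d i (j + 1))"
      by (simp_all add: i)
  next
    fix i j assume ij: "in_tri n i j \<and> 2 \<le> i \<and> 2 \<le> j \<and> a i j = a (i - 1) (j - 1) \<and> has_NW (d i j)"
    then obtain i' j' where i: "i = Suc i'" "j = Suc j'" by (cases i; cases j) auto
    then have "1 \<le> j' \<and> j' \<le> i' \<and> i' < n" using ij by (auto simp: in_tri_def)
    note l = loc[OF this, THEN conjunct2, THEN conjunct2, THEN conjunct2]
    have "a (Suc i') j' = a (Suc i') (Suc j') \<and> has_NE (d (Suc i') j')"
      using ij by (intro l[rule_format]) (simp add: i)
    then show "a i (j - 1) = a i j" "has_NE (d i (j - 1))"
      by (simp_all add: i)
  next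
    fix i j assume "\<not> in_tri n i j"
    with R[THEN conjunct1] show "a i j = 0" "d i j = NoArr" by simp_all
  qed
qed

section \<open>Patterns with a prescribed bottom row\<close>

lemma local_okD: "local_ok k e l k' e' \<Longrightarrow> k \<le> l \<and> l \<le> k'"
  unfolding local_ok_def by (elim conjE) (rule conjI)

lemma is_arrowed_GT_local:
  assumes "is_arrowed_GT n a d" "1 \<le> j" "j \<le> i" "i < n"
  shows "local_ok (a (Suc i) j) (d (Suc i) j) (a i j) (a (Suc i) (Suc j)) (d (Suc i) (Suc j))"
  using assms unfolding is_arrowed_GT_iff by blast

lemma is_arrowed_GT_outside:
  assumes "is_arrowed_GT n a d" "\<not> in_tri n i j"
  shows "a i j = 0" "d i j = NoArr"
  using assms unfolding is_arrowed_GT_iff by blast+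

section \<open>Attaching and removing a bottom row\<close>

definition add_row :: "'b \<Rightarrow> nat \<Rightarrow> 'b list \<Rightarrow> (nat \<Rightarrow> nat \<Rightarrow> 'b) \<Rightarrow> nat \<Rightarrow> nat \<Rightarrow> 'b" where
  "add_row z n xs a i j = (if i = Suc n then if 1 \<le> j \<and> j \<le> Suc n then xs ! (j - 1) else z else a i j)"

text \<open>Resetting the removed row to the default value is what makes cutting and attaching
  mutually inverse on functions.\<close>

definition cut_row :: "'b \<Rightarrow> nat \<Rightarrow> (nat \<Rightarrow> nat \<Rightarrow> 'b) \<Rightarrow> nat \<Rightarrow> nat \<Rightarrow> 'b" where
  "cut_row z n a i j = (if i \<le> n then a i j else z)"

definition row_list :: "nat \<Rightarrow> (nat \<Rightarrow> nat \<Rightarrow> 'b) \<Rightarrow> 'b list" where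
  "row_list n a = map (\<lambda>j. a n (Suc j)) [0..<n]"

lemma length_row_list [simp]: "length (row_list n a) = n"
  by (simp add: row_list_def)

lemma nth_row_list [simp]: "j < n \<Longrightarrow> row_list n a ! j = a n (Suc j)"
  by (simp add: row_list_def)

lemma add_cut_row:
  assumes "\<And>i j. \<not> in_tri (Suc n) i j \<Longrightarrow> a i j = z"
  shows "add_row z n (row_list (Suc n) a) (cut_row z n a) = a"
proof (intro ext)
  fix i j
  show "add_row z n (row_list (Suc n) a) (cut_row z n a) i j = a i j"
    using assms[of i j] by (cases j) (auto simp: add_row_def cut_row_def in_tri_def)
qed

lemma cut_add_row:
  assumes "\<And>i j. \<not> in_tri n i j \<Longrightarrow> a i j = z"
  shows "cut_row z n (add_row z n xs a) = a"
proof (intro ext)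
  fix i j
  show "cut_row z n (add_row z n xs a) i j = a i j"
    using assms[of i j] by (auto simp: add_row_def cut_row_def in_tri_def)
qed

lemma row_add_row: "length xs = Suc n \<Longrightarrow> row_list (Suc n) (add_row z n xs a) = xs"
  by (rule nth_equalityI) (simp_all add: add_row_def)

lemma row_signs_nonzero_iff:
  assumes "sorted ks" "length ks = Suc (length ls)"
  shows "row_signs ks es ls \<noteq> 0 \<longleftrightarrow>
    (\<forall>j<length ls. local_ok (ks!j) (es!j) (ls!j) (ks!Suc j) (es!Suc j))"
proof -
  have "ks!j \<le> ks!Suc j" if "j < length ls" for j
    using assms that by (simp add: sorted_iff_nth_Suc)
  then show ?thesis by (auto simp: row_signs_def sg_local)
qed

lemma AGT_bottomD:
  assumes "(a, d) \<in> AGT_bottom n ks"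
  shows "is_arrowed_GT n a d" "\<And>i j. in_tri n i j \<Longrightarrow> d i j \<noteq> Both" "length ks = n \<Longrightarrow> row_list n a = ks"
  using assms by (auto simp: AGT_bottom_def intro!: nth_equalityI)

lemma decos_iff: "e \<in> decos \<longleftrightarrow> e \<noteq> Both"
  by (cases e) (auto simp: decos_def)

lemma cut_row_in_AGT_bottom:
  assumes "(a, d) \<in> AGT_bottom (Suc n) ks" "length ks = Suc n" "sorted ks" "set ks \<subseteq> {0..m}"
  shows "row_list (Suc n) d \<in> lists_n decos (Suc n)" "row_list n a \<in> lists_n {0..m} n"
    "row_signs ks (row_list (Suc n) d) (row_list n a) \<noteq> 0"
    "(cut_row 0 n a, cut_row NoArr n d) \<in> AGT_bottom n (row_list n a)"
proof -
  note A = AGT_bottomD[OF assms(1)]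
  have ks: "row_list (Suc n) a = ks" using A(3) assms by simp
  have ksj: "ks ! j = a (Suc n) (Suc j)" if "j < Suc n" for j
    using that by (simp flip: ks)
  have loc: "local_ok (ks!j) (d (Suc n) (Suc j)) (a n (Suc j)) (ks!Suc j) (d (Suc n) (Suc (Suc j)))" if "j < n" for j
    using is_arrowed_GT_local[OF A(1), of "Suc j" n] that by (simp add: ksj)
  show "row_list (Suc n) d \<in> lists_n decos (Suc n)"
    using A(2) by (auto simp: lists_n_def row_list_def decos_iff in_tri_def simp del: upt_Suc)
  show "row_signs ks (row_list (Suc n) d) (row_list n a) \<noteq> 0"
    using assms loc by (subst row_signs_nonzero_iff) simp_all
  have "a n (Suc j) \<in> {0..m}" if "j < n" for j
  proof -
    have "ks!j \<in> set ks" "ks!Suc j \<in> set ks" using that assms by simp_all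
    then have "0 \<le> ks!j" "ks!Suc j \<le> m" using assms(4) by auto
    then show ?thesis using local_okD[OF loc[OF that]] by simp
  qed
  then show "row_list n a \<in> lists_n {0..m} n"
    by (auto simp: lists_n_def row_list_def)
  have "is_arrowed_GT n (cut_row 0 n a) (cut_row NoArr n d)"
    unfolding is_arrowed_GT_iff
  proof (intro conjI allI impI)
    fix i j assume "\<not> in_tri n i j"
    then have "i \<le> n \<Longrightarrow> \<not> in_tri (Suc n) i j" by (auto simp: in_tri_def)
    then show "cut_row 0 n a i j = 0" "cut_row NoArr n d i j = NoArr"
      using is_arrowed_GT_outside[OF A(1), of i j] by (auto simp: cut_row_def)
  next
    fix i j assume "1 \<le> j \<and> j \<le> i \<and> i < n"
    then show "local_ok (cut_row 0 n a (Suc i) j) (cut_row NoArr n d (Suc i) j) (cut_row 0 n a i j)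
        (cut_row 0 n a (Suc i) (Suc j)) (cut_row NoArr n d (Suc i) (Suc j))"
      using is_arrowed_GT_local[OF A(1), of j i] by (simp add: cut_row_def)
  qed
  moreover have "cut_row NoArr n d i j \<noteq> Both" if "in_tri n i j" for i j
    using A(2)[of i j] that by (auto simp: cut_row_def in_tri_def)
  ultimately show "(cut_row 0 n a, cut_row NoArr n d) \<in> AGT_bottom n (row_list n a)"
    by (auto simp: AGT_bottom_def cut_row_def)
qed

lemma add_row_in_AGT_bottom:
  assumes "(a, d) \<in> AGT_bottom n ls" "length ks = Suc n" "sorted ks" "length ls = n"
    "es \<in> lists_n decos (Suc n)" "row_signs ks es ls \<noteq> 0"
  shows "(add_row 0 n ks a, add_row NoArr n es d) \<in> AGT_bottom (Suc n) ks"
proof -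
  note A = AGT_bottomD[OF assms(1)]
  have ls: "row_list n a = ls" using A(3) assms by simp
  have es: "length es = Suc n" "set es \<subseteq> decos" using assms by (auto simp: lists_n_def)
  have loc: "local_ok (ks!j) (es!j) (a n (Suc j)) (ks!Suc j) (es!Suc j)" if "j < n" for j
    using assms(6) that row_signs_nonzero_iff[of ks ls es] assms by (simp flip: ls)
  have "is_arrowed_GT (Suc n) (add_row 0 n ks a) (add_row NoArr n es d)"
    unfolding is_arrowed_GT_iff
  proof (intro conjI allI impI)
    fix i j assume ij: "\<not> in_tri (Suc n) i j"
    then have "\<not> in_tri n i j" by (auto simp: in_tri_def)
    with ij show "add_row 0 n ks a i j = 0" "add_row NoArr n es d i j = NoArr"
      using is_arrowed_GT_outside[OF A(1), of i j] by (auto simp: add_row_def in_tri_def)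
  next
    fix i j assume ij: "1 \<le> j \<and> j \<le> i \<and> i < Suc n"
    then obtain j' where j: "j = Suc j'" by (cases j) auto
    show "local_ok (add_row 0 n ks a (Suc i) j) (add_row NoArr n es d (Suc i) j) (add_row 0 n ks a i j)
        (add_row 0 n ks a (Suc i) (Suc j)) (add_row NoArr n es d (Suc i) (Suc j))"
    proof (cases "i = n")
      case True
      then show ?thesis using loc[of j'] ij j by (simp add: add_row_def)
    next
      case False
      then show ?thesis using is_arrowed_GT_local[OF A(1), of j i] ij by (simp add: add_row_def)
    qed
  qed
  moreover have "add_row NoArr n es d i j \<noteq> Both" if "in_tri (Suc n) i j" for i j
  proof (cases "i = Suc n")
    case True
    then have "es ! (j - 1) \<in> decos" using that es by (auto simp: in_tri_def)
    then show ?thesis using True that by (simp add: add_row_def decos_iff in_tri_def)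
  next
    case False
    then show ?thesis using A(2)[of i j] that by (simp add: add_row_def in_tri_def)
  qed
  ultimately show ?thesis
    by (auto simp: AGT_bottom_def add_row_def)
qed

text \<open>For sorted \<open>ks\<close>, a nonzero sign selects exactly the bottom decorations and
  next rows that can occur together.\<close>

definition row_data :: "int \<Rightarrow> int list \<Rightarrow> nat \<Rightarrow> (deco list \<times> int list) set" where
  "row_data m ks n = {(es, ls) \<in> lists_n decos (Suc n) \<times> lists_n {0..m} n. row_signs ks es ls \<noteq> 0}"

lemma finite_row_data: "finite (row_data m ks n)"
proof (rule finite_subset)
  show "row_data m ks n \<subseteq> lists_n decos (Suc n) \<times> lists_n {0..m} n" by (auto simp: row_data_def)
qed (intro finite_cartesian_product finite_lists_n, simp_all add: decos_def)

lemma bij_betw_add_row: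
  assumes "length ks = Suc n" "sorted ks" "set ks \<subseteq> {0..m}"
  shows "bij_betw (\<lambda>((es, ls), (a, d)). (add_row 0 n ks a, add_row NoArr n es d))
    (SIGMA (es, ls):row_data m ks n. AGT_bottom n ls) (AGT_bottom (Suc n) ks)"
proof (rule bij_betw_byWitness[where f' = "\<lambda>(a, d). ((row_list (Suc n) d, row_list n a), (cut_row 0 n a, cut_row NoArr n d))"])
  show "\<forall>t\<in>SIGMA (es, ls):row_data m ks n. AGT_bottom n ls.
    (\<lambda>(a, d). ((row_list (Suc n) d, row_list n a), (cut_row 0 n a, cut_row NoArr n d)))
     ((\<lambda>((es, ls), (a, d)). (add_row 0 n ks a, add_row NoArr n es d)) t) = t"
  proof (clarsimp)
    fix es ls a d assume 1: "(es, ls) \<in> row_data m ks n" "(a, d) \<in> AGT_bottom n ls"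
    have l: "length es = Suc n" "length ls = n" using 1(1) by (auto simp: row_data_def lists_n_def)
    have "row_list n (add_row 0 n ks a) = row_list n a"
      by (rule nth_equalityI) (simp_all add: add_row_def)
    then show "row_list (Suc n) (add_row NoArr n es d) = es \<and> row_list n (add_row 0 n ks a) = ls \<and>
       cut_row 0 n (add_row 0 n ks a) = a \<and> cut_row NoArr n (add_row NoArr n es d) = d"
      using AGT_bottomD[OF 1(2)] l is_arrowed_GT_outside
      by (simp add: row_add_row cut_add_row)
  qed
  show "\<forall>t\<in>AGT_bottom (Suc n) ks. (\<lambda>((es, ls), (a, d)). (add_row 0 n ks a, add_row NoArr n es d))
     ((\<lambda>(a, d). ((row_list (Suc n) d, row_list n a), (cut_row 0 n a, cut_row NoArr n d))) t) = t"
  proof (clarsimp)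
    fix a d assume 1: "(a, d) \<in> AGT_bottom (Suc n) ks"
    show "add_row 0 n ks (cut_row 0 n a) = a \<and> add_row NoArr n (row_list (Suc n) d) (cut_row NoArr n d) = d"
      using AGT_bottomD[OF 1] assms is_arrowed_GT_outside add_cut_row[of n a 0] by (simp add: add_cut_row)
  qed
  show "(\<lambda>((es, ls), (a, d)). (add_row 0 n ks a, add_row NoArr n es d)) `
     (SIGMA (es, ls):row_data m ks n. AGT_bottom n ls) \<subseteq> AGT_bottom (Suc n) ks"
    using add_row_in_AGT_bottom[OF _ assms(1,2)] by (auto simp: row_data_def lists_n_def)
  show "(\<lambda>(a, d). ((row_list (Suc n) d, row_list n a), (cut_row 0 n a, cut_row NoArr n d))) `
     AGT_bottom (Suc n) ks \<subseteq> (SIGMA (es, ls):row_data m ks n. AGT_bottom n ls)"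
    using cut_row_in_AGT_bottom[OF _ assms] by (auto simp: row_data_def)
qed

lemma AGT_bottom_0: "AGT_bottom 0 [] = {(\<lambda>i j. 0, \<lambda>i j. NoArr)}"
  by (auto simp: AGT_bottom_def is_arrowed_GT_iff in_tri_def fun_eq_iff)

text \<open>The entry of \<open>ks\<close> shared by two consecutive triangles separates
  \<open>ls ! j\<close> from \<open>ls ! Suc j\<close>. Strictness of the bottom row is not
  inherited by the row above, so the induction works with weakly increasing rows.\<close>

lemma row_data_sorted:
  assumes "(es, ls) \<in> row_data m ks n" "length ks = Suc n" "sorted ks"
  shows "sorted ls" "length ls = n" "set ls \<subseteq> {0..m}"
proof -
  show l: "length ls = n" "set ls \<subseteq> {0..m}" using assms by (auto simp: row_data_def lists_n_def)
  have loc: "\<forall>j<n. local_ok (ks!j) (es!j) (ls!j) (ks!Suc j) (es!Suc j)"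
    using row_signs_nonzero_iff[of ks ls es] assms l by (auto simp: row_data_def)
  have "ls ! j \<le> ls ! Suc j" if "Suc j < n" for j
  proof -
    have "ls ! j \<le> ks ! Suc j" "ks ! Suc j \<le> ls ! Suc j"
      using local_okD[of "ks!j" "es!j" "ls!j" "ks!Suc j" "es!Suc j"] loc that
        local_okD[of "ks!Suc j" "es!Suc j" "ls!Suc j" "ks!Suc (Suc j)" "es!Suc (Suc j)"] by auto
    then show ?thesis by simp
  qed
  then show "sorted ls" using l by (simp add: sorted_iff_nth_Suc)
qed

text \<open>\<open>AGT_bottom\<close> bounds only the bottom row directly; finiteness of the rest
  comes from the row-by-row bijection.\<close>

lemma finite_AGT_bottom:
  assumes "length ks = n" "sorted ks" "set ks \<subseteq> {0..m}"
  shows "finite (AGT_bottom n ks)"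
  using assms
proof (induction n arbitrary: ks)
  case 0
  then show ?case by (simp add: AGT_bottom_0)
next
  case (Suc n)
  have "finite (SIGMA (es, ls):row_data m ks n. AGT_bottom n ls)"
    using Suc.IH row_data_sorted[OF _ Suc.prems(1,2)] finite_row_data
    by (intro finite_SigmaI) auto
  then show ?case
    using bij_betw_finite[OF bij_betw_add_row[OF Suc.prems]] by blast
qed

lemma minus_one_power_card: "finite A \<Longrightarrow> (-1) ^ card {j\<in>A. Q j} = (\<Prod>j\<in>A. if Q j then -1 else 1 :: real)"
  by (simp add: prod.inter_filter[symmetric])

text \<open>The new special triangles have their apex in row \<open>n\<close> and their base in the
  attached row; \<open>row_signs\<close> records -1 for each of them.\<close>

lemma sgn_AGT_add_row:
  assumes "(a, d) \<in> AGT_bottom n ls" "length ks = Suc n" "sorted ks" "(es, ls) \<in> row_data m ks n"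
  shows "real_of_int (sgn_AGT (Suc n) (add_row 0 n ks a) (add_row NoArr n es d)) =
    row_signs ks es ls * real_of_int (sgn_AGT n a d)"
proof -
  let ?a = "add_row 0 n ks a" and ?d = "add_row NoArr n es d"
  have l: "length ls = n" using row_data_sorted[OF assms(4,2,3)] by simp
  have ls: "row_list n a = ls" using AGT_bottomD(3)[OF assms(1)] l by simp
  let ?Q = "\<lambda>j. special (ks!j) (es!j) (ls!j) (ks!Suc j) (es!Suc j)"
  have split: "special_triangles (Suc n) ?a ?d = special_triangles n a d \<union> (\<lambda>j. (n, Suc j)) ` {j\<in>{..<n}. ?Q j}"
    (is "?S = ?S1 \<union> ?S2")
  proof (rule Set.set_eqI)
    fix t :: "nat \<times> nat"
    obtain i j where t: "t = (i, j)" by (cases t)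
    show "t \<in> ?S \<longleftrightarrow> t \<in> ?S1 \<union> ?S2"
    proof (cases "i = n \<and> 1 \<le> j")
      case True
      then obtain j' where "j = Suc j'" by (cases j) auto
      then show ?thesis using True unfolding t
        by (auto simp: special_triangles_def add_row_def special_def image_iff simp flip: ls)
    next
      case False
      then show ?thesis unfolding t
        by (auto simp: special_triangles_def add_row_def)
    qed
  qed
  have fin: "finite ?S1"
    by (rule finite_subset[of _ "{..n} \<times> {..n}"]) (auto simp: special_triangles_def)
  have "card ?S = card ?S1 + card {j\<in>{..<n}. ?Q j}"
  proof -
    have "card (?S1 \<union> ?S2) = card ?S1 + card ?S2"
      by (rule card_Un_disjoint) (use fin in \<open>auto simp: special_triangles_def\<close>)
    moreover have "card ?S2 = card {j\<in>{..<n}. ?Q j}"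
      by (rule card_image) (auto simp: inj_on_def)
    ultimately show ?thesis by (simp add: split)
  qed
  then have "real_of_int (sgn_AGT (Suc n) ?a ?d) = real_of_int (sgn_AGT n a d) * (\<Prod>j<n. if ?Q j then -1 else 1)"
    by (simp add: sgn_AGT_def power_add minus_one_power_card[symmetric])
  moreover have "row_signs ks es ls = (\<Prod>j<n. if ?Q j then -1 else 1)"
  proof -
    have loc: "\<forall>j<n. local_ok (ks!j) (es!j) (ls!j) (ks!Suc j) (es!Suc j)"
      using row_signs_nonzero_iff[of ks ls es] assms l by (auto simp: row_data_def)
    have "ks!j \<le> ks!Suc j" if "j < n" for j
      using assms that by (simp add: sorted_iff_nth_Suc)
    then show ?thesis using loc l by (simp add: row_signs_def sg_local)
  qed
  ultimately show ?thesis by simp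
qed

lemma AGT_weight_add_row:
  assumes "(a, d) \<in> AGT_bottom n ls" "length ks = Suc n" "length ls = n"
  shows "AGT_weight x (Suc n) (add_row 0 n ks a) (add_row NoArr n es d) =
    row_weight (x (Suc n)) ks es ls * AGT_weight x n a d"
proof -
  have ls: "row_list n a = ls" using AGT_bottomD(3)[OF assms(1)] assms by simp
  let ?a = "add_row 0 n ks a" and ?d = "add_row NoArr n es d"
  have 1: "(\<Sum>j<Suc n. ?a (Suc n) (Suc j) + up (?d (Suc n) (Suc j)) - dn (?d (Suc n) (Suc j))) =
     (\<Sum>j<Suc n. ks ! j + up (es ! j) - dn (es ! j))"
    by (rule sum.cong) (simp_all add: add_row_def)
  have 2: "(\<Sum>j<n. ?a n (Suc j)) = (\<Sum>j<n. ls ! j)"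
    by (rule sum.cong) (simp_all add: add_row_def flip: ls)
  have 3: "AGT_weight x n ?a ?d = AGT_weight x n a d"
    unfolding AGT_weight_def by (rule prod.cong) (simp_all add: add_row_def)
  have "AGT_weight x (Suc n) ?a ?d = AGT_weight x n ?a ?d * (x (Suc n) powi (\<Sum>j<Suc n. ?a (Suc n) (Suc j) + up (?d (Suc n) (Suc j)) - dn (?d (Suc n) (Suc j))) *
     x (Suc n) powi (- (\<Sum>j<n. ?a n (Suc j))))"
    by (simp add: AGT_weight_def)
  also have "\<dots> = AGT_weight x n a d * row_weight (x (Suc n)) ks es ls"
    unfolding 1 2 3 using assms by (simp add: row_weight_def)
  finally show ?thesis by simp
qed

lemma AGT_bottom_sum:
  assumes "length ks = n" "sorted ks" "set ks \<subseteq> {0..m}"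
    and "inj_on x {1..n}" "\<And>i. i \<in> {1..n} \<Longrightarrow> x i \<noteq> 0"
  shows "(\<Sum>(a, d)\<in>AGT_bottom n ks. real_of_int (sgn_AGT n a d) * AGT_weight x n a d) =
    (\<Prod>i=1..n. 1 + x i + 1 / x i) * G ks (x ` {1..n})"
  using assms
proof (induction n arbitrary: ks)
  case 0
  then show ?case
    by (simp add: AGT_bottom_0 AGT_weight_def sgn_AGT_def special_triangles_def)
next
  case (Suc n)
  let ?X = "x (Suc n)" and ?Z = "x ` {1..n}"
  define C where "C = (\<Prod>i=1..n. 1 + x i + 1 / x i)"
  have ins: "{1..Suc n} = insert (Suc n) {1..n}" by auto
  have inj: "inj_on x {1..n}" and notin: "?X \<notin> ?Z"
    using Suc.prems(4) unfolding ins by auto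
  have card: "card ?Z = n" using inj by (simp add: card_image)
  have X0: "?X \<noteq> 0" "0 \<notin> ?Z" using Suc.prems(5) by fastforce+
  have IH: "(\<Sum>(a, d)\<in>AGT_bottom n ls. real_of_int (sgn_AGT n a d) * AGT_weight x n a d) = C * G ls ?Z"
    if "(es, ls) \<in> row_data m ks n" for es ls
    unfolding C_def using Suc.IH[of ls] row_data_sorted[OF that Suc.prems(1,2)] inj Suc.prems(5) by auto
  let ?f = "\<lambda>n (a, d). real_of_int (sgn_AGT n a d) * AGT_weight x n a d"
  have "sum (?f (Suc n)) (AGT_bottom (Suc n) ks) =
    (\<Sum>t\<in>(SIGMA (es, ls):row_data m ks n. AGT_bottom n ls).
      ?f (Suc n) ((\<lambda>((es, ls), (a, d)). (add_row 0 n ks a, add_row NoArr n es d)) t))"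
    by (rule sum.reindex_bij_betw[symmetric]) (rule bij_betw_add_row[OF Suc.prems(1-3)])
  also have "\<dots> = (\<Sum>((es, ls), t)\<in>(SIGMA (es, ls):row_data m ks n. AGT_bottom n ls).
      row_weight ?X ks es ls * row_signs ks es ls * ?f n t)"
    by (rule sum.cong[OF refl])
       (auto simp: sgn_AGT_add_row[OF _ Suc.prems(1,2)] AGT_weight_add_row[OF _ Suc.prems(1)] row_data_sorted[OF _ Suc.prems(1,2)])
  also have "\<dots> = (\<Sum>(es, ls)\<in>row_data m ks n. \<Sum>t\<in>AGT_bottom n ls. row_weight ?X ks es ls * row_signs ks es ls * ?f n t)"
  proof -
    have "\<forall>p\<in>row_data m ks n. finite (case p of (es, ls) \<Rightarrow> AGT_bottom n ls)"
      using finite_AGT_bottom[of _ n m] row_data_sorted[OF _ Suc.prems(1,2)] by auto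
    from sum.Sigma[OF finite_row_data this, of "\<lambda>(es, ls) t. row_weight ?X ks es ls * row_signs ks es ls * ?f n t"]
    show ?thesis by (simp add: case_prod_unfold)
  qed
  also have "\<dots> = (\<Sum>(es, ls)\<in>row_data m ks n. row_weight ?X ks es ls * row_signs ks es ls * (C * G ls ?Z))"
    by (intro sum.cong refl) (auto simp: IH simp flip: sum_distrib_left)
  \<comment> \<open>Pairs with vanishing sign are added back, which gives the sum the full product
    range of \<open>row_transfer_eq_sum\<close>.\<close>
  also have "\<dots> = (\<Sum>(es, ls)\<in>lists_n decos (Suc n) \<times> lists_n {0..m} n. row_weight ?X ks es ls * row_signs ks es ls * (C * G ls ?Z))"
    by (rule sum.mono_neutral_left)
       (auto simp: row_data_def decos_def intro!: finite_cartesian_product finite_lists_n)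
  also have "\<dots> = C * row_transfer ?X ks (\<lambda>ls. G ls ?Z)"
    unfolding row_transfer_eq_sum[OF Suc.prems(3,1) X0(1)] sum.cartesian_product[symmetric] sum_distrib_left
    by (simp only: mult_ac)
  also have "\<dots> = C * ((1 + ?X + 1 / ?X) * G ks (insert ?X ?Z))"
    using row_transfer_G[of ?Z ?X ks] notin X0 card Suc.prems(1) by simp
  also have "\<dots> = (\<Prod>i=1..Suc n. 1 + x i + 1 / x i) * G ks (x ` {1..Suc n})"
    unfolding C_def ins by simp
  finally show ?case .
qed

section \<open>Determinants and interpolation\<close>

text \<open>Expanding in monomials factors the matrix through a unitriangular one.
  \<open>\<kappa>\<close> lets scalars act through another ring: it is the identity for real-valued
  functionals and the embedding of constants when the values are polynomials in M.\<close>

lemma det_monic_basis: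
  fixes \<phi> :: "nat \<Rightarrow> 'b :: comm_ring_1 poly \<Rightarrow> 'a :: comm_ring_1" and \<kappa> :: "'b \<Rightarrow> 'a"
  assumes add: "\<And>i p q. \<phi> i (p + q) = \<phi> i p + \<phi> i q"
    and smult: "\<And>i c p. \<phi> i (smult c p) = \<kappa> c * \<phi> i p"
    and kappa: "\<kappa> 0 = 0" "\<kappa> 1 = 1"
    and deg: "\<And>l. l < n \<Longrightarrow> degree (p l) = l" and lead: "\<And>l. l < n \<Longrightarrow> lead_coeff (p l) = 1"
  shows "det (mat n n (\<lambda>(i, l). \<phi> i (p l))) = det (mat n n (\<lambda>(i, l). \<phi> i (monom 1 l)))"
proof -
  define U where "U = mat n n (\<lambda>(k, l). \<kappa> (coeff (p l) k))"
  define B where "B = mat n n (\<lambda>(i, l). \<phi> i (monom 1 l))"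
  have zero: "\<phi> i 0 = 0" for i using smult[of i 0 0] kappa by simp
  have sum: "\<phi> i (\<Sum>k\<in>S. g k) = (\<Sum>k\<in>S. \<phi> i (g k))" for i g and S :: "nat set"
    by (induction S rule: infinite_finite_induct) (auto simp: add zero)
  have "mat n n (\<lambda>(i, l). \<phi> i (p l)) = B * U"
  proof (rule eq_matI)
    fix i l assume "i < dim_row (B * U)" "l < dim_col (B * U)"
    then have il: "i < n" "l < n" by (auto simp: B_def U_def)
    have n: "{..n-1} = {0..<n}" using il by auto
    have "degree (p l) \<le> n - 1" using deg[OF il(2)] il by simp
    then have "(\<Sum>k\<le>n-1. monom (coeff (p l) k) k) = p l"
      by (rule poly_as_sum_of_monoms')
    then have "\<phi> i (p l) = \<phi> i (\<Sum>k=0..<n. monom (coeff (p l) k) k)"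
      unfolding n by (simp only:)
    also have "\<dots> = (\<Sum>k=0..<n. \<phi> i (monom (coeff (p l) k) k))"
      by (rule sum)
    also have "\<dots> = (\<Sum>k=0..<n. \<kappa> (coeff (p l) k) * \<phi> i (monom 1 k))"
    proof (rule sum.cong[OF refl])
      show "\<phi> i (monom (coeff (p l) k) k) = \<kappa> (coeff (p l) k) * \<phi> i (monom 1 k)" for k
        using smult[of i "coeff (p l) k" "monom 1 k"] unfolding smult_monom mult_1_right .
    qed
    finally show "mat n n (\<lambda>(i, l). \<phi> i (p l)) $$ (i, l) = (B * U) $$ (i, l)"
      using il by (simp add: B_def U_def scalar_prod_def mult.commute)
  qed (auto simp: B_def U_def)
  moreover have "det U = 1"
  proof -
    have "upper_triangular U" using deg by (auto simp: U_def upper_triangular_def coeff_eq_0 kappa)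
    then have "det U = (\<Prod>i=0..<n. U $$ (i, i))"
      by (subst det_upper_triangular[of _ n]) (auto simp: U_def prod_list_diag_prod)
    also have "\<dots> = 1" using lead deg by (intro prod.neutral) (auto simp: U_def kappa)
    finally show ?thesis .
  qed
  moreover have "det (B * U) = det B * det U"
    by (rule det_mult[of _ n]) (auto simp: B_def U_def)
  ultimately show ?thesis by (simp add: B_def)
qed

lemma degree_prod_linear: 
  fixes a :: "'b \<Rightarrow> 'a :: idom"
  shows "finite A \<Longrightarrow> degree (\<Prod>j\<in>A. [:- a j, 1:]) = card A" "lead_coeff (\<Prod>j\<in>A. [:- a j, 1:]) = 1"
  by (subst degree_prod_sum_eq) (simp_all add: lead_coeff_prod)

text \<open>In the Newton basis of products of \<open>t - x j\<close> over \<open>j < l\<close>, row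
  \<open>i\<close> vanishes for \<open>l > i\<close>, so the matrix is triangular.\<close>

lemma det_vandermonde:
  fixes x :: "nat \<Rightarrow> 'a :: idom"
  shows "det (mat n n (\<lambda>(i, l). x i ^ l)) = (\<Prod>j<n. \<Prod>i<j. x j - x i)"
proof -
  let ?p = "\<lambda>l. \<Prod>j<l. [:- x j, 1:]"
  let ?A = "mat n n (\<lambda>(i, l). poly (?p l) (x i))"
  have "det ?A = det (mat n n (\<lambda>(i, l). poly (monom 1 l) (x i)))"
  proof (rule det_monic_basis[where \<kappa> = "\<lambda>c. c"])
    show "degree (?p l) = l" for l
      using degree_prod_linear(1)[of "{..<l}" x] by simp
    show "lead_coeff (?p l) = 1" for l
      by (rule degree_prod_linear(2))
  qed simp_all
  moreover have "det ?A = prod_list (diag_mat ?A)"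
    by (rule det_lower_triangular[of n]) (auto simp: poly_prod)
  moreover have "prod_list (diag_mat ?A) = (\<Prod>j<n. \<Prod>i<j. x j - x i)"
    by (simp add: prod_list_diag_prod poly_prod lessThan_atLeast0)
  ultimately show ?thesis by (simp add: poly_monom)
qed

lemma det_mat_leibniz:
  "det (mat n n (\<lambda>(i, l). f i l)) = (\<Sum>p | p permutes {0..<n}. signof p * (\<Prod>i<n. f i (p i)))"
proof -
  have "(\<Prod>i=0..<n. mat n n (\<lambda>(i, l). f i l) $$ (i, p i)) = (\<Prod>i<n. f i (p i))" if "p permutes {0..<n}" for p
    unfolding lessThan_atLeast0
  proof (rule prod.cong[OF refl])
    fix i assume "i \<in> {0..<n}"
    then show "mat n n (\<lambda>(i, l). f i l) $$ (i, p i) = f i (p i)"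
      using permutes_in_image[OF that, of i] by simp
  qed
  then show ?thesis by (subst det_def'[of _ n]) simp_all
qed

lemma det_scale_rows:
  "det (mat n n (\<lambda>(i, l). c i * a i l)) = (\<Prod>i<n. c i) * det (mat n n (\<lambda>(i, l). a i l))"
  unfolding det_mat_leibniz prod.distrib sum_distrib_left by (simp only: mult_ac)

lemma det_mat_transpose: "det (mat n n (\<lambda>(i, l). a l i)) = det (mat n n (\<lambda>(i, l). a i l))"
proof -
  have "mat n n (\<lambda>(i, l). a l i) = transpose_mat (mat n n (\<lambda>(i, l). a i l))"
    by (rule eq_matI) auto
  then show ?thesis using det_transpose[of "mat n n (\<lambda>(i, l). a i l)" n] by simp
qed

lemma det_scale_cols:
  "det (mat n n (\<lambda>(i, l). c l * a i l)) = (\<Prod>i<n. c i) * det (mat n n (\<lambda>(i, l). a i l))"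
  by (subst (1 2) det_mat_transpose[symmetric]) (rule det_scale_rows)

lemma det_cong_mat:
  assumes "\<And>i l. i < n \<Longrightarrow> l < n \<Longrightarrow> a i l = b i l"
  shows "det (mat n n (\<lambda>(i, l). a i l)) = det (mat n n (\<lambda>(i, l). b i l))"
  by (rule arg_cong[where f = det], rule eq_matI) (use assms in auto)

text \<open>Multilinearity in the rows; \<open>S\<close> is the set of rows in which the second term
  is taken.\<close>

lemma det_expand_row_differences:
  fixes a b :: "nat \<Rightarrow> nat \<Rightarrow> 'a :: comm_ring_1"
  shows "det (mat n n (\<lambda>(i, l). a i l - c i * b i l)) =
    (\<Sum>S\<in>Pow {..<n}. (-1) ^ card S * (\<Prod>i\<in>S. c i) * det (mat n n (\<lambda>(i, l). if i \<in> S then b i l else a i l)))"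
proof -
  let ?P = "{p. p permutes {0..<n}}"
  note D = det_mat_leibniz[of n]
  have "(\<Prod>i<n. a i (p i) - c i * b i (p i)) =
    (\<Sum>S\<in>Pow {..<n}. (-1) ^ card S * (\<Prod>i\<in>S. c i) * (\<Prod>i<n. if i \<in> S then b i (p i) else a i (p i)))" for p
  proof -
    have "(\<Prod>i<n. a i (p i) - c i * b i (p i)) = (\<Prod>i<n. - (c i * b i (p i)) + a i (p i))" by simp
    also have "\<dots> = (\<Sum>S\<in>Pow {..<n}. (\<Prod>i\<in>S. - (c i * b i (p i))) * (\<Prod>i\<in>{..<n}-S. a i (p i)))"
      by (rule prod_add) simp
    also have "\<dots> = (\<Sum>S\<in>Pow {..<n}. (-1) ^ card S * (\<Prod>i\<in>S. c i) * (\<Prod>i<n. if i \<in> S then b i (p i) else a i (p i)))"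
    proof (rule sum.cong[OF refl])
      fix S assume S: "S \<in> Pow {..<n}"
      then have "(\<Prod>i<n. if i \<in> S then b i (p i) else a i (p i)) = (\<Prod>i\<in>S. b i (p i)) * (\<Prod>i\<in>{..<n}-S. a i (p i))"
        by (subst prod.If_cases) (auto simp: Int_absorb1 Diff_eq)
      then show "(\<Prod>i\<in>S. - (c i * b i (p i))) * (\<Prod>i\<in>{..<n}-S. a i (p i)) =
         (-1) ^ card S * (\<Prod>i\<in>S. c i) * (\<Prod>i<n. if i \<in> S then b i (p i) else a i (p i))"
        by (simp add: prod_uminus prod.distrib mult_ac)
    qed
    finally show ?thesis .
  qed
  then have "det (mat n n (\<lambda>(i, l). a i l - c i * b i l)) = (\<Sum>p\<in>?P. \<Sum>S\<in>Pow {..<n}.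
     signof p * ((-1) ^ card S * (\<Prod>i\<in>S. c i) * (\<Prod>i<n. if i \<in> S then b i (p i) else a i (p i))))"
    by (simp only: D sum_distrib_left)
  also have "\<dots> = (\<Sum>S\<in>Pow {..<n}. \<Sum>p\<in>?P.
     signof p * ((-1) ^ card S * (\<Prod>i\<in>S. c i) * (\<Prod>i<n. if i \<in> S then b i (p i) else a i (p i))))"
    by (rule sum.swap)
  finally show ?thesis
    by (simp only: D sum_distrib_left mult_ac)
qed

text \<open>The sum is the coefficient of degree \<open>card A - 1\<close> in the interpolation
  polynomial of \<open>p\<close> at \<open>A\<close>, and that polynomial is \<open>p\<close>
  itself.\<close>

lemma lagrange_sum_zero:
  fixes p :: "'a :: field poly"
  assumes "finite A" "Suc (degree p) < card A"
  shows "(\<Sum>x\<in>A. poly p x / (\<Prod>y\<in>A-{x}. x - y)) = 0"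
proof -
  define c where "c x = poly p x / (\<Prod>y\<in>A-{x}. x - y)" for x
  define L where "L x = (\<Prod>y\<in>A-{x}. [:- y, 1:])" for x
  define q where "q = (\<Sum>x\<in>A. smult (c x) (L x))"
  have degL: "degree (L x) = card A - 1" "coeff (L x) (card A - 1) = 1" if "x \<in> A" for x
    using degree_prod_linear(1)[of "A-{x}" "\<lambda>y. y"] degree_prod_linear(2)[of "\<lambda>y. y" "A-{x}"] assms that by (auto simp: L_def)
  have "poly q z = poly p z" if z: "z \<in> A" for z
  proof -
    have "poly (L x) z = 0" if "x \<in> A - {z}" for x
      using z that assms by (auto simp: L_def poly_prod intro!: prod_zero)
    then have "(\<Sum>x\<in>A-{z}. c x * poly (L x) z) = 0" by simp
    then have "poly q z = c z * poly (L z) z"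
      using z assms by (simp add: q_def poly_sum sum.remove[of A z])
    moreover have "poly (L z) z \<noteq> 0" using assms by (auto simp: L_def poly_prod)
    moreover have "(\<Prod>y\<in>A-{z}. z - y) = poly (L z) z" by (simp add: L_def poly_prod)
    ultimately show ?thesis by (simp add: c_def)
  qed
  moreover have "degree q \<le> card A - 1"
    unfolding q_def by (rule degree_sum_le) (use assms degL degree_smult_le in \<open>auto intro: order_trans\<close>)
  ultimately have "q = p"
    using assms by (intro poly_eqI_degree[of A]) auto
  then have "coeff q (card A - 1) = 0"
    using assms by (auto intro!: coeff_eq_0)
  moreover have "coeff q (card A - 1) = (\<Sum>x\<in>A. c x)"
    unfolding q_def coeff_sum by (rule sum.cong[OF refl]) (simp only: coeff_smult degL mult_1_right)
  ultimately show ?thesis by (simp add: c_def)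
qed

section \<open>The bounded Littlewood identity\<close>

definition strict_lists :: "nat \<Rightarrow> nat \<Rightarrow> int list set" where
  "strict_lists N n = {ks. length ks = n \<and> sorted_wrt (<) ks \<and> set ks \<subseteq> {0..<int N}}"

lemma finite_strict_lists: "finite (strict_lists N n)"
  by (rule finite_subset[OF _ finite_lists_length_eq[of "{0..<int N}" n]]) (auto simp: strict_lists_def)

lemma strict_lists_0 [simp]: "strict_lists N 0 = {[]}"
  by (auto simp: strict_lists_def)

lemma strict_lists_none [simp]: "strict_lists 0 (Suc n) = {}"
  by (auto simp: strict_lists_def length_Suc_conv)

lemma sorted_wrt_map_shift:
  "sorted_wrt (<) (map (\<lambda>k. k + 1 :: int) ks) \<longleftrightarrow> sorted_wrt (<) ks"
  "sorted_wrt (<) (map (\<lambda>k. k - 1 :: int) ks) \<longleftrightarrow> sorted_wrt (<) ks"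
  by (induction ks) auto

text \<open>Split by whether the smallest entry is 0, then lower the positive entries by one; this
  drives the induction on \<open>N\<close>.\<close>

lemma strict_lists_Suc:
  "strict_lists (Suc N) (Suc n) = map (\<lambda>k. k + 1) ` strict_lists N (Suc n) \<union>
     (\<lambda>ks. 0 # map (\<lambda>k. k + 1) ks) ` strict_lists N n"
  (is "?L = ?A \<union> ?B")
proof (intro equalityI subsetI)
  fix ks assume "ks \<in> ?L"
  then obtain k ks' where ks: "ks = k # ks'" "length ks' = n" "sorted_wrt (<) (k # ks')" "set (k # ks') \<subseteq> {0..<int (Suc N)}"
    by (auto simp: strict_lists_def length_Suc_conv)
  have shift: "xs = map (\<lambda>k. k + 1) (map (\<lambda>k. k - 1) xs)" for xs :: "int list" by (induction xs) auto
  have mem: "sorted_wrt (<) xs \<Longrightarrow> set xs \<subseteq> {1..<int (Suc N)} \<Longrightarrow> map (\<lambda>k. k - 1) xs \<in> strict_lists N (length xs)" for xs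
    by (auto simp: strict_lists_def sorted_wrt_map_shift)
  show "ks \<in> ?A \<union> ?B"
  proof (cases "k = 0")
    case True
    have "set ks' \<subseteq> {1..<int (Suc N)}" using ks True by force
    then have "map (\<lambda>k. k - 1) ks' \<in> strict_lists N n"
      using mem[of ks'] ks by simp
    then show ?thesis using ks(1) True shift[of ks'] by blast
  next
    case False
    have "set ks \<subseteq> {1..<int (Suc N)}" using ks False by force
    then have "map (\<lambda>k. k - 1) ks \<in> strict_lists N (Suc n)"
      using mem[of ks] ks by simp
    then show ?thesis using shift[of ks] by blast
  qed
next
  fix ks assume "ks \<in> ?A \<union> ?B"
  then show "ks \<in> ?L" by (fastforce simp: strict_lists_def sorted_wrt_map_shift)
qed

lemma G_shift:
  assumes "finite X" "0 \<notin> X" "length ks = card X"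
  shows "G (map (\<lambda>k. k + 1) ks) X = \<Prod>X * G ks X"
  using assms
proof (induction ks arbitrary: X)
  case Nil
  then show ?case by simp
next
  case (Cons k ks)
  have "x powi (k + 1) * omega x X * G (map (\<lambda>k. k + 1) ks) (X - {x}) = \<Prod>X * (x powi k * omega x X * G ks (X - {x}))"
    if x: "x \<in> X" for x
  proof -
    have "length ks = card (X - {x})" using Cons.prems x by simp
    then have "G (map (\<lambda>k. k + 1) ks) (X - {x}) = \<Prod>(X - {x}) * G ks (X - {x})"
      using Cons.IH[of "X - {x}"] Cons.prems by auto
    moreover have "\<Prod>X = x * \<Prod>(X - {x})" using Cons.prems x by (intro prod.remove) auto
    moreover have "x \<noteq> 0" using Cons.prems x by auto
    ultimately show ?thesis by (simp add: power_int_add mult_ac)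
  qed
  then show ?case unfolding list.map G.simps sum_distrib_left by (rule sum.cong[OF refl])
qed

definition G_sum :: "nat \<Rightarrow> real set \<Rightarrow> real" where
  "G_sum N X = (\<Sum>ks\<in>strict_lists N (card X). G ks X)"

lemma G_sum_0: "finite X \<Longrightarrow> X \<noteq> {} \<Longrightarrow> G_sum 0 X = 0"
  by (cases "card X") (auto simp: G_sum_def)

text \<open>The first term collects the lists without 0. In the others the exponent 0 comes first;
  \<open>x\<close> is the variable that takes it, and the remaining exponents are lowered by
  one.\<close>

lemma G_sum_Suc:
  assumes "finite X" "0 \<notin> X" "X \<noteq> {}"
  shows "G_sum (Suc N) X = \<Prod>X * G_sum N X + (\<Sum>x\<in>X. omega x X * \<Prod>(X - {x}) * G_sum N (X - {x}))"
proof -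
  obtain n where n: "card X = Suc n" using assms by (cases "card X") auto
  have cx: "card (X - {x}) = n" if "x \<in> X" for x using n that assms by simp
  let ?s = "map (\<lambda>k. k + 1 :: int)"
  have inj: "inj ?s" by (auto intro: inj_mapI injI)
  have "G_sum (Suc N) X = (\<Sum>ks\<in>?s ` strict_lists N (Suc n). G ks X) + (\<Sum>ks\<in>(\<lambda>ks. 0 # ?s ks) ` strict_lists N n. G ks X)"
    unfolding G_sum_def n strict_lists_Suc
  proof (rule sum.union_disjoint)
    show "?s ` strict_lists N (Suc n) \<inter> (\<lambda>ks. 0 # ?s ks) ` strict_lists N n = {}"
      by (fastforce simp: strict_lists_def length_Suc_conv)
  qed (simp_all add: finite_strict_lists)
  also have "(\<Sum>ks\<in>?s ` strict_lists N (Suc n). G ks X) = (\<Sum>ks\<in>strict_lists N (Suc n). G (?s ks) X)"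
    by (rule sum.reindex_cong[OF _ refl refl]) (use inj in \<open>auto simp: inj_on_def inj_def\<close>)
  also have "\<dots> = (\<Sum>ks\<in>strict_lists N (Suc n). \<Prod>X * G ks X)"
    using assms n by (intro sum.cong refl G_shift) (auto simp: strict_lists_def)
  also have "\<dots> = \<Prod>X * G_sum N X"
    by (simp add: G_sum_def n sum_distrib_left)
  also have "(\<Sum>ks\<in>(\<lambda>ks. 0 # ?s ks) ` strict_lists N n. G ks X) = (\<Sum>ks\<in>strict_lists N n. G (0 # ?s ks) X)"
    by (rule sum.reindex_cong[OF _ refl refl]) (use inj in \<open>auto simp: inj_on_def inj_def\<close>)
  also have "\<dots> = (\<Sum>ks\<in>strict_lists N n. \<Sum>x\<in>X. omega x X * (\<Prod>(X - {x}) * G ks (X - {x})))"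
  proof (rule sum.cong[OF refl])
    fix ks assume ks: "ks \<in> strict_lists N n"
    have "G (?s ks) (X - {x}) = \<Prod>(X - {x}) * G ks (X - {x})" if "x \<in> X" for x
      using ks that assms cx[OF that] by (intro G_shift) (auto simp: strict_lists_def)
    then show "G (0 # ?s ks) X = (\<Sum>x\<in>X. omega x X * (\<Prod>(X - {x}) * G ks (X - {x})))"
      by simp
  qed
  also have "\<dots> = (\<Sum>x\<in>X. \<Sum>ks\<in>strict_lists N n. omega x X * (\<Prod>(X - {x}) * G ks (X - {x})))"
    by (rule sum.swap)
  also have "\<dots> = (\<Sum>x\<in>X. omega x X * \<Prod>(X - {x}) * G_sum N (X - {x}))"
    by (rule sum.cong[OF refl]) (simp only: G_sum_def cx sum_distrib_left mult.assoc)
  finally show ?thesis .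
qed

section \<open>The function x + x^2 and its interpolation identity\<close>

definition ff :: "real \<Rightarrow> real" where "ff x = x + x ^ 2"

lemma ff_less: "0 < x \<Longrightarrow> x < y \<Longrightarrow> ff x < ff y"
  by (simp add: ff_def power_strict_mono add_strict_mono)

lemma ff_pos: "0 < x \<Longrightarrow> 0 < ff x"
  by (simp add: ff_def add_pos_pos)

lemma ff_eq_iff: "0 < x \<Longrightarrow> 0 < y \<Longrightarrow> ff x = ff y \<longleftrightarrow> x = y"
  using ff_less[of x y] ff_less[of y x] by (metis less_irrefl linorder_neqE)

lemma ff_inverse: "x > 0 \<Longrightarrow> x ^ 3 * ff (1 / x) = ff x"
  by (simp add: ff_def field_simps power2_eq_square power3_eq_cube)

text \<open>Links the kernel to differences of values of \<open>ff\<close>: by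
  \<open>ff_inverse\<close> the right-hand side is \<open>y ^ 3 * (ff (1 / y) - ff x)\<close> for
  positive \<open>y\<close>, a difference between an inverted and a plain variable.\<close>

lemma kern_numerator: "y * (1 + y + x * y) * (1 - x * y) = ff y - y ^ 3 * ff x"
  by (simp add: ff_def algebra_simps power2_eq_square power3_eq_cube)

text \<open>Lagrange interpolation of \<open>\<Prod>(f(y) - y\<^sup>3 t)\<close> at the nodes \<open>f(Y)\<close>, \<open>0\<close> and \<open>-1\<close>.\<close>

lemma lagrange_identity:
  assumes "finite Y" "\<And>y. y \<in> Y \<Longrightarrow> y > 0"
  shows "(\<Sum>x\<in>Y. (1 - x) * (\<Prod>y\<in>Y-{x}. (ff y - y ^ 3 * ff x) / (ff y - ff x))) = 1 - \<Prod>Y"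
proof -
  define H where "H = (\<Prod>y\<in>Y. [:ff y, - (y ^ 3):])"
  define A where "A = insert 0 (insert (-1) (ff ` Y))"
  define e :: real where "e = (-1) ^ card Y"
  have e: "e * e = 1" "e \<noteq> 0" by (simp_all add: e_def flip: power_add mult_2)
  have pos: "ff y > 0" if "y \<in> Y" for y using ff_pos assms(2)[OF that] .
  have inj: "inj_on ff Y" using assms ff_eq_iff by (auto simp: inj_on_def)
  have fin: "finite A" using assms by (simp add: A_def)
  have n0: "0 \<notin> ff ` Y" "-1 \<notin> ff ` Y" using pos by force+
  have cA: "card A = card Y + 2"
    using assms inj n0 by (simp add: A_def card_image)
  have polyH: "poly H t = (\<Prod>y\<in>Y. ff y - y ^ 3 * t)" for t
    by (simp add: H_def poly_prod mult.commute)
  have "degree H \<le> card Y"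
  proof -
    have "degree H \<le> (\<Sum>y\<in>Y. degree [:ff y, - (y ^ 3):])"
      unfolding H_def using degree_prod_sum_le[OF assms(1), of "\<lambda>y. [:ff y, - (y ^ 3):]"] unfolding comp_def .
    also have "\<dots> \<le> (\<Sum>y\<in>Y. 1)" by (intro sum_mono) (simp add: degree_pCons_eq_if)
    finally show ?thesis by simp
  qed
  then have "(\<Sum>t\<in>A. poly H t / (\<Prod>s\<in>A-{t}. t - s)) = 0"
    using cA fin by (intro lagrange_sum_zero) auto
  moreover have "(\<Sum>t\<in>A. poly H t / (\<Prod>s\<in>A-{t}. t - s)) =
     poly H 0 / (\<Prod>s\<in>A-{0}. 0 - s) + poly H (-1) / (\<Prod>s\<in>A-{-1}. -1 - s) +
     (\<Sum>x\<in>Y. poly H (ff x) / (\<Prod>s\<in>A-{ff x}. ff x - s))"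
    using assms n0 inj unfolding A_def by (simp add: sum.reindex)
  moreover have "poly H 0 / (\<Prod>s\<in>A-{0}. 0 - s) = e"
  proof -
    have "A - {0} = insert (-1) (ff ` Y)" using n0 unfolding A_def by (simp add: insert_Diff_if)
    then have "(\<Prod>s\<in>A-{0}. 0 - s) = (\<Prod>y\<in>Y. - ff y)"
      using assms n0 inj by (simp add: prod.reindex)
    also have "\<dots> = e * (\<Prod>y\<in>Y. ff y)" by (simp add: prod_uminus e_def)
    moreover have "(\<Prod>y\<in>Y. ff y) \<noteq> 0" using assms pos by (force simp: prod_zero_iff)
    ultimately show ?thesis using e by (simp add: polyH divide_simps) 
  qed
  moreover have "poly H (-1) / (\<Prod>s\<in>A-{-1}. -1 - s) = - (e * \<Prod>Y)"
  proof -
    have "A - {-1} = insert 0 (ff ` Y)" using n0 unfolding A_def by (simp add: insert_Diff_if)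
    then have "(\<Prod>s\<in>A-{-1}. -1 - s) = - (\<Prod>y\<in>Y. - (1 + ff y))"
      using assms n0 inj by (simp add: prod.reindex)
    also have "\<dots> = - (e * (\<Prod>y\<in>Y. 1 + ff y))" unfolding prod_uminus e_def by simp
    finally have 1: "(\<Prod>s\<in>A-{-1}. -1 - s) = - (e * (\<Prod>y\<in>Y. 1 + ff y))" .
    \<comment> \<open>Since \<open>ff y + y ^ 3 = y * (1 + ff y)\<close>, the node -1 is the one
      that produces \<open>\<Prod>Y\<close>.\<close>
    have 2: "poly H (-1) = \<Prod>Y * (\<Prod>y\<in>Y. 1 + ff y)"
      unfolding polyH prod.distrib[symmetric]
      by (rule prod.cong) (simp_all add: ff_def algebra_simps power2_eq_square power3_eq_cube)
    have 3: "(\<Prod>y\<in>Y. 1 + ff y) \<noteq> 0" using assms pos by (force simp: prod_zero_iff)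
    show ?thesis unfolding 1 2 using 3 e by (simp add: divide_simps)
  qed
  moreover have "poly H (ff x) / (\<Prod>s\<in>A-{ff x}. ff x - s) =
     - e * ((1 - x) * (\<Prod>y\<in>Y-{x}. (ff y - y ^ 3 * ff x) / (ff y - ff x)))" if x: "x \<in> Y" for x
  proof -
    have x0: "x > 0" using assms x by simp
    have "ff ` Y - {ff x} = ff ` (Y - {x})" using inj x by (auto simp: inj_on_def)
    then have "A - {ff x} = insert 0 (insert (-1) (ff ` (Y - {x})))"
      using pos[OF x] unfolding A_def by (simp add: insert_Diff_if)
    moreover have "inj_on ff (Y - {x})" using inj by (rule inj_on_subset) auto
    moreover have "0 \<notin> ff ` (Y - {x})" "-1 \<notin> ff ` (Y - {x})" using n0 by blast+
    ultimately have "(\<Prod>s\<in>A-{ff x}. ff x - s) = ff x * (ff x + 1) * (\<Prod>y\<in>Y-{x}. ff x - ff y)"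
      using assms by (simp add: prod.reindex)
    also have "(\<Prod>y\<in>Y-{x}. ff x - ff y) = (\<Prod>y\<in>Y-{x}. - (ff y - ff x))" by simp
    also have "\<dots> = - e * (\<Prod>y\<in>Y-{x}. ff y - ff x)"
    proof -
      have "card Y = Suc (card (Y - {x}))" using assms(1) x by (metis card_Suc_Diff1)
      then show ?thesis unfolding prod_uminus e_def by simp
    qed
    finally have 1: "(\<Prod>s\<in>A-{ff x}. ff x - s) = - e * (ff x * (ff x + 1)) * (\<Prod>y\<in>Y-{x}. ff y - ff x)" by simp
    have 2: "poly H (ff x) = (ff x * (1 - x ^ 3)) * (\<Prod>y\<in>Y-{x}. ff y - y ^ 3 * ff x)"
      unfolding polyH using assms(1) x by (subst prod.remove[of Y x]) (simp_all add: algebra_simps)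
    \<comment> \<open>Here 1 - x^3 = (1 - x) (1 + f(x)), so the distances from f(x) to the nodes 0
      and -1 cancel and 1 - x is left. This explains the choice of the two extra nodes.\<close>
    have 3: "ff x * (1 - x ^ 3) = (ff x * (ff x + 1)) * (1 - x)"
      by (simp add: ff_def algebra_simps power2_eq_square power3_eq_cube)
    have 4: "ff x * (ff x + 1) \<noteq> 0" using pos[OF x] by simp
    have 5: "- e * (a * c) * b \<noteq> 0 \<Longrightarrow> (a * c) * u * v / (- e * (a * c) * b) = - e * (u * (v / b))" for a b c u v :: real
      using e by (simp add: divide_simps)
    have 6: "(\<Prod>y\<in>Y-{x}. ff y - ff x) \<noteq> 0"
      using assms(1) inj x by (auto simp: prod_zero_iff inj_on_def)
    show ?thesis unfolding 1 2 3 prod_dividef by (rule 5) (use 4 6 e in auto)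
  qed
  ultimately have "e - e * \<Prod>Y - e * (\<Sum>x\<in>Y. (1 - x) * (\<Prod>y\<in>Y-{x}. (ff y - y ^ 3 * ff x) / (ff y - ff x))) = 0"
    by (simp add: sum_distrib_left sum_negf)
  then have "e * (1 - \<Prod>Y - (\<Sum>x\<in>Y. (1 - x) * (\<Prod>y\<in>Y-{x}. (ff y - y ^ 3 * ff x) / (ff y - ff x)))) = 0"
    by (simp only: right_diff_distrib mult_1_right)
  then show ?thesis using e(2) by simp
qed

section \<open>The determinant side, expanded over sets of inverted variables\<close>

definition pair_prod :: "(real \<Rightarrow> real \<Rightarrow> real) \<Rightarrow> real set \<Rightarrow> real" where
  "pair_prod h X = (\<Prod>(x, y)\<in>{(x, y)\<in>X \<times> X. x < y}. h x y)"

lemma pair_prod_empty [simp]: "pair_prod h {} = 1"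
  by (simp add: pair_prod_def)

lemma pair_prod_insert:
  assumes "finite X" "z \<notin> X" "\<And>x y. h x y = h y x"
  shows "pair_prod h (insert z X) = (\<Prod>y\<in>X. h z y) * pair_prod h X"
proof -
  let ?P = "\<lambda>X. {(x, y)\<in>X \<times> X. x < y}"
  let ?f = "\<lambda>y. if z < y then (z, y) else (y, z)"
  have split: "?P (insert z X) = ?f ` X \<union> ?P X"
  proof (intro equalityI subsetI)
    fix p assume "p \<in> ?P (insert z X)"
    then obtain x y where p: "p = (x, y)" "x \<in> insert z X" "y \<in> insert z X" "x < y" by auto
    then consider "x \<in> X" "y \<in> X" | "x = z" "y \<in> X" | "y = z" "x \<in> X" using assms by auto
    then show "p \<in> ?f ` X \<union> ?P X"
    proof cases
      case 2
      then have "p = ?f y" using p by simp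
      then show ?thesis using 2 by blast
    next
      case 3
      then have "p = ?f x" using p by simp
      then show ?thesis using 3 by blast
    qed (use p in auto)
  next
    fix p assume "p \<in> ?f ` X \<union> ?P X"
    then show "p \<in> ?P (insert z X)"
    proof
      assume "p \<in> ?f ` X"
      then obtain y where y: "y \<in> X" "p = ?f y" by blast
      then have "y \<noteq> z" using assms by blast
      then show ?thesis using y by (cases "z < y") auto
    qed auto
  qed
  have fin: "finite (?P X)" by (rule finite_subset[of _ "X \<times> X"]) (use assms in auto)
  have "pair_prod h (insert z X) = (\<Prod>(x, y)\<in>?f ` X. h x y) * (\<Prod>(x, y)\<in>?P X. h x y)"
    unfolding pair_prod_def split
    by (rule prod.union_disjoint) (use assms fin in \<open>auto split: if_splits\<close>)
  also have "(\<Prod>(x, y)\<in>?f ` X. h x y) = (\<Prod>y\<in>X. case ?f y of (x, y) \<Rightarrow> h x y)"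
    by (rule prod.reindex_cong[OF _ refl refl]) (auto simp: inj_on_def split: if_splits)
  also have "\<dots> = (\<Prod>y\<in>X. h z y)"
    by (rule prod.cong[OF refl]) (simp add: assms(3)[of _ z])
  finally show ?thesis by (simp add: pair_prod_def)
qed

lemma pair_prod_image:
  fixes x :: "nat \<Rightarrow> real"
  assumes "inj_on x {..<n}" "\<And>u v. h u v = h v u"
  shows "pair_prod h (x ` {..<n}) = (\<Prod>j<n. \<Prod>i<j. h (x i) (x j))"
  using assms(1)
proof (induction n)
  case 0
  then show ?case by simp
next
  case (Suc n)
  have inj: "inj_on x {..<n}" and notin: "x n \<notin> x ` {..<n}"
    using Suc.prems by (auto simp: lessThan_Suc)
  have "pair_prod h (x ` {..<Suc n}) = (\<Prod>y\<in>x ` {..<n}. h (x n) y) * pair_prod h (x ` {..<n})"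
    using pair_prod_insert[OF _ notin, of h] assms(2) by (simp add: lessThan_Suc)
  also have "(\<Prod>y\<in>x ` {..<n}. h (x n) y) = (\<Prod>i<n. h (x i) (x n))"
    unfolding prod.reindex[OF inj] comp_def by (rule prod.cong[OF refl]) (rule assms(2))
  finally show ?case using Suc.IH[OF inj] by simp
qed

text \<open>\<open>S\<close> consists of the inverted variables: the rows of the determinant in
  which the term with \<open>ff (1 / x)\<close> is taken.\<close>

definition node :: "real set \<Rightarrow> real \<Rightarrow> real" where
  "node S x = (if x \<in> S then ff (1 / x) else ff x)"

definition quot :: "real set \<Rightarrow> real \<Rightarrow> real \<Rightarrow> real" where
  "quot S x y = (node S y - node S x) / ((y - x) * (1 - x * y))"

lemma quot_commute: "quot S x y = quot S y x"
proof -
  have "(- a) / ((- b) * c) = a / (b * c)" for a b c :: real by simp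
  from this[of "node S y - node S x" "y - x" "1 - x * y"] show ?thesis
    unfolding quot_def by (simp only: minus_diff_eq mult.commute[of y x])
qed

text \<open>The Vandermonde product in the nodes, divided by the elementary denominators.\<close>

definition K :: "real set \<Rightarrow> real set \<Rightarrow> real" where
  "K S X = (\<Prod>x\<in>X. 1 / (1 - x)) * pair_prod (quot S) X"

text \<open>By \<open>kern_numerator\<close>, \<open>kern x y * y\<close> is the pair factor
  \<open>quot S x y\<close> times a correction: \<open>y ^ 3\<close> for an inverted
  \<open>y\<close>, and otherwise a ratio. The ratios together with \<open>1 - x\<close> form the
  summand of \<open>lagrange_identity\<close> for \<open>X - S\<close>.\<close>

lemma K_remove:
  assumes X: "finite X" "\<And>x. x \<in> X \<Longrightarrow> x > 1" and S: "S \<subseteq> X" and x: "x \<in> X" "x \<notin> S"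
  shows "omega x X * \<Prod>(X - {x}) * K S (X - {x}) =
    K S X * (\<Prod>s\<in>S. s ^ 3) * ((1 - x) * (\<Prod>y\<in>X-S-{x}. (ff y - y ^ 3 * ff x) / (ff y - ff x)))"
proof -
  let ?r = "\<lambda>y. if y \<in> S then y ^ 3 else (ff y - y ^ 3 * ff x) / (ff y - ff x)"
  have x1: "x > 1" using X x by simp
  have "kern x y * y = quot S x y * ?r y" if y: "y \<in> X - {x}" for y
  proof -
    have y1: "y > 1" "y \<noteq> x" using X y by auto
    have xy: "1 - x * y \<noteq> 0" "y - x \<noteq> 0" using less_1_mult[OF x1 y1(1)] y1 by auto
    have ne: "ff y - ff x \<noteq> 0" using ff_eq_iff[of y x] x1 y1 by simp
    have num: "kern x y * y = (ff y - y ^ 3 * ff x) / ((y - x) * (1 - x * y))"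
      unfolding kern_numerator[symmetric] nonzero_mult_divide_mult_cancel_right[OF xy(1)]
      by (simp add: kern_def mult.commute)
    show ?thesis
    proof (cases "y \<in> S")
      case True
      have "(ff (1 / y) - ff x) * y ^ 3 = ff y - y ^ 3 * ff x"
        using ff_inverse[of y] y1 by (simp add: algebra_simps)
      then show ?thesis using True x unfolding num by (simp add: quot_def node_def)
    next
      case False
      then show ?thesis using x ne unfolding num by (simp add: quot_def node_def)
    qed
  qed
  then have "(\<Prod>y\<in>X-{x}. kern x y * y) = (\<Prod>y\<in>X-{x}. quot S x y * ?r y)"
    by (intro prod.cong refl)
  then have 1: "omega x X * \<Prod>(X - {x}) = (\<Prod>y\<in>X-{x}. quot S x y) * (\<Prod>y\<in>X-{x}. ?r y)"
    by (simp add: omega_def prod.distrib)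
  have "X - {x} = S \<union> (X - S - {x})" using S x by auto
  then have "(\<Prod>y\<in>X-{x}. ?r y) = (\<Prod>y\<in>S \<union> (X - S - {x}). ?r y)" by simp
  also have "\<dots> = (\<Prod>y\<in>S. ?r y) * (\<Prod>y\<in>X-S-{x}. ?r y)"
    by (rule prod.union_disjoint) (use X S finite_subset in auto)
  also have "(\<Prod>y\<in>S. ?r y) = (\<Prod>s\<in>S. s ^ 3)" by (rule prod.cong) auto
  also have "(\<Prod>y\<in>X-S-{x}. ?r y) = (\<Prod>y\<in>X-S-{x}. (ff y - y ^ 3 * ff x) / (ff y - ff x))"
    by (rule prod.cong) auto
  finally have 2: "(\<Prod>y\<in>X-{x}. ?r y) = (\<Prod>s\<in>S. s ^ 3) * (\<Prod>y\<in>X-S-{x}. (ff y - y ^ 3 * ff x) / (ff y - ff x))" .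
  have p: "pair_prod (quot S) X = (\<Prod>y\<in>X-{x}. quot S x y) * pair_prod (quot S) (X - {x})"
    using pair_prod_insert[of "X - {x}" x "quot S", OF _ _ quot_commute] X(1) x(1) by (simp add: insert_absorb)
  have "K S X = (1 / (1 - x)) * (\<Prod>y\<in>X-{x}. quot S x y) * K S (X - {x})"
    unfolding K_def p prod.remove[OF X(1) x(1), of "\<lambda>x. 1 / (1 - x)"] by (simp only: mult_ac)
  then have 3: "(1 - x) * K S X = (\<Prod>y\<in>X-{x}. quot S x y) * K S (X - {x})"
    using x1 by simp
  have "omega x X * \<Prod>(X - {x}) * K S (X - {x}) = ((\<Prod>y\<in>X-{x}. quot S x y) * K S (X - {x})) *
      ((\<Prod>s\<in>S. s ^ 3) * (\<Prod>y\<in>X-S-{x}. (ff y - y ^ 3 * ff x) / (ff y - ff x)))"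
    unfolding 1 2 by (simp only: mult_ac)
  then show ?thesis
    unfolding 3[symmetric] by (simp only: mult_ac)
qed

text \<open>The closed form for \<open>G_sum\<close> before it is folded into a determinant; the
  expansion over \<open>S\<close> is the form in which the recurrence in \<open>N\<close> can be
  checked term by term.\<close>

definition Q :: "nat \<Rightarrow> real set \<Rightarrow> real" where
  "Q N X = (\<Sum>S\<in>Pow X. (-1) ^ card S * (\<Prod>s\<in>S. s ^ (N + 2 * card X - 2)) * K S X)"

lemma Q_Suc:
  assumes X: "finite X" "\<And>x. x \<in> X \<Longrightarrow> x > 1" and ne: "X \<noteq> {}"
  shows "Q (Suc N) X = \<Prod>X * Q N X + (\<Sum>x\<in>X. omega x X * \<Prod>(X - {x}) * Q N (X - {x}))"
proof -
  let ?e = "N + 2 * card X - 2"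
  let ?t = "\<lambda>x S. omega x X * \<Prod>(X - {x}) * ((-1) ^ card S * (\<Prod>s\<in>S. s ^ (N + 2 * card (X - {x}) - 2)) * K S (X - {x}))"
  let ?l = "\<lambda>S x. (1 - x) * (\<Prod>y\<in>X-S-{x}. (ff y - y ^ 3 * ff x) / (ff y - ff x))"
  have cX: "card X \<ge> 1" using X ne by (simp add: Suc_le_eq card_gt_0_iff)
  have "(\<Sum>x\<in>X. omega x X * \<Prod>(X - {x}) * Q N (X - {x})) = (\<Sum>x\<in>X. \<Sum>S\<in>Pow (X - {x}). ?t x S)"
    by (simp only: Q_def sum_distrib_left)
  also have "\<dots> = (\<Sum>x\<in>X. \<Sum>S | S \<in> Pow X \<and> x \<notin> S. ?t x S)"
    by (intro sum.cong refl) auto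
  also have "\<dots> = (\<Sum>S\<in>Pow X. \<Sum>x | x \<in> X \<and> x \<notin> S. ?t x S)"
    by (rule sum.swap_restrict) (use X in auto)
  finally have 1: "(\<Sum>x\<in>X. omega x X * \<Prod>(X - {x}) * Q N (X - {x})) = (\<Sum>S\<in>Pow X. \<Sum>x | x \<in> X \<and> x \<notin> S. ?t x S)" .
  have 2: "(\<Sum>x | x \<in> X \<and> x \<notin> S. ?t x S) =
    (-1) ^ card S * (\<Prod>s\<in>S. s ^ Suc ?e) * K S X * (1 - \<Prod>(X - S))" if S: "S \<in> Pow X" for S
  proof -
    have "?t x S = (-1) ^ card S * (\<Prod>s\<in>S. s ^ Suc ?e) * K S X * ?l S x" if x: "x \<in> X" "x \<notin> S" for x
    proof -
      \<comment> \<open>Removing \<open>x\<close> lowers the exponent by 2 and \<open>s ^ 3\<close>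
        raises it by 3, which gives the exponent for \<open>Suc N\<close>. A nonempty
        \<open>S\<close> avoiding \<open>x\<close> forces \<open>card X \<ge> 2\<close>, so the
        natural subtractions are exact.\<close>
      have e: "(\<Prod>s\<in>S. s ^ (N + 2 * card (X - {x}) - 2)) * (\<Prod>s\<in>S. s ^ 3) = (\<Prod>s\<in>S. s ^ Suc ?e)"
      proof (cases "S = {}")
        case False
        then have "card (insert x S) \<le> card X" using x S X by (intro card_mono) auto
        moreover have "card (insert x S) = Suc (card S)" "card S \<ge> 1"
          using x S X False finite_subset[of S X] by (auto simp: Suc_le_eq card_gt_0_iff)
        ultimately have "N + 2 * card (X - {x}) - 2 + 3 = Suc ?e"
          using x X by simp
        then show ?thesis by (simp only: prod.distrib[symmetric] power_add[symmetric])
      qed simp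
      have "S \<subseteq> X" using S by simp
      from K_remove[OF X this x]
      have k: "omega x X * \<Prod>(X - {x}) * K S (X - {x}) = K S X * (\<Prod>s\<in>S. s ^ 3) * ?l S x" by simp
      have "?t x S = (-1) ^ card S * (\<Prod>s\<in>S. s ^ (N + 2 * card (X - {x}) - 2)) * (omega x X * \<Prod>(X - {x}) * K S (X - {x}))"
        by (simp only: mult_ac)
      also have "\<dots> = (-1) ^ card S * ((\<Prod>s\<in>S. s ^ (N + 2 * card (X - {x}) - 2)) * (\<Prod>s\<in>S. s ^ 3)) * K S X * ?l S x"
        unfolding k by (simp only: mult_ac)
      finally show ?thesis unfolding e .
    qed
    then have "(\<Sum>x | x \<in> X \<and> x \<notin> S. ?t x S) = (\<Sum>x | x \<in> X \<and> x \<notin> S. (-1) ^ card S * (\<Prod>s\<in>S. s ^ Suc ?e) * K S X * ?l S x)"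
      by (intro sum.cong refl) simp
    also have "\<dots> = (\<Sum>x\<in>X-S. (-1) ^ card S * (\<Prod>s\<in>S. s ^ Suc ?e) * K S X * ?l S x)"
      by (rule sum.cong) auto
    also have "(\<Sum>x\<in>X-S. (-1) ^ card S * (\<Prod>s\<in>S. s ^ Suc ?e) * K S X * ?l S x) =
      (-1) ^ card S * (\<Prod>s\<in>S. s ^ Suc ?e) * K S X * (\<Sum>x\<in>X-S. ?l S x)"
      by (simp only: sum_distrib_left)
    also have "(\<Sum>x\<in>X-S. ?l S x) = 1 - \<Prod>(X - S)"
      by (rule lagrange_identity) (use X in force)+
    finally show ?thesis .
  qed
  \<comment> \<open>For each \<open>S\<close>, write 1 as \<open>\<Prod>(X - S)\<close> plus
    \<open>1 - \<Prod>(X - S)\<close>. The first part completes \<open>\<Prod>S\<close> to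
    \<open>\<Prod>X\<close>; the second is the value found by interpolation.\<close>
  have "Q (Suc N) X = (\<Sum>S\<in>Pow X. \<Prod>X * ((-1) ^ card S * (\<Prod>s\<in>S. s ^ ?e) * K S X) + (\<Sum>x | x \<in> X \<and> x \<notin> S. ?t x S))"
    unfolding Q_def
  proof (rule sum.cong[OF refl])
    fix S assume S: "S \<in> Pow X"
    have fS: "finite S" using S X finite_subset by auto
    have "\<Prod>X = \<Prod>S * \<Prod>(X - S)" using S X by (metis Pow_iff mult.commute prod.subset_diff)
    moreover have "(\<Prod>s\<in>S. s ^ Suc ?e) = \<Prod>S * (\<Prod>s\<in>S. s ^ ?e)" by (simp add: prod.distrib)
    moreover have "Suc N + 2 * card X - 2 = Suc ?e" using cX by simp
    ultimately show "(-1) ^ card S * (\<Prod>s\<in>S. s ^ (Suc N + 2 * card X - 2)) * K S X =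
      \<Prod>X * ((-1) ^ card S * (\<Prod>s\<in>S. s ^ ?e) * K S X) + (\<Sum>x | x \<in> X \<and> x \<notin> S. ?t x S)"
      unfolding 2[OF S] by (simp add: algebra_simps)
  qed
  then show ?thesis
    unfolding 1 by (simp only: sum.distrib Q_def sum_distrib_left)
qed

lemma Q_image:
  assumes inj: "inj_on x {..<n}"
  shows "Q N (x ` {..<n}) = (\<Prod>i<n. 1 / (1 - x i)) * (\<Prod>j<n. \<Prod>i<j. 1 / ((x j - x i) * (1 - x i * x j))) *
    det (mat n n (\<lambda>(i, l). ff (x i) ^ l - x i ^ (N + 2 * n - 2) * ff (1 / x i) ^ l))"
proof -
  let ?e = "N + 2 * n - 2" and ?X = "x ` {..<n}"
  let ?C = "(\<Prod>i<n. 1 / (1 - x i)) * (\<Prod>j<n. \<Prod>i<j. 1 / ((x j - x i) * (1 - x i * x j)))"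
  let ?D = "\<lambda>T. det (mat n n (\<lambda>(i, l). if i \<in> T then ff (1 / x i) ^ l else ff (x i) ^ l))"
  have card: "card ?X = n" using card_image[OF inj] by simp
  have K: "K (x ` T) ?X = ?C * ?D T" if T: "T \<in> Pow {..<n}" for T
  proof -
    let ?nd = "\<lambda>i. if i \<in> T then ff (1 / x i) else ff (x i)"
    have nd: "node (x ` T) (x i) = ?nd i" if "i < n" for i
      using T that inj by (auto simp: node_def inj_on_def)
    have "K (x ` T) ?X = (\<Prod>i<n. 1 / (1 - x i)) * (\<Prod>j<n. \<Prod>i<j. quot (x ` T) (x i) (x j))"
      unfolding K_def pair_prod_image[OF inj quot_commute] prod.reindex[OF inj] comp_def ..
    also have "(\<Prod>j<n. \<Prod>i<j. quot (x ` T) (x i) (x j)) = (\<Prod>j<n. \<Prod>i<j. 1 / ((x j - x i) * (1 - x i * x j)) * (?nd j - ?nd i))"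
      by (intro prod.cong refl) (simp add: quot_def nd)
    also have "\<dots> = (\<Prod>j<n. \<Prod>i<j. 1 / ((x j - x i) * (1 - x i * x j))) * (\<Prod>j<n. \<Prod>i<j. ?nd j - ?nd i)"
      by (simp only: prod.distrib)
    also have "(\<Prod>j<n. \<Prod>i<j. ?nd j - ?nd i) = det (mat n n (\<lambda>(i, l). ?nd i ^ l))"
      by (rule det_vandermonde[symmetric])
    also have "(\<lambda>(i, l). ?nd i ^ l) = (\<lambda>(i, l). if i \<in> T then ff (1 / x i) ^ l else ff (x i) ^ l)"
      by (auto simp: fun_eq_iff)
    finally show ?thesis by (simp only: mult.assoc)
  qed
  have "Q N ?X = (\<Sum>S\<in>(`) x ` Pow {..<n}. (-1) ^ card S * (\<Prod>s\<in>S. s ^ ?e) * K S ?X)"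
    unfolding Q_def card by (simp only: image_Pow_surj)
  also have "\<dots> = (\<Sum>T\<in>Pow {..<n}. (-1) ^ card (x ` T) * (\<Prod>s\<in>x ` T. s ^ ?e) * K (x ` T) ?X)"
    by (rule sum.reindex_cong[OF _ refl refl]) (rule inj_on_image_Pow[OF inj])
  also have "\<dots> = (\<Sum>T\<in>Pow {..<n}. ?C * ((-1) ^ card T * (\<Prod>i\<in>T. x i ^ ?e) * ?D T))"
  proof (rule sum.cong[OF refl])
    fix T assume T: "T \<in> Pow {..<n}"
    then have i: "inj_on x T" using inj by (auto intro: inj_on_subset)
    show "(-1) ^ card (x ` T) * (\<Prod>s\<in>x ` T. s ^ ?e) * K (x ` T) ?X = ?C * ((-1) ^ card T * (\<Prod>i\<in>T. x i ^ ?e) * ?D T)"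
      unfolding K[OF T] card_image[OF i] prod.reindex[OF i] comp_def by (simp only: mult_ac)
  qed
  finally show ?thesis
    unfolding det_expand_row_differences sum_distrib_left[symmetric] .
qed

lemma det_zero_col:
  assumes "A \<in> carrier_mat n n" "k < n" "\<And>i. i < n \<Longrightarrow> A $$ (i, k) = 0"
  shows "det A = 0"
  unfolding det_def'[OF assms(1)]
proof (rule sum.neutral, rule ballI)
  fix p assume "p \<in> {p. p permutes {0..<n}}"
  then have p: "p permutes {0..<n}" by simp
  then obtain i where "i \<in> {0..<n}" "p i = k"
    using permutes_image[OF p] assms(2) by (metis atLeastLessThan_iff imageE le0)
  then have "(\<Prod>i=0..<n. A $$ (i, p i)) = 0"
    using assms(3)[of i] by (intro prod_zero bexI[of _ i]) auto
  then show "signof p * (\<Prod>i=0..<n. A $$ (i, p i)) = 0" by simp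
qed

text \<open>For N = 0 the exponent is 2m with m = card X - 1. Replacing the last column by the m-th
  power of 1 + f makes it vanish, because x^2 (1 + f(1/x)) = 1 + f(x).\<close>

lemma Q_0:
  assumes X: "finite X" "\<And>x. x \<in> X \<Longrightarrow> x > 1" and ne: "X \<noteq> {}"
  shows "Q 0 X = 0"
proof -
  obtain m where m: "card X = Suc m" using X ne by (cases "card X") auto
  let ?n = "Suc m"
  obtain x where x: "bij_betw x {..<?n} X"
    using ex_bij_betw_nat_finite[OF X(1)] m by (auto simp: lessThan_atLeast0)
  have inj: "inj_on x {..<?n}" and im: "x ` {..<?n} = X" using x by (auto simp: bij_betw_def)
  let ?phi = "\<lambda>i p. poly p (ff (x i)) - x i ^ (2 * m) * poly p (ff (1 / x i))"
  let ?p = "\<lambda>l. if l = m then [:1, 1 :: real:] ^ m else monom 1 l"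
  have "det (mat ?n ?n (\<lambda>(i, l). ?phi i (?p l))) = det (mat ?n ?n (\<lambda>(i, l). ?phi i (monom 1 l)))"
  proof (rule det_monic_basis[where \<kappa> = "\<lambda>c. c"])
    have "lead_coeff ([:1, 1 :: real:] ^ m) = 1" unfolding lead_coeff_power by simp
    then show "lead_coeff (?p l) = 1" for l by (simp add: degree_monom_eq)
  qed (simp_all add: algebra_simps degree_power_eq degree_monom_eq)
  moreover have "det (mat ?n ?n (\<lambda>(i, l). ?phi i (?p l))) = 0"
  proof (rule det_zero_col[of _ ?n m])
    fix i assume i: "i < ?n"
    then have "x i > 1" using X(2)[of "x i"] im by auto
    then have "x i ^ 2 * (1 + ff (1 / x i)) = 1 + ff (x i)"
      by (simp add: ff_def field_simps power2_eq_square)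
    then have "x i ^ (2 * m) * (1 + ff (1 / x i)) ^ m = (1 + ff (x i)) ^ m"
      by (simp add: power_mult flip: power_mult_distrib)
    then show "mat ?n ?n (\<lambda>(i, l). ?phi i (?p l)) $$ (i, m) = 0"
      using i by simp
  qed auto
  ultimately show ?thesis
    using Q_image[OF inj, of 0] by (simp add: im poly_monom)
qed

text \<open>Both sides satisfy the same recurrence and vanish at N = 0 for nonempty
  \<open>X\<close>; for the empty set both are 1. The bound \<open>x > 1\<close> keeps 1 - x and 1 -
  x y nonzero and makes \<open>ff\<close> injective.\<close>

lemma G_sum_eq_Q:
  assumes "finite X" "\<And>x. x \<in> X \<Longrightarrow> x > 1"
  shows "G_sum N X = Q N X"
proof (cases "X = {}")
  case True
  then show ?thesis by (simp add: G_sum_def Q_def K_def)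
next
  case False
  show ?thesis using assms False
  proof (induction N arbitrary: X)
    case 0
    then show ?case by (simp add: G_sum_0 Q_0)
  next
    case (Suc N)
    have IH: "G_sum N Y = Q N Y" if "Y \<subseteq> X" for Y
      using Suc.IH[of Y] Suc.prems that finite_subset[of Y X]
      by (cases "Y = {}") (auto simp: G_sum_def Q_def K_def)
    have "0 \<notin> X" using Suc.prems(2) by force
    then show ?case
      using G_sum_Suc[of X N] Q_Suc[of X N] Suc.prems IH[of X] IH[of "X - {_}"] by simp
  qed
qed

section \<open>Specialization at equal variables\<close>

definition fpoly :: "real poly" where "fpoly = [:0, 1, 1:]"

lemma degree_fpoly_power [simp]: "degree (fpoly ^ l) = 2 * l"
  by (simp add: fpoly_def degree_power_eq)

lemma poly_eq_sum_le:
  fixes p :: "real poly"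
  assumes "degree p \<le> B"
  shows "poly p x = (\<Sum>c\<le>B. coeff p c * x ^ c)"
proof -
  have "(\<Sum>c\<le>B. coeff p c * x ^ c) = (\<Sum>c\<le>degree p. coeff p c * x ^ c)"
    by (rule sum.mono_neutral_right) (use assms in \<open>auto simp: coeff_eq_0\<close>)
  then show ?thesis by (simp add: poly_altdef)
qed

text \<open>Chebyshev polynomials of the second kind in (t + 2)/2. The shift makes the argument w +
  1/w - 2, which vanishes to second order at w = 1.\<close>

fun cheb :: "nat \<Rightarrow> real poly" where
  "cheb 0 = 1"
| "cheb (Suc 0) = [:2, 1:]"
| "cheb (Suc (Suc i)) = [:2, 1:] * cheb (Suc i) - cheb i"

lemma degree_lead_cheb: "degree (cheb i) = i \<and> lead_coeff (cheb i) = 1"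
proof (induction i rule: cheb.induct)
  case (3 i)
  then have d: "degree (cheb (Suc i)) = Suc i" "degree (cheb i) = i" and l: "lead_coeff (cheb (Suc i)) = 1"
    by blast+
  have "cheb (Suc i) \<noteq> 0" using d by auto
  then have deg: "degree ([:2, 1:] * cheb (Suc i)) = Suc (Suc i)"
    by (subst degree_mult_eq) (simp_all add: d)
  have lead: "lead_coeff ([:2, 1:] * cheb (Suc i)) = 1"
    unfolding lead_coeff_mult l by simp
  have "degree (- cheb i) < degree ([:2, 1:] * cheb (Suc i))"
    unfolding deg by (simp add: d)
  from degree_add_eq_left[OF this] have deg': "degree (cheb (Suc (Suc i))) = Suc (Suc i)"
    unfolding deg by simp
  have "coeff (cheb (Suc (Suc i))) (Suc (Suc i)) = coeff ([:2, 1:] * cheb (Suc i)) (Suc (Suc i)) - coeff (cheb i) (Suc (Suc i))"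
    by (simp only: cheb.simps coeff_diff)
  also have "\<dots> = 1" using lead unfolding deg by (simp add: coeff_eq_0 d)
  finally show ?case using deg' by simp
qed auto

lemma cheb_eval:
  assumes "w \<noteq> 0"
  shows "(w - 1 / w) * poly (cheb i) (w + 1 / w - 2) = w ^ (i + 1) - (1 / w) ^ (i + 1)"
proof (induction i rule: cheb.induct)
  case 2
  show ?case using assms by (simp add: field_simps power2_eq_square)
next
  case (3 i)
  define t where "t = w + 1 / w - 2"
  have t2: "2 + t = w + 1 / w" by (simp add: t_def)
  have "poly (cheb (Suc (Suc i))) t = (2 + t) * poly (cheb (Suc i)) t - poly (cheb i) t"
    by (simp add: algebra_simps)
  then have "(w - 1 / w) * poly (cheb (Suc (Suc i))) t =
     (w + 1 / w) * ((w - 1 / w) * poly (cheb (Suc i)) t) - (w - 1 / w) * poly (cheb i) t"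
    by (simp only: t2 right_diff_distrib mult.left_commute)
  also have "\<dots> = (w + 1 / w) * (w ^ (Suc i + 1) - (1 / w) ^ (Suc i + 1)) - (w ^ (i + 1) - (1 / w) ^ (i + 1))"
    using 3 unfolding t_def by (simp only:)
  also have "\<dots> = w ^ (i + 3) - (1 / w) ^ (i + 3)"
    using assms by (simp add: field_simps power_add power3_eq_cube power2_eq_square)
  finally show ?case by (simp add: t_def numeral_3_eq_3)
qed simp

text \<open>Arises as the limit of the rescaled node determinant at r = 1. \<open>M\<close> is real
  so that the value can be treated as a polynomial in \<open>M\<close>.\<close>

definition moment_det :: "nat \<Rightarrow> real \<Rightarrow> real" where
  "moment_det n M = det (mat n n (\<lambda>(i, l). \<Sum>c\<le>3*n. coeff (fpoly ^ l) c * (2 * real c - M) ^ (2 * i + 1)))"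

lemma tendsto_det:
  fixes f :: "'b \<Rightarrow> nat \<Rightarrow> nat \<Rightarrow> real"
  assumes "\<And>i l. i < n \<Longrightarrow> l < n \<Longrightarrow> ((\<lambda>r. f r i l) \<longlongrightarrow> g i l) F"
  shows "((\<lambda>r. det (mat n n (\<lambda>(i, l). f r i l))) \<longlongrightarrow> det (mat n n (\<lambda>(i, l). g i l))) F"
  unfolding det_mat_leibniz
proof (intro tendsto_sum tendsto_mult tendsto_const tendsto_prod)
  fix p i assume "p \<in> {p. p permutes {0..<n}}" "i \<in> {..<n}"
  then have "i < n" "p i < n" using permutes_in_image[of p "{0..<n}" i] by auto
  then show "((\<lambda>r. f r i (p i)) \<longlongrightarrow> g i (p i)) F" by (rule assms)
qed

lemma power_int_difference_quotient:
  "((\<lambda>r::real. (r powi p - 1) / (r - 1)) \<longlongrightarrow> of_int p) (at_right 1)"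
proof -
  have "((\<lambda>r::real. r powi p) has_real_derivative of_int p * 1 powi (p - 1) * 1) (at 1)"
    by (rule DERIV_power_int) (auto intro!: derivative_eq_intros)
  then have "((\<lambda>r::real. (r powi p - 1 powi p) / (r - 1)) \<longlongrightarrow> of_int p) (at 1)"
    unfolding has_field_derivative_iff by simp
  then show ?thesis by (simp add: filterlim_at_split)
qed

lemma tendsto_power_int_at_1: "((\<lambda>r::real. r powi p) \<longlongrightarrow> 1) (at_right 1)"
proof -
  have "((\<lambda>r::real. r powi p) \<longlongrightarrow> 1 powi p) (at_right 1)"
    by (intro tendsto_intros) auto
  then show ?thesis by simp
qed

text \<open>Row by row, x^c - x^(M-c) is a power of r times (w - 1/w) times a Chebyshev polynomial
  in w + 1/w - 2. These polynomials are monic, so they may be replaced by plain powers.\<close>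

lemma det_node_difference:
  fixes r :: real and M :: nat
  assumes r: "r > 1"
  defines "w \<equiv> \<lambda>c. r powi (2 * int c - int M)"
  shows "det (mat n n (\<lambda>(i, l). poly fpoly (r ^ (2 * (i + 1))) ^ l -
      (r ^ (2 * (i + 1))) ^ M * poly fpoly (1 / r ^ (2 * (i + 1))) ^ l)) =
    (\<Prod>i<n. r ^ (M * (i + 1))) *
    det (mat n n (\<lambda>(i, l). \<Sum>c\<le>3*n. coeff (fpoly ^ l) c * ((w c - 1 / w c) * (w c + 1 / w c - 2) ^ i)))"
proof -
  have w0: "w c \<noteq> 0" for c using r by (simp add: w_def)
  let ?Th = "\<lambda>l p. \<Sum>c\<le>3*n. coeff (fpoly ^ l) c * ((w c - 1 / w c) * poly p (w c + 1 / w c - 2))"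
  have entry: "poly fpoly (r ^ (2 * (i + 1))) ^ l -
      (r ^ (2 * (i + 1))) ^ M * poly fpoly (1 / r ^ (2 * (i + 1))) ^ l =
      r ^ (M * (i + 1)) * ?Th l (cheb i)" if "l < n" for i l
  proof -
    let ?x = "r ^ (2 * (i + 1))"
    have deg: "degree (fpoly ^ l) \<le> 3 * n" using that by simp
    have "?x ^ c - ?x ^ M * (1 / ?x) ^ c = r ^ (M * (i + 1)) * (w c ^ (i + 1) - (1 / w c) ^ (i + 1))" for c
    proof -
      have e: "r ^ k = r powi int k" for k by simp
      have 1: "?x ^ k = r powi (2 * int k * (int i + 1))" for k
      proof -
        have "?x ^ k = r ^ (2 * (i + 1) * k)" by (rule power_mult[symmetric])
        also have "\<dots> = r powi int (2 * (i + 1) * k)" by (rule e)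
        also have "int (2 * (i + 1) * k) = 2 * int k * (int i + 1)" by (simp add: algebra_simps)
        finally show ?thesis .
      qed
      have 2: "?x ^ M * (1 / ?x) ^ c = r powi (2 * int M * (int i + 1) - 2 * int c * (int i + 1))"
      proof -
        have "?x ^ M * (1 / ?x) ^ c = ?x ^ M / ?x ^ c" by (simp add: power_one_over)
        also have "\<dots> = r powi (2 * int M * (int i + 1) - 2 * int c * (int i + 1))"
          unfolding 1 by (rule power_int_diff[symmetric]) (use r in simp)
        finally show ?thesis .
      qed
      have 3: "w c ^ (i + 1) = r powi ((2 * int c - int M) * (int i + 1))"
      proof -
        have "w c ^ (i + 1) = w c powi int (i + 1)" by (rule power_int_of_nat[symmetric])
        also have "\<dots> = r powi ((2 * int c - int M) * int (i + 1))"
          unfolding w_def by (rule power_int_mult[symmetric])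
        finally show ?thesis by (simp add: algebra_simps)
      qed
      have 4: "(1 / w c) ^ (i + 1) = r powi (- ((2 * int c - int M) * (int i + 1)))"
      proof -
        have "(1 / w c) ^ (i + 1) = 1 / w c ^ (i + 1)" by (rule power_one_over)
        then show ?thesis unfolding 3 by (simp only: power_int_minus inverse_eq_divide)
      qed
      have 5: "r ^ (M * (i + 1)) = r powi (int M * (int i + 1))"
        unfolding e by (simp add: algebra_simps)
      have r0: "r \<noteq> 0" using r by simp
      have 6: "r powi a * r powi b = r powi (a + b)" for a b
        by (rule power_int_add[symmetric]) (use r in simp)
      have 7: "int M * (int i + 1) + (2 * int c - int M) * (int i + 1) = 2 * int c * (int i + 1)"
        "int M * (int i + 1) + - ((2 * int c - int M) * (int i + 1)) = 2 * int M * (int i + 1) - 2 * int c * (int i + 1)"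
        by (simp_all add: algebra_simps)
      show ?thesis
        unfolding 2 unfolding 1 3 4 5 right_diff_distrib[of "r powi (int M * (int i + 1))"] 6 7 ..
    qed
    then have "(\<Sum>c\<le>3*n. coeff (fpoly ^ l) c * (?x ^ c - ?x ^ M * (1 / ?x) ^ c)) = r ^ (M * (i + 1)) * ?Th l (cheb i)"
      unfolding cheb_eval[OF w0] sum_distrib_left by (simp only: mult_ac)
    then show ?thesis
      unfolding poly_power[symmetric] poly_eq_sum_le[OF deg]
      by (simp only: right_diff_distrib sum_subtractf sum_distrib_left mult_ac)
  qed
  have "det (mat n n (\<lambda>(i, l). poly fpoly (r ^ (2 * (i + 1))) ^ l -
      (r ^ (2 * (i + 1))) ^ M * poly fpoly (1 / r ^ (2 * (i + 1))) ^ l)) =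
      det (mat n n (\<lambda>(i, l). r ^ (M * (i + 1)) * ?Th l (cheb i)))"
    by (rule det_cong_mat) (rule entry)
  also have "\<dots> = (\<Prod>i<n. r ^ (M * (i + 1))) * det (mat n n (\<lambda>(i, l). ?Th l (cheb i)))"
    by (rule det_scale_rows)
  \<comment> \<open>The basis polynomials are indexed by rows here, whereas
    \<open>det_monic_basis\<close> changes columns.\<close>
  also have "det (mat n n (\<lambda>(i, l). ?Th l (cheb i))) = det (mat n n (\<lambda>(i, l). ?Th i (cheb l)))"
    by (rule det_mat_transpose)
  also have "\<dots> = det (mat n n (\<lambda>(i, l). ?Th i (monom 1 l)))"
  proof (rule det_monic_basis[where \<kappa> = "\<lambda>c. c"])
    show "?Th i (p + q) = ?Th i p + ?Th i q" for i p q
      by (simp only: poly_add distrib_left sum.distrib)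
    show "?Th i (smult c p) = c * ?Th i p" for i c p
      by (simp only: poly_smult sum_distrib_left mult_ac)
    show "degree (cheb l) = l" "lead_coeff (cheb l) = 1" for l
      using degree_lead_cheb[of l] by blast+
  qed simp_all
  also have "\<dots> = det (mat n n (\<lambda>(i, l). ?Th l (monom 1 i)))"
    by (rule det_mat_transpose)
  finally show ?thesis by (simp only: poly_monom mult_1_left)
qed

text \<open>Row \<open>i\<close> vanishes to order 2i + 1 at r = 1: with p = 2c - M, w - 1/w behaves
  like 2p(r - 1) and w + 1/w - 2 like the square of p(r - 1). The factor 2 of each row gives
  \<open>2 ^ n\<close>.\<close>

lemma det_node_difference_limit:
  "((\<lambda>r::real. det (mat n n (\<lambda>(i, l). poly fpoly (r ^ (2 * (i + 1))) ^ l -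
      (r ^ (2 * (i + 1))) ^ M * poly fpoly (1 / r ^ (2 * (i + 1))) ^ l)) / (\<Prod>i<n. (r - 1) ^ (2 * i + 1)))
    \<longlongrightarrow> 2 ^ n * moment_det n (real M)) (at_right 1)"
proof -
  define w where "w r c = r powi (2 * int c - int M)" for r :: real and c
  let ?E = "\<lambda>r i l. \<Sum>c\<le>3*n. coeff (fpoly ^ l) c * (((w r c - 1 / w r c) * (w r c + 1 / w r c - 2) ^ i) / (r - 1) ^ (2 * i + 1))"
  have ent: "((\<lambda>r. ((w r c - 1 / w r c) * (w r c + 1 / w r c - 2) ^ i) / (r - 1) ^ (2 * i + 1)) \<longlongrightarrow>
      2 * (2 * real c - real M) ^ (2 * i + 1)) (at_right 1)" for c i
  proof -
    let ?p = "2 * int c - int M"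
    have "((\<lambda>r. (w r c - 1) / (r - 1) * ((w r c + 1) / w r c) * (((w r c - 1) / (r - 1)) ^ 2 / w r c) ^ i) \<longlongrightarrow>
       of_int ?p * ((1 + 1) / 1) * ((of_int ?p) ^ 2 / 1) ^ i) (at_right 1)"
      unfolding w_def by (intro tendsto_intros power_int_difference_quotient tendsto_power_int_at_1) auto
    moreover have "\<forall>\<^sub>F r in at_right 1. (w r c - 1) / (r - 1) * ((w r c + 1) / w r c) * (((w r c - 1) / (r - 1)) ^ 2 / w r c) ^ i =
       ((w r c - 1 / w r c) * (w r c + 1 / w r c - 2) ^ i) / (r - 1) ^ (2 * i + 1)"
    proof (rule eventually_at_right_less[THEN eventually_mono])
      fix r :: real assume r: "1 < r"
      then have w0: "w r c \<noteq> 0" by (simp add: w_def)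
      have 1: "w r c - 1 / w r c = (w r c - 1) * ((w r c + 1) / w r c)"
        using w0 by (simp add: field_simps)
      have 2: "w r c + 1 / w r c - 2 = (w r c - 1) ^ 2 / w r c"
        using w0 by (simp add: field_simps power2_eq_square)
      have 3: "(r - 1) ^ (2 * i + 1) = (r - 1) * ((r - 1) ^ 2) ^ i" by (simp add: power_mult)
      have 4: "((w r c - 1) / (r - 1)) ^ 2 = (w r c - 1) ^ 2 / (r - 1) ^ 2" by (rule power_divide)
      have key: "a / d * b * (e / f / g) ^ i = (a * b) * (e / g) ^ i / (d * f ^ i)" for a b d e f g :: real
        by (simp add: power_divide power_mult_distrib mult_ac)
      show "(w r c - 1) / (r - 1) * ((w r c + 1) / w r c) * (((w r c - 1) / (r - 1)) ^ 2 / w r c) ^ i =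
         ((w r c - 1 / w r c) * (w r c + 1 / w r c - 2) ^ i) / (r - 1) ^ (2 * i + 1)"
        unfolding 1 2 3 4 by (rule key)
    qed
    ultimately have "((\<lambda>r. ((w r c - 1 / w r c) * (w r c + 1 / w r c - 2) ^ i) / (r - 1) ^ (2 * i + 1)) \<longlongrightarrow>
      of_int ?p * ((1 + 1) / 1) * ((of_int ?p) ^ 2 / 1) ^ i) (at_right 1)"
      by (rule Lim_transform_eventually)
    moreover have "q * ((1 + 1) / 1) * (q ^ 2 / 1) ^ i = 2 * q ^ (2 * i + 1)" for q :: real
      by (simp add: power_mult)
    moreover have "of_int ?p = 2 * real c - real M" by simp
    ultimately show ?thesis by (simp only:)
  qed
  have "((\<lambda>r. det (mat n n (\<lambda>(i, l). ?E r i l))) \<longlongrightarrow>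
     det (mat n n (\<lambda>(i, l). \<Sum>c\<le>3*n. coeff (fpoly ^ l) c * (2 * (2 * real c - real M) ^ (2 * i + 1))))) (at_right 1)"
    by (intro tendsto_det tendsto_sum tendsto_mult tendsto_const ent)
  also have "det (mat n n (\<lambda>(i, l). \<Sum>c\<le>3*n. coeff (fpoly ^ l) c * (2 * (2 * real c - real M) ^ (2 * i + 1)))) =
     det (mat n n (\<lambda>(i, l). 2 * (\<Sum>c\<le>3*n. coeff (fpoly ^ l) c * (2 * real c - real M) ^ (2 * i + 1))))"
    by (rule det_cong_mat) (simp only: sum_distrib_left mult_ac)
  also have "\<dots> = 2 ^ n * moment_det n (real M)"
    unfolding det_scale_rows moment_det_def by simp
  finally have "((\<lambda>r. det (mat n n (\<lambda>(i, l). ?E r i l))) \<longlongrightarrow> 2 ^ n * moment_det n (real M)) (at_right 1)" .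
  moreover have "((\<lambda>r::real. \<Prod>i<n. r ^ (M * (i + 1))) \<longlongrightarrow> (\<Prod>i<n. 1 ^ (M * (i + 1)))) (at_right 1)"
    by (intro tendsto_intros)
  ultimately have lim: "((\<lambda>r. (\<Prod>i<n. r ^ (M * (i + 1))) * det (mat n n (\<lambda>(i, l). ?E r i l))) \<longlongrightarrow>
      (\<Prod>i<n. 1 ^ (M * (i + 1))) * (2 ^ n * moment_det n (real M))) (at_right 1)"
    by (intro tendsto_mult)
  have ev: "\<forall>\<^sub>F r in at_right 1. (\<Prod>i<n. r ^ (M * (i + 1))) * det (mat n n (\<lambda>(i, l). ?E r i l)) =
     det (mat n n (\<lambda>(i, l). poly fpoly (r ^ (2 * (i + 1))) ^ l -
      (r ^ (2 * (i + 1))) ^ M * poly fpoly (1 / r ^ (2 * (i + 1))) ^ l)) / (\<Prod>i<n. (r - 1) ^ (2 * i + 1))"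
  proof (rule eventually_at_right_less[THEN eventually_mono])
    fix r :: real assume r: "1 < r"
    let ?B = "\<lambda>i l. \<Sum>c\<le>3*n. coeff (fpoly ^ l) c * ((w r c - 1 / w r c) * (w r c + 1 / w r c - 2) ^ i)"
    have "det (mat n n (\<lambda>(i, l). ?E r i l)) = det (mat n n (\<lambda>(i, l). (1 / (r - 1) ^ (2 * i + 1)) * ?B i l))"
      by (rule det_cong_mat) (simp add: sum_divide_distrib)
    also have "\<dots> = (\<Prod>i<n. 1 / (r - 1) ^ (2 * i + 1)) * det (mat n n (\<lambda>(i, l). ?B i l))"
      by (rule det_scale_rows)
    finally show "(\<Prod>i<n. r ^ (M * (i + 1))) * det (mat n n (\<lambda>(i, l). ?E r i l)) =
     det (mat n n (\<lambda>(i, l). poly fpoly (r ^ (2 * (i + 1))) ^ l -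
      (r ^ (2 * (i + 1))) ^ M * poly fpoly (1 / r ^ (2 * (i + 1))) ^ l)) / (\<Prod>i<n. (r - 1) ^ (2 * i + 1))"
      unfolding det_node_difference[OF r] w_def[symmetric] by (simp add: prod_dividef)
  qed
  show ?thesis using Lim_transform_eventually[OF lim ev] by simp
qed

section \<open>The moment determinant\<close>

text \<open>The coefficients at c and v - c agree, while odd powers of 2c - v are opposite
  there.\<close>

lemma palindromic_odd_moment_zero:
  fixes G :: "real poly"
  assumes deg: "degree G \<le> v" "v \<le> B" and pal: "\<And>x. x > 0 \<Longrightarrow> x ^ v * poly G (1 / x) = poly G x"
  shows "(\<Sum>c\<le>B. coeff G c * (2 * real c - real v) ^ (2 * k + 1)) = 0"
proof -
  define G' where "G' = (\<Sum>c\<le>v. monom (coeff G (v - c)) c)"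
  have co: "coeff G' c = (if c \<le> v then coeff G (v - c) else 0)" for c
    by (auto simp: G'_def coeff_sum)
  have "poly G' x = poly G x" if "x > 0" for x
  proof -
    have "poly G' x = (\<Sum>c\<le>v. coeff G (v - c) * x ^ c)"
      by (simp add: G'_def poly_sum poly_monom)
    also have "\<dots> = (\<Sum>c\<le>v. coeff G c * x ^ (v - c))"
      by (rule sum.reindex_bij_witness[of _ "\<lambda>c. v - c" "\<lambda>c. v - c"]) auto
    also have "\<dots> = (\<Sum>c\<le>v. x ^ v * (coeff G c * (1 / x) ^ c))"
      using that by (intro sum.cong refl) (simp add: power_diff power_one_over)
    also have "\<dots> = x ^ v * poly G (1 / x)"
      unfolding poly_eq_sum_le[OF deg(1)] sum_distrib_left ..
    finally show ?thesis using pal[OF that] by simp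
  qed
  then have "poly (G' - G) x = 0" if "x \<in> {0<..}" for x using that by simp
  then have "{0<..} \<subseteq> {x. poly (G' - G) x = 0}" by auto
  then have "infinite {x. poly (G' - G) x = 0}"
    using infinite_Ioi[of "0::real"] finite_subset by blast
  then have "G' - G = 0" using poly_roots_finite by blast
  then have sym: "coeff G (v - c) = coeff G c" if "c \<le> v" for c
    using co[of c] that by simp
  have "(\<Sum>c\<le>B. coeff G c * (2 * real c - real v) ^ (2 * k + 1)) = (\<Sum>c\<le>v. coeff G c * (2 * real c - real v) ^ (2 * k + 1))"
    by (rule sum.mono_neutral_right) (use deg in \<open>auto simp: coeff_eq_0\<close>)
  also have "\<dots> = (\<Sum>c\<le>v. coeff G (v - c) * (2 * real (v - c) - real v) ^ (2 * k + 1))"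
    by (rule sum.reindex_bij_witness[of _ "\<lambda>c. v - c" "\<lambda>c. v - c"]) auto
  also have "\<dots> = (\<Sum>c\<le>v. - (coeff G c * (2 * real c - real v) ^ (2 * k + 1)))"
  proof (rule sum.cong[OF refl])
    fix c assume c: "c \<in> {..v}"
    then have "2 * real (v - c) - real v = - (2 * real c - real v)" by simp
    moreover have "(- (2 * real c - real v)) ^ (2 * k + 1) = - ((2 * real c - real v) ^ (2 * k + 1))"
      by (rule power_minus_odd) simp
    ultimately show "coeff G (v - c) * (2 * real (v - c) - real v) ^ (2 * k + 1) = - (coeff G c * (2 * real c - real v) ^ (2 * k + 1))"
      using sym c by simp
  qed
  finally have "(\<Sum>c\<le>B. coeff G c * (2 * real c - real v) ^ (2 * k + 1)) =
      - (\<Sum>c\<le>v. coeff G c * (2 * real c - real v) ^ (2 * k + 1))" by (simp only: sum_negf)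
  moreover have "(\<Sum>c\<le>B. coeff G c * (2 * real c - real v) ^ (2 * k + 1)) = (\<Sum>c\<le>v. coeff G c * (2 * real c - real v) ^ (2 * k + 1))"
    by (rule sum.mono_neutral_right) (use deg in \<open>auto simp: coeff_eq_0\<close>)
  ultimately show ?thesis by linarith
qed

text \<open>As a polynomial in \<open>M\<close>; the range of \<open>c\<close> is long enough for every centre of symmetry \<open>v / 2\<close>, \<open>v \<le> 3l\<close>.\<close>

definition moment :: "nat \<Rightarrow> nat \<Rightarrow> real poly \<Rightarrow> real poly" where
  "moment n i p = (\<Sum>c\<le>3*n. smult (coeff (pcompose p fpoly) c) ([:2 * real c, -1:] ^ (2 * i + 1)))"

lemma moment_add: "moment n i (p + q) = moment n i p + moment n i q"
  by (simp only: moment_def pcompose_add coeff_add smult_add_left sum.distrib)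

lemma poly_moment: "poly (moment n i p) M = (\<Sum>c\<le>3*n. coeff (pcompose p fpoly) c * (2 * real c - M) ^ (2 * i + 1))"
proof -
  have "poly [:2 * real c, -1:] M = 2 * real c - M" for c by simp
  then show ?thesis unfolding moment_def poly_sum poly_smult poly_power by (simp only:)
qed

lemma moment_smult: "moment n i (smult c p) = [:c:] * moment n i p"
proof (rule poly_ext)
  show "poly (moment n i (smult c p)) M = poly ([:c:] * moment n i p) M" for M
    unfolding poly_mult poly_moment pcompose_smult coeff_smult sum_distrib_left
    by (simp add: mult.assoc)
qed

lemma pcompose_monom_fpoly: "pcompose (monom 1 l) q = q ^ l" for q :: "real poly"
  by (rule poly_ext) (simp add: poly_pcompose poly_monom)

definition moment_det_poly :: "nat \<Rightarrow> real poly" where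
  "moment_det_poly n = det (mat n n (\<lambda>(i, l). moment n i (monom 1 l)))"

lemma poly_det:
  "poly (det (mat n n (\<lambda>(i, l). f i l))) M = det (mat n n (\<lambda>(i, l). poly (f i l) M))"
  for M :: "'a :: comm_ring_1"
proof -
  have "poly (signof p) M = signof p" for p by (cases "sign p = 1") (auto simp: sign_def)
  then show ?thesis
    unfolding det_mat_leibniz by (simp add: poly_sum poly_prod)
qed

lemma poly_moment_det_poly: "poly (moment_det_poly n) M = moment_det n M"
  unfolding moment_det_poly_def poly_det poly_moment pcompose_monom_fpoly moment_det_def ..

lemma moment_det_poly_basis:
  assumes "\<And>l. l < n \<Longrightarrow> degree (p l) = l" "\<And>l. l < n \<Longrightarrow> lead_coeff (p l) = 1"
  shows "moment_det_poly n = det (mat n n (\<lambda>(i, l). moment n i (p l)))"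
  unfolding moment_det_poly_def
proof (rule det_monic_basis[where \<kappa> = "\<lambda>c. [:c:]", symmetric])
  show "moment n i (smult c p) = [:c:] * moment n i p" for i c p by (rule moment_smult)
  show "lead_coeff (p l) = 1" if "l < n" for l using assms(2)[OF that] .
qed (simp_all add: moment_add assms(1) one_pCons)

section \<open>The linear factors in M\<close>

lemma fpoly_eval: "poly fpoly x = x + x ^ 2"
  by (simp add: fpoly_def power2_eq_square algebra_simps)

text \<open>One change of basis makes all columns in the index set divisible by M - v at the same
  time, so their number bounds the multiplicity from below.\<close>

lemma root_power_dvd_moment_det_poly:
  "[:- real v, 1:] ^ card {l. l < n \<and> 2 * l \<le> v \<and> v \<le> 3 * l} dvd moment_det_poly n"
proof -
  let ?L = "{l. l < n \<and> 2 * l \<le> v \<and> v \<le> 3 * l}"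
  define p :: "nat \<Rightarrow> real poly" where
    "p l = (if l \<in> ?L then monom 1 (v - 2 * l) * [:1, 1:] ^ (l - (v - 2 * l)) else monom 1 l)" for l
  define d where "d l = (if l \<in> ?L then [:- real v, 1:] else 1)" for l
  have deg: "degree (p l) = l" for l
    by (auto simp: p_def degree_mult_eq degree_monom_eq degree_power_eq)
  have "lead_coeff (p l) = 1" for l
  proof -
    have "lead_coeff (monom 1 (v - 2 * l) * [:1, 1:] ^ (l - (v - 2 * l)) :: real poly) = 1"
      unfolding lead_coeff_mult lead_coeff_power by (simp add: degree_monom_eq)
    moreover have "lead_coeff (monom 1 l :: real poly) = 1" by (simp add: degree_monom_eq)
    ultimately show ?thesis unfolding p_def by presburger
  qed
  then have "moment_det_poly n = det (mat n n (\<lambda>(i, l). moment n i (p l)))"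
    using deg by (intro moment_det_poly_basis)
  also have "\<dots> = det (mat n n (\<lambda>(i, l). d l * (moment n i (p l) div d l)))"
  proof (rule det_cong_mat)
    fix i l assume l: "l < n"
    have "d l dvd moment n i (p l)"
    proof (cases "l \<in> ?L")
      case True
      define a where "a = v - 2 * l"
      have a: "a \<le> l" "v = 2 * l + a" "v \<le> 3 * n" using True by (auto simp: a_def)
      let ?G = "pcompose (p l) fpoly"
      have pe: "poly ?G x = (x + x ^ 2) ^ a * (1 + (x + x ^ 2)) ^ (l - a)" for x
        using True by (simp add: p_def a_def poly_pcompose poly_monom fpoly_eval add.assoc)
      have pal: "x ^ v * poly ?G (1 / x) = poly ?G x" if x: "x > 0" for x
      proof -
        have 1: "x ^ 3 * (1 / x + (1 / x) ^ 2) = x + x ^ 2"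
          using x by (simp add: field_simps power2_eq_square power3_eq_cube)
        have 2: "x ^ 2 * (1 + (1 / x + (1 / x) ^ 2)) = 1 + (x + x ^ 2)"
          using x by (simp add: field_simps power2_eq_square)
        \<comment> \<open>Each factor f absorbs \<open>x ^ 3\<close> and each factor 1 + f absorbs
          \<open>x ^ 2\<close>; the choice \<open>a = v - 2 * l\<close> makes the total exactly
          \<open>v\<close>.\<close>
        have "v = 3 * a + 2 * (l - a)" using a by simp
        then have "x ^ v = (x ^ 3) ^ a * (x ^ 2) ^ (l - a)" by (simp only: power_add power_mult)
        then have "x ^ v * poly ?G (1 / x) = (x ^ 3 * (1 / x + (1 / x) ^ 2)) ^ a * (x ^ 2 * (1 + (1 / x + (1 / x) ^ 2))) ^ (l - a)"
          unfolding pe power_mult_distrib by (simp only: mult_ac)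
        then show ?thesis unfolding 1 2 pe .
      qed
      have "degree ?G \<le> v"
        using a by (simp add: degree_pcompose deg fpoly_def)
      from palindromic_odd_moment_zero[OF this a(3) pal]
      have "poly (moment n i (p l)) (real v) = 0" by (simp only: poly_moment)
      then show ?thesis using True by (simp add: d_def poly_eq_0_iff_dvd)
    next
      case False
      then have "d l = 1" unfolding d_def by (rule if_not_P)
      then show ?thesis by simp
    qed
    then show "moment n i (p l) = d l * (moment n i (p l) div d l)" by simp
  qed
  also have "\<dots> = (\<Prod>l<n. d l) * det (mat n n (\<lambda>(i, l). moment n i (p l) div d l))"
    by (rule det_scale_cols)
  also have "(\<Prod>l<n. d l) = [:- real v, 1:] ^ card ?L"
  proof -
    have "(\<Prod>l<n. d l) = (\<Prod>l\<in>{l \<in> {..<n}. l \<in> ?L}. [:- real v, 1:])"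
      unfolding d_def by (rule prod.inter_filter[symmetric]) simp
    also have "{l \<in> {..<n}. l \<in> ?L} = ?L" by auto
    finally show ?thesis by simp
  qed
  finally show ?thesis by simp
qed

lemma linear_power_dvd_cancel:
  fixes p q :: "'a :: idom poly"
  assumes "[:- a, 1:] ^ m dvd p * q" "poly p a \<noteq> 0"
  shows "[:- a, 1:] ^ m dvd q"
proof (cases "q = 0")
  case False
  then have "p * q \<noteq> 0" using assms(2) by auto
  then show ?thesis
    using assms False by (auto simp: order_divides order_mult order_0I)
qed simp

lemma prod_linear_powers_dvd:
  fixes p :: "real poly"
  assumes "finite V" "\<And>v. v \<in> V \<Longrightarrow> [:- real v, 1:] ^ m v dvd p"
  shows "(\<Prod>v\<in>V. [:- real v, 1:] ^ m v) dvd p"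
  using assms
proof (induction V)
  case (insert w V)
  then obtain q where q: "p = (\<Prod>v\<in>V. [:- real v, 1:] ^ m v) * q" by (auto elim: dvdE)
  have "poly (\<Prod>v\<in>V. [:- real v, 1:] ^ m v) (real w) \<noteq> 0"
    using insert.hyps by (auto simp: poly_prod)
  then have "[:- real w, 1:] ^ m w dvd q"
    using linear_power_dvd_cancel insert.prems[of w] unfolding q by blast
  then show ?case using insert.hyps unfolding q by (simp add: mult.commute mult_dvd_mono)
qed simp

text \<open>Its degree, the sum of l + 1 over l < n, equals the growth order of the determinant in
  M, which leaves a constant cofactor.\<close>

definition root_poly :: "nat \<Rightarrow> real poly" where
  "root_poly n = (\<Prod>l<n. \<Prod>v\<in>{2*l..3*l}. [:- real v, 1:])"

text \<open>Regrouping the factors by the root v instead of the column l turns the multiplicity of v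
  into the column count of \<open>root_power_dvd_moment_det_poly\<close>.\<close>

lemma root_poly_dvd: "root_poly n dvd moment_det_poly n"
proof -
  have "root_poly n = (\<Prod>l<n. \<Prod>v | v \<in> {..3*n} \<and> 2 * l \<le> v \<and> v \<le> 3 * l. [:- real v, 1:])"
    unfolding root_poly_def by (intro prod.cong refl) auto
  also have "\<dots> = (\<Prod>v\<le>3*n. \<Prod>l | l \<in> {..<n} \<and> 2 * l \<le> v \<and> v \<le> 3 * l. [:- real v, 1:])"
    by (rule prod.swap_restrict) auto
  also have "\<dots> = (\<Prod>v\<le>3*n. [:- real v, 1:] ^ card {l. l < n \<and> 2 * l \<le> v \<and> v \<le> 3 * l})"
    by simp
  also have "\<dots> dvd moment_det_poly n"
    by (rule prod_linear_powers_dvd) (simp_all add: root_power_dvd_moment_det_poly)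
  finally show ?thesis .
qed

section \<open>Behaviour as M tends to infinity\<close>

definition theta :: "real poly \<Rightarrow> real poly" where "theta p = pCons 0 (pderiv p)"

lemma coeff_theta: "coeff (theta p) c = real c * coeff p c"
  by (cases c) (simp_all add: theta_def coeff_pderiv)

lemma poly_theta: "poly (theta p) x = x * poly (pderiv p) x"
  by (simp add: theta_def)

lemma coeff_theta_power: "coeff ((theta ^^ k) p) c = real c ^ k * coeff p c"
  by (induction k) (simp_all add: coeff_theta)

text \<open>\<open>theta\<close> is x d/dx, which multiplies the coefficient of x^c by c; evaluation
  at 1 sums the coefficients.\<close>

lemma coefficient_moment:
  assumes "degree p \<le> B"
  shows "(\<Sum>c\<le>B. coeff p c * real c ^ k) = poly ((theta ^^ k) p) 1"
proof -
  have "degree ((theta ^^ k) p) \<le> B"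
    by (rule degree_le) (use assms in \<open>auto simp: coeff_theta_power coeff_eq_0\<close>)
  from poly_eq_sum_le[OF this, of 1] show ?thesis
    by (simp add: coeff_theta_power mult.commute)
qed

text \<open>Each application lowers the order of the zero at 1 by one and multiplies the leading
  value there by the previous order.\<close>

lemma theta_power_root:
  "\<exists>g'. (theta ^^ k) ([:-1, 1:] ^ (k + m) * g) = [:-1, 1:] ^ m * g' \<and>
     poly g' 1 = (\<Prod>j<k. real (m + Suc j)) * poly g 1"
proof (induction k arbitrary: m)
  case 0
  show ?case by (intro exI[of _ g]) simp
next
  case (Suc k)
  obtain g' where g': "(theta ^^ k) ([:-1, 1:] ^ (k + Suc m) * g) = [:-1, 1:] ^ Suc m * g'"
    "poly g' 1 = (\<Prod>j<k. real (Suc m + Suc j)) * poly g 1"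
    using Suc.IH[of "Suc m"] by blast
  define g'' where "g'' = [:0, 1:] * (smult (real (Suc m)) g' + [:-1, 1:] * pderiv g')"
  have "theta ([:-1, 1:] ^ Suc m * g') = [:-1, 1:] ^ m * g''"
  proof (rule poly_ext)
    fix x
    have pd: "poly (pderiv ([:-1, 1:] ^ Suc m * g')) x = (x - 1) ^ Suc m * poly (pderiv g') x + poly g' x * (real (Suc m) * (x - 1) ^ m)"
      unfolding pderiv_mult pderiv_power_Suc by (simp add: pderiv_pCons algebra_simps)
    show "poly (theta ([:-1, 1:] ^ Suc m * g')) x = poly ([:-1, 1:] ^ m * g'') x"
      unfolding poly_theta pd g''_def poly_mult poly_power by (simp add: algebra_simps)
  qed
  moreover have "poly g'' 1 = (\<Prod>j<Suc k. real (m + Suc j)) * poly g 1"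
    unfolding g''_def prod.lessThan_Suc_shift using g'(2) by simp
  ultimately show ?case
    using g'(1) by (intro exI[of _ g'']) simp
qed

lemma pcompose_shifted_fpoly:
  "pcompose ([:-2, 1:] ^ l) fpoly = [:-1, 1:] ^ l * [:2, 1:] ^ l"
proof (rule poly_ext)
  fix x :: real
  have "poly [:-2, 1:] (poly fpoly x) = poly [:-1, 1:] x * poly [:2, 1:] x"
    by (simp add: fpoly_eval algebra_simps power2_eq_square)
  then show "poly (pcompose ([:-2, 1:] ^ l) fpoly) x = poly ([:-1, 1:] ^ l * [:2, 1:] ^ l) x"
    unfolding poly_pcompose poly_power poly_mult by (simp only: power_mult_distrib)
qed

definition shifted_moment :: "nat \<Rightarrow> nat \<Rightarrow> nat \<Rightarrow> real" where
  "shifted_moment n l k = (\<Sum>c\<le>3*n. coeff (pcompose ([:-2, 1:] ^ l) fpoly) c * real c ^ k)"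

text \<open>As f - 2 = (x - 1)(x + 2), its l-th power has a zero of order l at 1. The factor 3 is
  the value of x + 2 there.\<close>

lemma shifted_moment:
  assumes "l < n"
  shows "k < l \<Longrightarrow> shifted_moment n l k = 0" "shifted_moment n l l = fact l * 3 ^ l"
proof -
  have "degree (pcompose ([:-2, 1:] ^ l) fpoly) \<le> 3 * n"
    using assms by (simp add: degree_pcompose fpoly_def degree_power_eq)
  then have s: "shifted_moment n l k = poly ((theta ^^ k) ([:-1, 1:] ^ l * [:2, 1:] ^ l)) 1" for k
    unfolding shifted_moment_def pcompose_shifted_fpoly by (rule coefficient_moment)
  show "shifted_moment n l k = 0" if "k < l"
    using theta_power_root[of k "l - k" "[:2, 1:] ^ l"] that unfolding s by auto
  have "(\<Prod>j<l. real (Suc j)) = fact l" by (induction l) simp_all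
  then show "shifted_moment n l l = fact l * 3 ^ l"
    using theta_power_root[of l 0 "[:2, 1:] ^ l"] unfolding s by auto
qed

lemma shifted_moment_expand:
  "poly (moment n i ([:-2, 1:] ^ l)) M =
    (\<Sum>k\<le>2*i+1. real ((2*i+1) choose k) * 2 ^ k * (- M) ^ (2*i+1-k) * shifted_moment n l k)"
proof -
  have "(2 * real c - M) ^ (2*i+1) = (\<Sum>k\<le>2*i+1. real ((2*i+1) choose k) * 2 ^ k * (- M) ^ (2*i+1-k) * real c ^ k)" for c
    using binomial_ring[of "2 * real c" "- M" "2*i+1"] by (simp add: power_mult_distrib mult_ac)
  then have "poly (moment n i ([:-2, 1:] ^ l)) M =
     (\<Sum>c\<le>3*n. \<Sum>k\<le>2*i+1. coeff (pcompose ([:-2, 1:] ^ l) fpoly) c * (real ((2*i+1) choose k) * 2 ^ k * (- M) ^ (2*i+1-k) * real c ^ k))"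
    by (simp only: poly_moment sum_distrib_left)
  also have "\<dots> = (\<Sum>k\<le>2*i+1. \<Sum>c\<le>3*n. coeff (pcompose ([:-2, 1:] ^ l) fpoly) c * (real ((2*i+1) choose k) * 2 ^ k * (- M) ^ (2*i+1-k) * real c ^ k))"
    by (rule sum.swap)
  finally show ?thesis
    unfolding shifted_moment_def sum_distrib_left by (simp only: mult_ac)
qed

lemma choose_fact_falling: "real (N choose l) * fact l = (\<Prod>k<l. real N - real k)"
  unfolding binomial_gbinomial[where 'a = real]
  using gbinomial_mult_fact'[of "real N" l] by (simp add: lessThan_atLeast0)

text \<open>In the binomial expansion the orders k < l vanish and k > l are suppressed by M^(l-k),
  so k = l decides. The base -6 collects 2 from 2c, 3 from x + 2 and the sign of -M; the overall
  sign is that of an odd power.\<close>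

lemma shifted_moment_limit:
  assumes l: "l < n"
  shows "((\<lambda>M. 1 / M ^ (2*i+1) * (M ^ l * poly (moment n i ([:-2, 1:] ^ l)) M)) \<longlongrightarrow>
     - ((-6) ^ l) * (\<Prod>k<l. real (2*i+1) - real k)) at_top"
proof -
  let ?b = "\<lambda>k. real ((2*i+1) choose k) * 2 ^ k * (-1) ^ (2*i+1-k) * shifted_moment n l k"
  have tlim: "((\<lambda>M::real. ?b k * (M ^ l / M ^ k)) \<longlongrightarrow> (if k = l then ?b l else 0)) at_top" for k
  proof -
    consider "k < l" | "k = l" | "l < k" by linarith
    then show ?thesis
    proof cases
      case 1
      then show ?thesis by (simp add: shifted_moment(1)[OF l])
    next
      case 2
      have "\<forall>\<^sub>F M::real in at_top. ?b l = ?b k * (M ^ l / M ^ k)"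
        using eventually_gt_at_top[of "0::real"] by eventually_elim (simp add: 2)
      with tendsto_const have "((\<lambda>M::real. ?b k * (M ^ l / M ^ k)) \<longlongrightarrow> ?b l) at_top"
        by (rule Lim_transform_eventually)
      then show ?thesis using 2 by simp
    next
      case 3
      have "((\<lambda>M::real. ?b k * inverse (M ^ (k - l))) \<longlongrightarrow> ?b k * 0) at_top"
        using 3 by (intro tendsto_mult tendsto_const tendsto_inverse_0_at_top filterlim_pow_at_top filterlim_ident) auto
      moreover have "\<forall>\<^sub>F M::real in at_top. ?b k * inverse (M ^ (k - l)) = ?b k * (M ^ l / M ^ k)"
        using eventually_gt_at_top[of "0::real"]
      proof eventually_elim
        case (elim M)
        then have "M ^ k = M ^ l * M ^ (k - l)" using 3 by (simp flip: power_add)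
        then show ?case using elim by (simp add: field_simps)
      qed
      ultimately have "((\<lambda>M::real. ?b k * (M ^ l / M ^ k)) \<longlongrightarrow> ?b k * 0) at_top"
        by (rule Lim_transform_eventually)
      then show ?thesis using 3 by simp
    qed
  qed
  have "((\<lambda>M::real. \<Sum>k\<le>2*i+1. ?b k * (M ^ l / M ^ k)) \<longlongrightarrow> (\<Sum>k\<le>2*i+1. if k = l then ?b l else 0)) at_top"
    by (intro tendsto_sum tlim)
  moreover have "\<forall>\<^sub>F M::real in at_top. (\<Sum>k\<le>2*i+1. ?b k * (M ^ l / M ^ k)) =
     1 / M ^ (2*i+1) * (M ^ l * poly (moment n i ([:-2, 1:] ^ l)) M)"
    using eventually_gt_at_top[of "0::real"]
  proof eventually_elim
    case (elim M)
    show ?case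
      unfolding shifted_moment_expand sum_distrib_left
    proof (rule sum.cong[OF refl])
      fix k assume k: "k \<in> {..2*i+1}"
      define N where "N = 2*i+1"
      have "M ^ N = M ^ (N - k) * M ^ k" using k by (simp add: N_def flip: power_add)
      moreover have "(- M) ^ (N - k) = (-1) ^ (N - k) * M ^ (N - k)" by (rule power_minus)
      ultimately show "?b k * (M ^ l / M ^ k) = 1 / M ^ (2*i+1) * (M ^ l * (real ((2*i+1) choose k) * 2 ^ k * (- M) ^ (2*i+1-k) * shifted_moment n l k))"
        unfolding N_def[symmetric] using elim by simp
    qed
  qed
  ultimately have "((\<lambda>M. 1 / M ^ (2*i+1) * (M ^ l * poly (moment n i ([:-2, 1:] ^ l)) M)) \<longlongrightarrow>
     (\<Sum>k\<le>2*i+1. if k = l then ?b l else 0)) at_top"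
    by (rule Lim_transform_eventually)
  also have "(\<Sum>k\<le>2*i+1. if k = l then ?b l else 0) = - ((-6) ^ l) * (\<Prod>k<l. real (2*i+1) - real k)"
  proof (cases "l \<le> 2*i+1")
    case True
    have "(-1 :: real) ^ (2*i+1-l) * (-1) ^ l = (-1) ^ (2*i+1)" using True by (simp flip: power_add)
    then have "(-1 :: real) ^ (2*i+1-l) * (-1) ^ l = -1" by simp
    then have sgn: "(-1 :: real) ^ (2*i+1-l) = - ((-1) ^ l)"
      by (cases "even l") auto
    have six: "(-6 :: real) ^ l = (-1) ^ l * (2 ^ l * 3 ^ l)"
      by (simp flip: power_mult_distrib)
    have "(\<Sum>k\<le>2*i+1. if k = l then ?b l else 0) = ?b l"
      by (subst sum.delta) (use True in simp_all)
    also have "\<dots> = - ((-6) ^ l) * (real ((2*i+1) choose l) * fact l)"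
      unfolding six sgn shifted_moment(2)[OF l] by (simp only: mult_minus_left mult_minus_right mult_ac)
    finally show ?thesis unfolding choose_fact_falling .
  next
    \<comment> \<open>Both sides vanish: the falling factorial contains a zero factor.\<close>
    case False
    then show ?thesis
      unfolding choose_fact_falling[symmetric] by (simp add: binomial_eq_0)
  qed
  finally show ?thesis .
qed

definition moment_const :: "nat \<Rightarrow> real" where
  "moment_const n = (\<Prod>l<n. - ((-6) ^ l)) * (\<Prod>j<n. \<Prod>i<j. 2 * (real j - real i))"

text \<open>Up to column factors, the limiting entries are falling factorials in 2i + 1, monic of
  degree l, so the determinant is a Vandermonde product over odd numbers.\<close>

lemma moment_det_limit:
  "((\<lambda>M. (\<Prod>i<n. 1 / M ^ (2*i+1)) * ((\<Prod>l<n. M ^ l) * moment_det n M)) \<longlongrightarrow> moment_const n) at_top"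
proof -
  let ?e = "\<lambda>M i l. 1 / M ^ (2*i+1) * (M ^ l * poly (moment n i ([:-2, 1:] ^ l)) M)"
  have "((\<lambda>M. det (mat n n (\<lambda>(i, l). ?e M i l))) \<longlongrightarrow>
     det (mat n n (\<lambda>(i, l). - ((-6) ^ l) * (\<Prod>k<l. real (2*i+1) - real k)))) at_top"
    by (intro tendsto_det shifted_moment_limit)
  moreover have "det (mat n n (\<lambda>(i, l). ?e M i l)) = (\<Prod>i<n. 1 / M ^ (2*i+1)) * ((\<Prod>l<n. M ^ l) * moment_det n M)" for M
  proof -
    have "lead_coeff ([:-2, 1:] ^ l :: real poly) = 1" for l unfolding lead_coeff_power by simp
    then have "moment_det_poly n = det (mat n n (\<lambda>(i, l). moment n i ([:-2, 1:] ^ l)))"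
      by (intro moment_det_poly_basis) (simp_all add: degree_power_eq)
    then have "moment_det n M = det (mat n n (\<lambda>(i, l). poly (moment n i ([:-2, 1:] ^ l)) M))"
      unfolding poly_moment_det_poly[symmetric] by (simp only: poly_det)
    then show ?thesis
      by (simp only: det_scale_rows det_scale_cols)
  qed
  moreover have "det (mat n n (\<lambda>(i, l). - ((-6) ^ l) * (\<Prod>k<l. real (2*i+1) - real k))) = moment_const n"
  proof -
    let ?p = "\<lambda>l. \<Prod>k<l. [:- real k, 1:]"
    have "det (mat n n (\<lambda>(i, l). - ((-6) ^ l) * (\<Prod>k<l. real (2*i+1) - real k))) =
        (\<Prod>l<n. - ((-6) ^ l)) * det (mat n n (\<lambda>(i, l). \<Prod>k<l. real (2*i+1) - real k))"
      by (rule det_scale_cols)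
    also have "det (mat n n (\<lambda>(i, l). \<Prod>k<l. real (2*i+1) - real k)) = det (mat n n (\<lambda>(i, l). poly (?p l) (real (2*i+1))))"
      by (rule det_cong_mat) (simp add: poly_prod)
    also have "\<dots> = det (mat n n (\<lambda>(i, l). poly (monom 1 l) (real (2*i+1))))"
    proof (rule det_monic_basis[where \<kappa> = "\<lambda>c. c"])
      show "degree (?p l) = l" for l using degree_prod_linear(1)[of "{..<l}" real] by simp
      show "lead_coeff (?p l) = 1" for l by (rule degree_prod_linear(2))
    qed simp_all
    also have "\<dots> = (\<Prod>j<n. \<Prod>i<j. real (2*j+1) - real (2*i+1))"
      unfolding poly_monom mult_1_left by (rule det_vandermonde)
    also have "\<dots> = (\<Prod>j<n. \<Prod>i<j. 2 * (real j - real i))"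
      by (intro prod.cong refl) simp
    finally show ?thesis unfolding moment_const_def .
  qed
  ultimately show ?thesis by (simp only:)
qed

text \<open>Otherwise, after subtracting \<open>C\<close> and normalizing the sign, the polynomial
  is eventually at least its positive leading coefficient although it tends to 0.\<close>

lemma poly_const_if_limit:
  fixes p :: "real poly"
  assumes "(poly p \<longlongrightarrow> C) at_top"
  shows "p = [:C:]"
proof (rule ccontr)
  assume ne: "p \<noteq> [:C:]"
  define a where "a = lead_coeff (p - [:C:])"
  define q where "q = smult (sgn a) (p - [:C:])"
  have "a \<noteq> 0" using ne unfolding a_def leading_coeff_0_iff by simp
  then have "sgn a * a > 0" by (simp add: sgn_if)
  then have lc: "lead_coeff q > 0" unfolding q_def lead_coeff_smult a_def .
  then obtain n where n: "\<And>x. x \<ge> n \<Longrightarrow> poly q x \<ge> lead_coeff q"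
    using poly_pinfty_gt_lc[of q] by auto
  have "((\<lambda>x. poly q x) \<longlongrightarrow> sgn a * (C - C)) at_top"
    unfolding q_def poly_smult poly_diff by (intro tendsto_intros assms) simp
  then have "((\<lambda>x. poly q x) \<longlongrightarrow> 0) at_top" by simp
  moreover have "\<forall>\<^sub>F x in at_top. lead_coeff q \<le> poly q x"
    using eventually_ge_at_top[of n] by eventually_elim (rule n)
  ultimately have "lead_coeff q \<le> 0"
    by (intro tendsto_lowerbound[of "poly q" 0 at_top]) simp_all
  then show False using lc by simp
qed

lemma moment_det_eq:
  "moment_det n M = moment_const n * (\<Prod>l<n. \<Prod>v\<in>{2*l..3*l}. M - real v)"
proof -
  obtain R where R: "moment_det_poly n = root_poly n * R" using root_poly_dvd[of n] unfolding dvd_def by blast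
  have md: "moment_det n M = (\<Prod>l<n. \<Prod>v\<in>{2*l..3*l}. M - real v) * poly R M" for M
    unfolding poly_moment_det_poly[symmetric] R by (simp add: root_poly_def poly_prod)
  have fac: "((\<lambda>M::real. \<Prod>l<n. \<Prod>v\<in>{2*l..3*l}. (M - real v) / M) \<longlongrightarrow> (\<Prod>l<n. \<Prod>v\<in>{2*l..3*l}. 1)) at_top"
  proof (intro tendsto_prod)
    fix v :: nat
    have "((\<lambda>M::real. 1 - real v * inverse M) \<longlongrightarrow> 1 - real v * 0) at_top"
      by (intro tendsto_intros tendsto_inverse_0_at_top filterlim_ident)
    moreover have "\<forall>\<^sub>F M::real in at_top. 1 - real v * inverse M = (M - real v) / M"
      using eventually_gt_at_top[of "0::real"] by eventually_elim (simp add: field_simps)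
    ultimately have "((\<lambda>M::real. (M - real v) / M) \<longlongrightarrow> 1 - real v * 0) at_top"
      by (rule Lim_transform_eventually)
    then show "((\<lambda>M::real. (M - real v) / M) \<longlongrightarrow> 1) at_top" by simp
  qed
  then have fac1: "((\<lambda>M::real. \<Prod>l<n. \<Prod>v\<in>{2*l..3*l}. (M - real v) / M) \<longlongrightarrow> 1) at_top" by simp
  have "((\<lambda>M. ((\<Prod>i<n. 1 / M ^ (2*i+1)) * ((\<Prod>l<n. M ^ l) * moment_det n M)) / (\<Prod>l<n. \<Prod>v\<in>{2*l..3*l}. (M - real v) / M))
     \<longlongrightarrow> moment_const n / 1) at_top"
    by (rule tendsto_divide[OF moment_det_limit fac1]) simp
  moreover have "\<forall>\<^sub>F M::real in at_top. ((\<Prod>i<n. 1 / M ^ (2*i+1)) * ((\<Prod>l<n. M ^ l) * moment_det n M)) / (\<Prod>l<n. \<Prod>v\<in>{2*l..3*l}. (M - real v) / M) = poly R M"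
    using eventually_gt_at_top[of "real (3 * n)"]
  proof eventually_elim
    case (elim M)
    then have M: "M > 0" by (smt (verit) of_nat_0_le_iff)
    let ?V = "\<Prod>l<n. \<Prod>v\<in>{2*l..3*l}. (M - real v) / M"
    have nz: "?V \<noteq> 0"
    proof -
      have "M - real v \<noteq> 0" if "l < n" "v \<in> {2*l..3*l}" for l v using that elim by auto
      then show ?thesis using M by (simp add: prod_zero_iff)
    qed
    \<comment> \<open>The powers of \<open>M\<close> balance index by index: l + 1 linear factors
      and M^l against M^(2l+1).\<close>
    have "(\<Prod>i<n. 1 / M ^ (2*i+1)) * ((\<Prod>l<n. M ^ l) * (\<Prod>l<n. \<Prod>v\<in>{2*l..3*l}. M - real v)) =
       (\<Prod>l<n. 1 / M ^ (2*l+1) * (M ^ l * (\<Prod>v\<in>{2*l..3*l}. M - real v)))"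
      by (simp only: prod.distrib)
    also have "\<dots> = ?V"
    proof (rule prod.cong[OF refl])
      fix l
      have "card {2*l..3*l} = l + 1" by simp
      then have "(\<Prod>v\<in>{2*l..3*l}. (M - real v) / M) = (\<Prod>v\<in>{2*l..3*l}. M - real v) / M ^ (l + 1)"
        unfolding prod_dividef prod_constant by (simp only:)
      moreover have "M ^ (2*l+1) = M ^ l * M ^ (l + 1)" by (simp add: mult_2 flip: power_add)
      ultimately show "1 / M ^ (2*l+1) * (M ^ l * (\<Prod>v\<in>{2*l..3*l}. M - real v)) = (\<Prod>v\<in>{2*l..3*l}. (M - real v) / M)"
        using M by simp
    qed
    finally have "(\<Prod>i<n. 1 / M ^ (2*i+1)) * ((\<Prod>l<n. M ^ l) * moment_det n M) = ?V * poly R M"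
      unfolding md by (simp only: mult.assoc[symmetric])
    then show ?case using nz by simp
  qed
  ultimately have "(poly R \<longlongrightarrow> moment_const n / 1) at_top"
    by (rule Lim_transform_eventually)
  then have "R = [:moment_const n:]" using poly_const_if_limit by simp
  then show ?thesis unfolding md by simp
qed

section \<open>The enumeration formula\<close>

text \<open>Interlacing carries the bounds from the bottom row upwards. The half-open range of
  \<open>strict_lists\<close> turns the maximal entry \<open>m\<close> into
  \<open>Suc m\<close>.\<close>

lemma AGT_set_Un:
  "AGT_set n m = (\<Union>ks\<in>strict_lists (Suc m) n. AGT_bottom n ks)"
proof (intro equalityI subsetI)
  fix t assume t: "t \<in> AGT_set n m"
  obtain a d where ad: "t = (a, d)" by (cases t)
  have A: "is_arrowed_GT n a d" "\<And>i j. in_tri n i j \<Longrightarrow> d i j \<noteq> Both"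
    "\<And>i j. in_tri n i j \<Longrightarrow> 0 \<le> a i j \<and> a i j \<le> int m"
    "\<And>j. 1 \<le> j \<Longrightarrow> j < n \<Longrightarrow> a n j < a n (j + 1)"
    using t unfolding ad AGT_set_def by blast+
  have "row_list n a \<in> strict_lists (Suc m) n"
  proof -
    have "sorted_wrt (<) (row_list n a)"
      unfolding sorted_wrt_iff_nth_Suc_transp[OF transp_on_less] using A(4)[of "Suc _"] by simp
    moreover have "0 \<le> a n (Suc j) \<and> a n (Suc j) \<le> int m" if "j < n" for j
      using A(3)[of n "Suc j"] that by (simp add: in_tri_def)
    then have "set (row_list n a) \<subseteq> {0..<int (Suc m)}"
      by (force simp: row_list_def)
    ultimately show ?thesis by (simp add: strict_lists_def)
  qed
  moreover have "t \<in> AGT_bottom n (row_list n a)"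
    using A(1,2) by (simp add: ad AGT_bottom_def)
  ultimately show "t \<in> (\<Union>ks\<in>strict_lists (Suc m) n. AGT_bottom n ks)" by blast
next
  fix t assume "t \<in> (\<Union>ks\<in>strict_lists (Suc m) n. AGT_bottom n ks)"
  then obtain ks a d where t: "t = (a, d)" "ks \<in> strict_lists (Suc m) n" "(a, d) \<in> AGT_bottom n ks"
    by (cases t) blast
  note A = AGT_bottomD[OF t(3)]
  have ks: "length ks = n" "sorted_wrt (<) ks" "set ks \<subseteq> {0..<int (Suc m)}"
    using t(2) by (auto simp: strict_lists_def)
  have row: "row_list n a = ks" using A(3) ks by simp
  have bot: "a n (Suc j) = ks ! j" if "j < n" for j using that by (simp flip: row)
  have rng: "0 \<le> ks ! j \<and> ks ! j \<le> int m" if "j < n" for j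
  proof -
    have "ks ! j \<in> {0..<int (Suc m)}" using subsetD[OF ks(3) nth_mem] that ks(1) by simp
    then show ?thesis by simp
  qed
  have bound: "0 \<le> a i j \<and> a i j \<le> int m" if "i \<le> n" "1 \<le> j" "j \<le> i" for i j
    using that
  proof (induction i arbitrary: j rule: inc_induct)
    case base
    then show ?case using bot[of "j - 1"] rng[of "j - 1"] by simp
  next
    case (step i)
    have "a (Suc i) j \<le> a i j \<and> a i j \<le> a (Suc i) (Suc j)"
      by (rule local_okD[OF is_arrowed_GT_local[OF A(1)]]) (use step in auto)
    moreover have "0 \<le> a (Suc i) j" "a (Suc i) (Suc j) \<le> int m"
      using step.IH[of j] step.IH[of "Suc j"] step.prems by auto
    ultimately show ?case by linarith
  qed
  have "a n j < a n (j + 1)" if jn: "1 \<le> j" "j < n" for j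
  proof -
    obtain j' where j: "j = Suc j'" using jn by (cases j) auto
    have "ks ! j' < ks ! Suc j'" using sorted_wrt_nth_less[OF ks(2), of j' "Suc j'"] jn j ks(1) by simp
    then show ?thesis using bot[of j'] bot[of "Suc j'"] jn j by simp
  qed
  then show "t \<in> AGT_set n m"
    using A(1,2) bound unfolding t(1) AGT_set_def in_tri_def by auto
qed

lemma strict_lists_sorted:
  assumes "ks \<in> strict_lists (Suc m) n"
  shows "length ks = n" "sorted ks" "set ks \<subseteq> {0..int m}"
  using assms strict_sorted_imp_sorted[of ks] by (auto simp: strict_lists_def)

lemma AGT_set_weighted_sum:
  assumes "inj_on x {1..n}" "\<And>i. i \<in> {1..n} \<Longrightarrow> x i \<noteq> 0"
  shows "(\<Sum>(a, d)\<in>AGT_set n m. real_of_int (sgn_AGT n a d) * AGT_weight x n a d) =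
    (\<Prod>i=1..n. 1 + x i + 1 / x i) * G_sum (Suc m) (x ` {1..n})"
proof -
  let ?f = "\<lambda>(a, d). real_of_int (sgn_AGT n a d) * AGT_weight x n a d"
  have "sum ?f (AGT_set n m) = (\<Sum>ks\<in>strict_lists (Suc m) n. sum ?f (AGT_bottom n ks))"
    unfolding AGT_set_Un
  proof (rule sum.UNION_disjoint)
    show "\<forall>ks\<in>strict_lists (Suc m) n. finite (AGT_bottom n ks)"
      using finite_AGT_bottom[of _ n "int m"] strict_lists_sorted[of _ m n] by blast
    show "\<forall>ks\<in>strict_lists (Suc m) n. \<forall>ls\<in>strict_lists (Suc m) n. ks \<noteq> ls \<longrightarrow> AGT_bottom n ks \<inter> AGT_bottom n ls = {}"
    proof (intro ballI impI)
      fix ks ls assume kl: "ks \<in> strict_lists (Suc m) n" "ls \<in> strict_lists (Suc m) n" "ks \<noteq> ls"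
      have "False" if "(a, d) \<in> AGT_bottom n ks" "(a, d) \<in> AGT_bottom n ls" for a d
        using AGT_bottomD(3)[OF that(1) strict_lists_sorted(1)[OF kl(1)]]
          AGT_bottomD(3)[OF that(2) strict_lists_sorted(1)[OF kl(2)]] kl(3) by simp
      then show "AGT_bottom n ks \<inter> AGT_bottom n ls = {}" by auto
    qed
  qed (rule finite_strict_lists)
  also have "\<dots> = (\<Sum>ks\<in>strict_lists (Suc m) n. (\<Prod>i=1..n. 1 + x i + 1 / x i) * G ks (x ` {1..n}))"
  proof (rule sum.cong[OF refl])
    fix ks assume "ks \<in> strict_lists (Suc m) n"
    note s = strict_lists_sorted[OF this]
    show "sum ?f (AGT_bottom n ks) = (\<Prod>i=1..n. 1 + x i + 1 / x i) * G ks (x ` {1..n})"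
      by (rule AGT_bottom_sum[OF s assms])
  qed
  also have "\<dots> = (\<Prod>i=1..n. 1 + x i + 1 / x i) * G_sum (Suc m) (x ` {1..n})"
    using card_image[OF assms(1)] by (simp add: G_sum_def sum_distrib_left)
  finally show ?thesis .
qed

lemma power_difference_quotient:
  "((\<lambda>r::real. (r ^ a - r ^ b) / (r - 1)) \<longlongrightarrow> real a - real b) (at_right 1)"
proof -
  have "((\<lambda>r::real. (r powi int a - 1) / (r - 1) - (r powi int b - 1) / (r - 1)) \<longlongrightarrow> of_int (int a) - of_int (int b)) (at_right 1)"
    by (intro tendsto_diff power_int_difference_quotient)
  moreover have "(r powi int a - 1) / (r - 1) - (r powi int b - 1) / (r - 1) = (r ^ a - r ^ b) / (r - 1)" for r :: real
    by (simp flip: diff_divide_distrib)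
  ultimately show ?thesis by simp
qed

text \<open>The denominators supply one factor r - 1 per variable and two per pair. This matches the
  sum of the orders 2i + 1 to which the determinant rows vanish, so the quotient has a finite
  limit.\<close>

lemma Q_limit:
  "((\<lambda>r::real. Q N ((\<lambda>i. r ^ (2 * (i + 1))) ` {..<n})) \<longlongrightarrow>
    (\<Prod>j<n. (1 / (0 - real (2 * (j + 1)))) * (\<Prod>i<j. 1 / ((real (2 * (j + 1)) - real (2 * (i + 1))) * (0 - real (2 * (i + 1) + 2 * (j + 1)))))) *
    (2 ^ n * moment_det n (real (N + 2 * n - 2)))) (at_right 1)"
proof -
  let ?M = "N + 2 * n - 2"
  let ?D = "\<lambda>r::real. det (mat n n (\<lambda>(i, l). poly fpoly (r ^ (2 * (i + 1))) ^ l -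
      (r ^ (2 * (i + 1))) ^ ?M * poly fpoly (1 / r ^ (2 * (i + 1))) ^ l))"
  let ?K = "\<lambda>r::real. \<Prod>j<n. (1 / ((r ^ 0 - r ^ (2 * (j + 1))) / (r - 1))) *
     (\<Prod>i<j. 1 / ((r ^ (2 * (j + 1)) - r ^ (2 * (i + 1))) / (r - 1) * ((r ^ 0 - r ^ (2 * (i + 1) + 2 * (j + 1))) / (r - 1))))"
  have "(?K \<longlongrightarrow> (\<Prod>j<n. (1 / (real 0 - real (2 * (j + 1)))) * (\<Prod>i<j. 1 / ((real (2 * (j + 1)) - real (2 * (i + 1))) * (real 0 - real (2 * (i + 1) + 2 * (j + 1))))))) (at_right 1)"
    by (intro tendsto_prod tendsto_mult tendsto_divide tendsto_const power_difference_quotient) auto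
  then have "((\<lambda>r. ?K r * (?D r / (\<Prod>i<n. (r - 1) ^ (2 * i + 1)))) \<longlongrightarrow>
    (\<Prod>j<n. (1 / (real 0 - real (2 * (j + 1)))) * (\<Prod>i<j. 1 / ((real (2 * (j + 1)) - real (2 * (i + 1))) * (real 0 - real (2 * (i + 1) + 2 * (j + 1)))))) *
    (2 ^ n * moment_det n (real ?M))) (at_right 1)"
    by (intro tendsto_mult det_node_difference_limit)
  moreover have "\<forall>\<^sub>F r in at_right 1. ?K r * (?D r / (\<Prod>i<n. (r - 1) ^ (2 * i + 1))) = Q N ((\<lambda>i. r ^ (2 * (i + 1))) ` {..<n})"
  proof (rule eventually_at_right_less[THEN eventually_mono])
    fix r :: real assume r: "1 < r"
    let ?x = "\<lambda>i. r ^ (2 * (i + 1))"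
    have inj: "inj_on ?x {..<n}"
      by (rule inj_onI) (use r in \<open>simp add: power_inject_exp[OF r]\<close>)
    have ff: "ff y = poly fpoly y" for y by (simp only: ff_def fpoly_eval)
    define h where "h = r - 1"
    have h: "h \<noteq> 0" using r by (simp add: h_def)
    have hp: "(\<Prod>i<n. h ^ (2 * i + 1)) = (\<Prod>j<n. h * (\<Prod>i<j. h * h))"
      by (simp add: power_mult power2_eq_square)
    have k: "?K r = (\<Prod>j<n. h * (\<Prod>i<j. h * h)) * ((\<Prod>i<n. 1 / (1 - ?x i)) * (\<Prod>j<n. \<Prod>i<j. 1 / ((?x j - ?x i) * (1 - ?x i * ?x j))))"
    proof -
      have 1: "1 / (u / h) = h * (1 / u)" "1 / (u / h * (v / h)) = (h * h) * (1 / (u * v))" for u v by simp_all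
      have 2: "r ^ (2 * (i + 1) + 2 * (j + 1)) = ?x i * ?x j" for i j by (rule power_add)
      show ?thesis
        unfolding h_def[symmetric] 1 2 power_0 by (simp only: prod.distrib mult_ac)
    qed
    have "(\<Prod>j<n. h * (\<Prod>i<j. h * h)) \<noteq> 0" using h by (simp add: prod_zero_iff)
    then have cancel: "(\<Prod>j<n. h * (\<Prod>i<j. h * h)) * C * (D / (\<Prod>j<n. h * (\<Prod>i<j. h * h))) = C * D" for C D
      by simp
    show "?K r * (?D r / (\<Prod>i<n. (r - 1) ^ (2 * i + 1))) = Q N (?x ` {..<n})"
      unfolding Q_image[OF inj] ff unfolding k unfolding h_def[symmetric] unfolding hp by (rule cancel)
  qed
  ultimately have "((\<lambda>r::real. Q N ((\<lambda>i. r ^ (2 * (i + 1))) ` {..<n})) \<longlongrightarrow>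
    (\<Prod>j<n. (1 / (real 0 - real (2 * (j + 1)))) * (\<Prod>i<j. 1 / ((real (2 * (j + 1)) - real (2 * (i + 1))) * (real 0 - real (2 * (i + 1) + 2 * (j + 1)))))) *
    (2 ^ n * moment_det n (real ?M))) (at_right 1)"
    by (rule Lim_transform_eventually)
  then show ?thesis by (simp only: of_nat_0)
qed

lemma AGT_weight_limit:
  "((\<lambda>r::real. AGT_weight (\<lambda>i. r ^ (2 * i)) n a d) \<longlongrightarrow> 1) (at_right 1)"
proof -
  have "((\<lambda>r::real. (r ^ (2 * Suc i)) powi p) \<longlongrightarrow> (1 ^ (2 * Suc i)) powi p) (at_right 1)" for i p
    by (intro tendsto_power_int tendsto_power tendsto_ident_at) simp
  then have "((\<lambda>r::real. AGT_weight (\<lambda>i. r ^ (2 * i)) n a d) \<longlongrightarrow> (\<Prod>i<n. (1 ^ (2 * Suc i)) powi (\<Sum>j<Suc i. a (Suc i) (Suc j) + up (d (Suc i) (Suc j)) - dn (d (Suc i) (Suc j))) *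
     (1 ^ (2 * Suc i)) powi (- (\<Sum>j<i. a i (Suc j))))) (at_right 1)"
    unfolding AGT_weight_def by (intro tendsto_prod tendsto_mult)
  then show ?thesis by simp
qed

text \<open>The weighted identity is compared on both sides as r decreases to 1; for r > 1 the
  variables are distinct and exceed 1, the weights tend to 1 and each row factor to 3.\<close>

lemma AGT_set_sum_limit:
  "(\<Sum>(a, d)\<in>AGT_set n m. real_of_int (sgn_AGT n a d)) = 3 ^ n *
    ((\<Prod>j<n. (1 / (0 - real (2 * (j + 1)))) * (\<Prod>i<j. 1 / ((real (2 * (j + 1)) - real (2 * (i + 1))) * (0 - real (2 * (i + 1) + 2 * (j + 1)))))) *
    (2 ^ n * moment_det n (real (Suc m + 2 * n - 2))))"
proof (rule tendsto_unique[of "at_right (1::real)"])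
  let ?x = "\<lambda>r::real. \<lambda>i. r ^ (2 * i)"
  let ?W = "\<lambda>r. \<Sum>(a, d)\<in>AGT_set n m. real_of_int (sgn_AGT n a d) * AGT_weight (?x r) n a d"
  have "(?W \<longlongrightarrow> (\<Sum>(a, d)\<in>AGT_set n m. real_of_int (sgn_AGT n a d) * 1)) (at_right 1)"
    unfolding case_prod_unfold by (intro tendsto_sum tendsto_mult tendsto_const AGT_weight_limit)
  then show "(?W \<longlongrightarrow> (\<Sum>(a, d)\<in>AGT_set n m. real_of_int (sgn_AGT n a d))) (at_right 1)" by simp
  have "((\<lambda>r. \<Prod>i=1..n. 1 + ?x r i + 1 / ?x r i) \<longlongrightarrow> (\<Prod>i=1..n. 1 + 1 ^ (2 * i) + 1 / 1 ^ (2 * i))) (at_right 1)"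
    by (intro tendsto_intros) simp
  then have c: "((\<lambda>r. \<Prod>i=1..n. 1 + ?x r i + 1 / ?x r i) \<longlongrightarrow> 3 ^ n) (at_right 1)" by simp
  have lim: "((\<lambda>r. (\<Prod>i=1..n. 1 + ?x r i + 1 / ?x r i) * Q (Suc m) ((\<lambda>i. r ^ (2 * (i + 1))) ` {..<n})) \<longlongrightarrow> 3 ^ n *
    ((\<Prod>j<n. (1 / (0 - real (2 * (j + 1)))) * (\<Prod>i<j. 1 / ((real (2 * (j + 1)) - real (2 * (i + 1))) * (0 - real (2 * (i + 1) + 2 * (j + 1)))))) *
    (2 ^ n * moment_det n (real (Suc m + 2 * n - 2))))) (at_right 1)"
    by (rule tendsto_mult[OF c Q_limit])
  have ev: "\<forall>\<^sub>F r in at_right 1. (\<Prod>i=1..n. 1 + ?x r i + 1 / ?x r i) * Q (Suc m) ((\<lambda>i. r ^ (2 * (i + 1))) ` {..<n}) = ?W r"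
  proof (rule eventually_at_right_less[THEN eventually_mono])
    fix r :: real assume r: "1 < r"
    have inj: "inj_on (?x r) {1..n}"
      by (rule inj_onI) (use r in \<open>simp add: power_inject_exp[OF r]\<close>)
    have "{1..n} = Suc ` {..<n}" by (simp add: image_Suc_lessThan)
    then have im: "?x r ` {1..n} = (\<lambda>i. r ^ (2 * (i + 1))) ` {..<n}" by (simp add: image_image)
    have gt: "x > 1" if "x \<in> ?x r ` {1..n}" for x
      using that r by (auto intro!: one_less_power)
    have "G_sum (Suc m) (?x r ` {1..n}) = Q (Suc m) (?x r ` {1..n})"
      by (rule G_sum_eq_Q) (use gt in auto)
    then show "(\<Prod>i=1..n. 1 + ?x r i + 1 / ?x r i) * Q (Suc m) ((\<lambda>i. r ^ (2 * (i + 1))) ` {..<n}) = ?W r"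
      unfolding im[symmetric] using AGT_set_weighted_sum[OF inj, of m] r by simp
  qed
  show "(?W \<longlongrightarrow> 3 ^ n *
    ((\<Prod>j<n. (1 / (0 - real (2 * (j + 1)))) * (\<Prod>i<j. 1 / ((real (2 * (j + 1)) - real (2 * (i + 1))) * (0 - real (2 * (i + 1) + 2 * (j + 1)))))) *
    (2 ^ n * moment_det n (real (Suc m + 2 * n - 2))))) (at_right 1)"
    by (rule Lim_transform_eventually[OF lim ev])
qed simp

section \<open>Collecting the constants\<close>

lemma pochhammer_diagonal: "pochhammer (real (Suc j)) (Suc j) = real (Suc j) * (\<Prod>i<j. real (i + j + 2))"
  unfolding pochhammer_prod prod.lessThan_Suc_shift[symmetric] lessThan_atLeast0[symmetric] prod.lessThan_Suc_shift
  by (simp add: add_ac)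

text \<open>All factors of index \<open>j\<close>: 3 from the row factor, 2 from the moment limit,
  then the denominator of \<open>x_j\<close>, the column constant and the pairs below
  \<open>j\<close>. Each pair leaves -1/2 over i + j + 2, and (-6)(-1/2) = 3 yields the power of
  3.\<close>

lemma constant_factor:
  "3 * 2 * (1 / (0 - real (2 * (j + 1)))) * (- ((-6) ^ j)) *
   (\<Prod>i<j. 1 / ((real (2 * (j + 1)) - real (2 * (i + 1))) * (0 - real (2 * (i + 1) + 2 * (j + 1)))) * (2 * (real j - real i))) =
   3 ^ Suc j / pochhammer (real (Suc j)) (Suc j)"
proof -
  have "(\<Prod>i<j. 1 / ((real (2 * (j + 1)) - real (2 * (i + 1))) * (0 - real (2 * (i + 1) + 2 * (j + 1)))) * (2 * (real j - real i))) =
    (\<Prod>i<j. (-1/2) / real (i + j + 2))"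
  proof (rule prod.cong[OF refl])
    fix i assume i: "i \<in> {..<j}"
    define b c where "b = real j - real i" and "c = real (i + j + 2)"
    have nz: "b \<noteq> 0" "c \<noteq> 0" using i by (auto simp: b_def c_def)
    have 1: "real (2 * (j + 1)) - real (2 * (i + 1)) = 2 * b" "0 - real (2 * (i + 1) + 2 * (j + 1)) = - (2 * c)"
      by (simp_all add: b_def c_def)
    show "1 / ((real (2 * (j + 1)) - real (2 * (i + 1))) * (0 - real (2 * (i + 1) + 2 * (j + 1)))) * (2 * (real j - real i)) = (-1/2) / real (i + j + 2)"
      unfolding 1 b_def[symmetric] c_def[symmetric] using nz by (simp add: field_simps)
  qed
  also have "\<dots> = (-1/2) ^ j / (\<Prod>i<j. real (i + j + 2))"
    unfolding prod_dividef[of "\<lambda>_. -1/2"] by (simp only: prod_constant card_lessThan)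
  finally have P: "(\<Prod>i<j. 1 / ((real (2 * (j + 1)) - real (2 * (i + 1))) * (0 - real (2 * (i + 1) + 2 * (j + 1)))) * (2 * (real j - real i))) =
    (-1/2) ^ j / (\<Prod>i<j. real (i + j + 2))" .
  have s: "(-6 :: real) ^ j * (-1/2) ^ j = 3 ^ j" by (simp flip: power_mult_distrib)
  have "3 * 2 * (1 / (0 - real (2 * (j + 1)))) * (- ((-6) ^ j)) = 3 * ((-6) ^ j / real (Suc j))"
    by (simp add: field_simps)
  then have "3 * 2 * (1 / (0 - real (2 * (j + 1)))) * (- ((-6) ^ j)) * ((-1/2) ^ j / (\<Prod>i<j. real (i + j + 2))) =
     3 * ((-6) ^ j * (-1/2) ^ j) / (real (Suc j) * (\<Prod>i<j. real (i + j + 2)))"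
    by simp
  then show ?thesis
    unfolding P pochhammer_diagonal s by simp
qed

lemma prod_power_Suc_triangle: "(\<Prod>j<n. (3::real) ^ Suc j) = 3 ^ ((n + 1) choose 2)"
proof (induction n)
  case (Suc n)
  have "(Suc n + 1) choose 2 = ((n + 1) choose 2) + Suc n"
    by (simp add: numeral_2_eq_2)
  then show ?case using Suc by (simp add: power_add)
qed (simp add: numeral_2_eq_2)

lemma pochhammer_shifted:
  "(\<Prod>v\<in>{2*l..3*l}. M - real v) = pochhammer (M - 3 * real l) (Suc l)"
proof -
  have "(\<Prod>v\<in>{2*l..3*l}. M - real v) = (\<Prod>i\<in>{0..l}. M - 3 * real l + real i)"
    by (rule prod.reindex_bij_witness[of _ "\<lambda>i. 3 * l - i" "\<lambda>v. 3 * l - v"]) auto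
  then show ?thesis by (simp add: pochhammer_prod atLeastLessThanSuc_atLeastAtMost)
qed

theorem theorem1p2:
  fixes n m :: nat
  assumes "n \<ge> 1"
  shows "(\<Sum>(a, d)\<in>AGT_set n m. real_of_int (sgn_AGT n a d)) =
         3 ^ ((n + 1) choose 2) *
         (\<Prod>i=1..n. pochhammer (real_of_int (2 * int n + int m + 2 - 3 * int i)) i
                      / pochhammer (real i) i)"
proof -
  define M where "M = real (Suc m + 2 * n - 2)"
  \<comment> \<open>For n at least 1 the natural subtraction is exact; with i = j + 1, M - 3j is
    then the required argument 2n + m + 2 - 3i.\<close>
  have M: "M = 2 * real n + real m - 1" using assms by (simp add: M_def)
  let ?a = "\<lambda>j. 1 / (0 - real (2 * (j + 1)))"
  let ?b = "\<lambda>j i. 1 / ((real (2 * (j + 1)) - real (2 * (i + 1))) * (0 - real (2 * (i + 1) + 2 * (j + 1))))"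
  let ?P = "\<lambda>l. \<Prod>v\<in>{2*l..3*l}. M - real v"
  have "(\<Sum>(a, d)\<in>AGT_set n m. real_of_int (sgn_AGT n a d)) =
      (\<Prod>j<n. 3 :: real) * ((\<Prod>j<n. ?a j * (\<Prod>i<j. ?b j i)) * ((\<Prod>j<n. 2) *
        ((\<Prod>j<n. - ((-6) ^ j)) * (\<Prod>j<n. \<Prod>i<j. 2 * (real j - real i)) * (\<Prod>l<n. ?P l))))"
    unfolding AGT_set_sum_limit M_def[symmetric] moment_det_eq moment_const_def
    by (simp only: prod_constant card_lessThan)
  also have "\<dots> = (\<Prod>j<n. (3 * 2 * ?a j * (- ((-6) ^ j)) * (\<Prod>i<j. ?b j i * (2 * (real j - real i)))) * ?P j)"
    by (simp only: prod.distrib mult_ac)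
  also have "\<dots> = (\<Prod>j<n. 3 ^ Suc j * (pochhammer (M - 3 * real j) (Suc j) / pochhammer (real (Suc j)) (Suc j)))"
    by (rule prod.cong[OF refl]) (simp only: constant_factor pochhammer_shifted, simp only: times_divide_eq_left times_divide_eq_right)
  also have "\<dots> = 3 ^ ((n + 1) choose 2) *
      (\<Prod>j<n. pochhammer (M - 3 * real j) (Suc j) / pochhammer (real (Suc j)) (Suc j))"
    unfolding prod.distrib prod_power_Suc_triangle ..
  also have "(\<Prod>j<n. pochhammer (M - 3 * real j) (Suc j) / pochhammer (real (Suc j)) (Suc j)) =
      (\<Prod>i=1..n. pochhammer (real_of_int (2 * int n + int m + 2 - 3 * int i)) i / pochhammer (real i) i)"
  proof (rule prod.reindex_bij_witness[of _ "\<lambda>i. i - 1" Suc])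
    fix j assume "j \<in> {..<n}"
    have "real_of_int (2 * int n + int m + 2 - 3 * int (Suc j)) = M - 3 * real j"
      by (simp add: M)
    then show "pochhammer (real_of_int (2 * int n + int m + 2 - 3 * int (Suc j))) (Suc j) / pochhammer (real (Suc j)) (Suc j) =
        pochhammer (M - 3 * real j) (Suc j) / pochhammer (real (Suc j)) (Suc j)"
      by (simp only:)
  qed auto
  finally show ?thesis .
qed

end
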